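(* Let $A$ be a basic finite dimensional algebra over a field $K$, and let $n$ be the number of isomorphism classes of simple $A$-modules. Let $(T,P)=(X_1\oplus\cdots\oplus X_r,\; X_{r+1}\oplus\cdots\oplus X_n)$ and $(T',P')=(Y_1\oplus\cdots\oplus Y_{r'},\; Y_{r'+1}\oplus\cdots\oplus Y_n)$ be two basic support $\tau$-tilting pairs over $A$ such that the modules $X_i$ and $Y_i$ are indecomposable for every $i\in\{1,\dots,n\}$. Then there is a permutation $s\in S_n$ such that the bijection $\{X_1,\dots,X_n\}\to\{Y_1,\dots,Y_n\}$ sending $X_i$ to $Y_{s(i)}$ for every $i$ has the property that, for every $i\in\{1,\dots,n\}$, the two modules $X_i$ and $Y_{s(i)}$ satisfy at least one of the following conditions: (a) $X_i$ is isomorphic to $Y_{s(i)}$; (b) $X_i\oplus Y_{s(i)}$ is not $\tau$-rigid; (c) $Y_{s(i)}\in\operatorname{add}P'$ but the pair $(X_i,Y_{s(i)})$ is not $\tau$-rigid; (d) $X_i\in\operatorname{add}P$ but the pair $(Y_{s(i)},X_i)$ is not $\tau$-rigid.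
   Context: Modules are finitely generated left $A$-modules, and $\tau$ denotes the Auslander--Reiten translation. For a finitely generated module $M$, $\operatorname{add}M$ is the class of all finite direct sums of direct summands of $M$. A module is basic if its indecomposable direct summands in a decomposition into indecomposables are pairwise non-isomorphic. A finitely generated $A$-module $T$ is $\tau$-rigid if $\operatorname{Hom}_A(T,\tau T)=0$. For a finitely generated module $T$ and a finitely generated projective module $P$, the pair $(T,P)$ is a $\tau$-rigid pair (or: is $\tau$-rigid) if $T$ is $\tau$-rigid and $\operatorname{Hom}_A(P,T)=0$. The pair $(T,P)$ is a support $\tau$-tilting pair if it is a $\tau$-rigid pair and the number of isomorphism classes of indecomposable direct summands of $T\oplus P$ is $n$. A support $\tau$-tilting pair $(T,P)$ is basic if both $T$ and $P$ (and hence also $T\oplus P$) are basic modules. The integers $r,r'$ satisfy $0\le r,r'\le n$, and an empty direct sum is the zero module. *)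

theory Defs
  imports Complex_Main "HOL-Library.Function_Algebras" "HOL-Library.Product_Plus"
    "HOL-Combinatorics.Permutations"
begin

text \<open>
  The sort \<open>{ring, monoid_mult}\<close> is that of unital associative rings; unlike \<open>ring_1\<close> it does not
  exclude the zero ring.
\<close>

locale fd_algebra = vector_space scale
  for scale :: "'k::field \<Rightarrow> 'a::{ring,monoid_mult} \<Rightarrow> 'a" +
  assumes scale_mult_left: "scale c (x * y) = scale c x * y"
    and scale_mult_right: "scale c (x * y) = x * scale c y"
    and finite_dimensional: "\<exists>B. finite B \<and> span B = UNIV"


section \<open>Left modules\<close>

text \<open>
  A module consists of a subgroup of an ambient abelian group together with an action of the ring.
  Values of the action outside the subgroup are irrelevant.
\<close>

record ('a, 'm) lmod =
  mcar :: "'m set"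
  act :: "'a \<Rightarrow> 'm \<Rightarrow> 'm"

text \<open>
  Definitions that have to choose or to range over modules unrelated to the types at hand use the
  ambient group of all sequences in the algebra. Over a finite dimensional algebra every finitely
  generated module has an isomorphic copy there: it is a quotient of some free module of finite
  rank, and the module structure can be carried over to a linear complement of the kernel.
\<close>

type_synonym 'a seqmod = "('a, nat \<Rightarrow> 'a) lmod"

definition left_module :: "('a::{ring,monoid_mult}, 'm::ab_group_add) lmod \<Rightarrow> bool" where
  "left_module M \<longleftrightarrow>
     0 \<in> mcar M \<and>
     (\<forall>x\<in>mcar M. \<forall>y\<in>mcar M. x + y \<in> mcar M) \<and>
     (\<forall>x\<in>mcar M. - x \<in> mcar M) \<and>
     (\<forall>a. \<forall>x\<in>mcar M. act M a x \<in> mcar M) \<and>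
     (\<forall>a. \<forall>x\<in>mcar M. \<forall>y\<in>mcar M. act M a (x + y) = act M a x + act M a y) \<and>
     (\<forall>a b. \<forall>x\<in>mcar M. act M (a + b) x = act M a x + act M b x) \<and>
     (\<forall>a b. \<forall>x\<in>mcar M. act M (a * b) x = act M a (act M b x)) \<and>
     (\<forall>x\<in>mcar M. act M 1 x = x)"

definition fg_module :: "('a::{ring,monoid_mult}, 'm::ab_group_add) lmod \<Rightarrow> bool" where
  "fg_module M \<longleftrightarrow> left_module M \<and>
     (\<exists>S. finite S \<and> S \<subseteq> mcar M \<and> (\<forall>x\<in>mcar M. \<exists>c. x = (\<Sum>s\<in>S. act M (c s) s)))"

definition regular :: "('a::{ring,monoid_mult}, 'a) lmod" where
  "regular = \<lparr>mcar = UNIV, act = (*)\<rparr>"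

text \<open>
  Homomorphisms are extended by zero outside the domain, so that they form a group under pointwise
  addition and are closed under composition.
\<close>

definition Hom :: "('a::{ring,monoid_mult}, 'm::ab_group_add) lmod \<Rightarrow> ('a, 'n::ab_group_add) lmod
    \<Rightarrow> ('m \<Rightarrow> 'n) set" where
  "Hom M N = {f.
     (\<forall>x\<in>mcar M. f x \<in> mcar N) \<and>
     (\<forall>x\<in>mcar M. \<forall>y\<in>mcar M. f (x + y) = f x + f y) \<and>
     (\<forall>a. \<forall>x\<in>mcar M. f (act M a x) = act N a (f x)) \<and>
     (\<forall>x. x \<notin> mcar M \<longrightarrow> f x = 0)}"

definition iso_mod :: "('a::{ring,monoid_mult}, 'm::ab_group_add) lmod
    \<Rightarrow> ('a, 'n::ab_group_add) lmod \<Rightarrow> bool" (infix "\<cong>" 50) where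
  "M \<cong> N \<longleftrightarrow> (\<exists>f\<in>Hom M N. bij_betw f (mcar M) (mcar N))"

definition submod :: "'m set \<Rightarrow> ('a::{ring,monoid_mult}, 'm::ab_group_add) lmod \<Rightarrow> bool" where
  "submod U M \<longleftrightarrow> U \<subseteq> mcar M \<and> left_module (M\<lparr>mcar := U\<rparr>)"

definition ker :: "('a::{ring,monoid_mult}, 'm::ab_group_add) lmod \<Rightarrow> ('m \<Rightarrow> 'n::ab_group_add)
    \<Rightarrow> 'm set" where
  "ker M f = {x \<in> mcar M. f x = 0}"

definition msum :: "('a::{ring,monoid_mult}, 'm::ab_group_add) lmod \<Rightarrow> ('a, 'n::ab_group_add) lmod
    \<Rightarrow> ('a, 'm \<times> 'n) lmod" (infixr "\<oplus>" 65) where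
  "M \<oplus> N = \<lparr>mcar = mcar M \<times> mcar N, act = (\<lambda>a (x, y). (act M a x, act N a y))\<rparr>"

text \<open>Used for finite index sets only.\<close>

definition dsum :: "'i set \<Rightarrow> ('i \<Rightarrow> ('a::{ring,monoid_mult}, 'm::ab_group_add) lmod)
    \<Rightarrow> ('a, 'i \<Rightarrow> 'm) lmod" where
  "dsum I X = \<lparr>mcar = {f. (\<forall>i\<in>I. f i \<in> mcar (X i)) \<and> (\<forall>i. i \<notin> I \<longrightarrow> f i = 0)},
               act = (\<lambda>a f i. if i \<in> I then act (X i) a (f i) else 0)\<rparr>"

definition indecomposable :: "('a::{ring,monoid_mult}, 'm::ab_group_add) lmod \<Rightarrow> bool" where
  "indecomposable M \<longleftrightarrow> left_module M \<and> mcar M \<noteq> {0} \<and>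
     (\<forall>(U :: ('a, 'm) lmod) (V :: ('a, 'm) lmod). left_module U \<and> left_module V \<and> M \<cong> U \<oplus> V \<longrightarrow>
        mcar U = {0} \<or> mcar V = {0})"

definition simple_mod :: "('a::{ring,monoid_mult}, 'm::ab_group_add) lmod \<Rightarrow> bool" where
  "simple_mod M \<longleftrightarrow> left_module M \<and> mcar M \<noteq> {0} \<and>
     (\<forall>U. submod U M \<longrightarrow> U = {0} \<or> U = mcar M)"

definition direct_summand :: "('a::{ring,monoid_mult}, 'n::ab_group_add) lmod
    \<Rightarrow> ('a, 'm::ab_group_add) lmod \<Rightarrow> bool" where
  "direct_summand N M \<longleftrightarrow> left_module N \<and>
     (\<exists>V :: ('a, 'm) lmod. left_module V \<and> N \<oplus> V \<cong> M)"

definition in_add :: "('a::{ring,monoid_mult}, 'n::ab_group_add) lmod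
    \<Rightarrow> ('a, 'm::ab_group_add) lmod \<Rightarrow> bool" where
  "in_add N M \<longleftrightarrow> left_module N \<and>
     (\<exists>m (Z :: nat \<Rightarrow> ('a, 'm) lmod).
        (\<forall>j<m. direct_summand (Z j) M) \<and> N \<cong> dsum {..<m} Z)"

definition basic_module :: "('a::{ring,monoid_mult}, 'm::ab_group_add) lmod \<Rightarrow> bool" where
  "basic_module M \<longleftrightarrow> fg_module M \<and>
     (\<forall>m (Z :: nat \<Rightarrow> ('a, 'm) lmod).
        (\<forall>j<m. indecomposable (Z j)) \<and> M \<cong> dsum {..<m} Z \<longrightarrow>
        (\<forall>j<m. \<forall>k<m. j \<noteq> k \<longrightarrow> \<not> Z j \<cong> Z k))"

definition iso_rel :: "(('a::{ring,monoid_mult}, 'm::ab_group_add) lmod \<times> ('a, 'm) lmod) set" where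
  "iso_rel = {(M, N). left_module M \<and> left_module N \<and> M \<cong> N}"

definition num_simples :: "'a::{ring,monoid_mult} itself \<Rightarrow> nat" where
  "num_simples _ = card ({S :: 'a seqmod. simple_mod S} // iso_rel)"

definition num_ind_summands :: "('a::{ring,monoid_mult}, 'm::ab_group_add) lmod \<Rightarrow> nat" where
  "num_ind_summands M =
     card ({U :: ('a, 'm) lmod. indecomposable U \<and> direct_summand U M} // iso_rel)"


section \<open>Projective modules and the Auslander--Reiten translation\<close>

text \<open>
  The lifting property is tested on the types available in the definition. For finitely generated
  \<open>P\<close> this is no restriction: it covers the epimorphisms from free modules of finite rank to \<open>P\<close>.
\<close>

definition projective :: "('a::{ring,monoid_mult}, 'm::ab_group_add) lmod \<Rightarrow> bool" where
  "projective P \<longleftrightarrow> left_module P \<and>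
     (\<forall>(M :: 'a seqmod) (N :: ('a, 'm) lmod) g f.
        left_module M \<and> left_module N \<and> g \<in> Hom M N \<and> g ` mcar M = mcar N \<and> f \<in> Hom P N \<longrightarrow>
        (\<exists>h\<in>Hom P M. g \<circ> h = f))"

definition superfluous :: "'m set \<Rightarrow> ('a::{ring,monoid_mult}, 'm::ab_group_add) lmod \<Rightarrow> bool" where
  "superfluous L P \<longleftrightarrow> submod L P \<and>
     (\<forall>U. submod U P \<and> {u + l | u l. u \<in> U \<and> l \<in> L} = mcar P \<longrightarrow> U = mcar P)"

definition projective_cover :: "('a::{ring,monoid_mult}, 'p::ab_group_add) lmod \<Rightarrow> ('p \<Rightarrow> 'm)
    \<Rightarrow> ('a, 'm::ab_group_add) lmod \<Rightarrow> bool" where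
  "projective_cover P p M \<longleftrightarrow> fg_module P \<and> projective P \<and> p \<in> Hom P M \<and>
     p ` mcar P = mcar M \<and> superfluous (ker P p) P"

text \<open>\<open>P1 \<rightarrow> P0 \<rightarrow> M \<rightarrow> 0\<close> with maps \<open>p1\<close> and \<open>p0\<close>.\<close>

definition min_proj_presentation :: "('a::{ring,monoid_mult}, 'm::ab_group_add) lmod
    \<Rightarrow> 'a seqmod \<Rightarrow> ((nat \<Rightarrow> 'a) \<Rightarrow> (nat \<Rightarrow> 'a)) \<Rightarrow> 'a seqmod \<Rightarrow> ((nat \<Rightarrow> 'a) \<Rightarrow> 'm) \<Rightarrow> bool" where
  "min_proj_presentation M P1 p1 P0 p0 \<longleftrightarrow>
     projective_cover P0 p0 M \<and> projective_cover P1 p1 (P0\<lparr>mcar := ker P0 p0\<rparr>)"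

text \<open>
  For a homomorphism \<open>p1\<close> from \<open>P1\<close> to \<open>P0\<close>, the dual \<open>D (Coker (Hom (p1, A)))\<close> of the cokernel of
  the map \<open>Hom (P0, A) \<rightarrow> Hom (P1, A)\<close>, \<open>h \<mapsto> h \<circ> p1\<close>, of right modules, where \<open>D\<close> is the duality
  over the base field. Linear forms on the cokernel are taken as linear forms on \<open>Hom (P1, A)\<close>
  that vanish on the image of the map; so this is also the kernel of the map induced by \<open>p1\<close> between
  the Nakayama modules \<open>D (Hom (P1, A))\<close> and \<open>D (Hom (P0, A))\<close>. As the algebra acts on
  \<open>Hom (P1, A)\<close> from the right by \<open>(h a) x = h x * a\<close>, it acts on linear forms from the left.
\<close>

definition dual_transpose :: "('k::field \<Rightarrow> 'a::{ring,monoid_mult} \<Rightarrow> 'a) \<Rightarrow> 'a seqmod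
    \<Rightarrow> ((nat \<Rightarrow> 'a) \<Rightarrow> (nat \<Rightarrow> 'a)) \<Rightarrow> 'a seqmod \<Rightarrow> ('a, ((nat \<Rightarrow> 'a) \<Rightarrow> 'a) \<Rightarrow> 'k) lmod" where
  "dual_transpose scale P1 p1 P0 =
     \<lparr>mcar = {\<phi>.
        (\<forall>h\<in>Hom P1 regular. \<forall>h'\<in>Hom P1 regular. \<phi> (h + h') = \<phi> h + \<phi> h') \<and>
        (\<forall>c. \<forall>h\<in>Hom P1 regular. \<phi> (\<lambda>x. scale c (h x)) = c * \<phi> h) \<and>
        (\<forall>h. h \<notin> Hom P1 regular \<longrightarrow> \<phi> h = 0) \<and>
        (\<forall>h\<in>Hom P0 regular. \<phi> (h \<circ> p1) = 0)},
      act = (\<lambda>a \<phi> h. if h \<in> Hom P1 regular then \<phi> (\<lambda>x. h x * a) else 0)\<rparr>"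

definition tau :: "('k::field \<Rightarrow> 'a::{ring,monoid_mult} \<Rightarrow> 'a) \<Rightarrow> ('a, 'm::ab_group_add) lmod
    \<Rightarrow> ('a, ((nat \<Rightarrow> 'a) \<Rightarrow> 'a) \<Rightarrow> 'k) lmod" where
  "tau scale M =
     (case (SOME (P1, p1, P0, p0). min_proj_presentation M P1 p1 P0 p0) of
        (P1, p1, P0, p0) \<Rightarrow> dual_transpose scale P1 p1 P0)"


section \<open>Support tau-tilting pairs\<close>

definition tau_rigid :: "('k::field \<Rightarrow> 'a::{ring,monoid_mult} \<Rightarrow> 'a)
    \<Rightarrow> ('a, 'm::ab_group_add) lmod \<Rightarrow> bool" where
  "tau_rigid scale T \<longleftrightarrow> fg_module T \<and> Hom T (tau scale T) = {0}"

definition tau_rigid_pair :: "('k::field \<Rightarrow> 'a::{ring,monoid_mult} \<Rightarrow> 'a)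
    \<Rightarrow> ('a, 'm::ab_group_add) lmod \<Rightarrow> ('a, 'p::ab_group_add) lmod \<Rightarrow> bool" where
  "tau_rigid_pair scale T P \<longleftrightarrow>
     tau_rigid scale T \<and> fg_module P \<and> projective P \<and> Hom P T = {0}"

definition support_tau_tilting_pair :: "('k::field \<Rightarrow> 'a::{ring,monoid_mult} \<Rightarrow> 'a)
    \<Rightarrow> ('a, 'm::ab_group_add) lmod \<Rightarrow> ('a, 'p::ab_group_add) lmod \<Rightarrow> bool" where
  "support_tau_tilting_pair scale T P \<longleftrightarrow>
     tau_rigid_pair scale T P \<and> num_ind_summands (T \<oplus> P) = num_simples TYPE('a)"

definition basic_support_tau_tilting_pair :: "('k::field \<Rightarrow> 'a::{ring,monoid_mult} \<Rightarrow> 'a)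
    \<Rightarrow> ('a, 'm::ab_group_add) lmod \<Rightarrow> ('a, 'p::ab_group_add) lmod \<Rightarrow> bool" where
  "basic_support_tau_tilting_pair scale T P \<longleftrightarrow>
     support_tau_tilting_pair scale T P \<and> basic_module T \<and> basic_module P"

end

theory Submission
  imports Defs
begin

text \<open>
  By Hall's marriage theorem it suffices to see that, for a set of \<open>X\<^sub>i\<close> and a set of \<open>Y\<^sub>j\<close> such that
  none of the conditions (a)--(d) holds between them, the two sets together have at most \<open>n\<close> members.
  Such a union is again the set of summands of a \<open>\<tau>\<close>-rigid pair, so one needs that a \<open>\<tau>\<close>-rigid pair
  has at most \<open>n\<close> non-isomorphic indecomposable summands.

  Let \<open>R\<^sub>1 \<rightarrow> R\<^sub>0 \<rightarrow> M\<close> be minimal projective presentations of the module summands \<open>M\<close> and put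
  \<open>\<theta>\<^sub>M(X) = dim Hom(R\<^sub>0, X) - dim Hom(R\<^sub>1, X)\<close>, and \<open>\<theta>\<^sub>Q(X) = dim Hom(Q, X)\<close> for the projective
  summands \<open>Q\<close>. These functions are additive on short exact sequences, hence determined by their values
  on the \<open>n\<close> simple modules; if there are more than \<open>n\<close> of them, they satisfy a linear relation with
  coefficients \<open>c\<close>. On a quotient \<open>X\<close> of a summand, \<open>\<theta>\<^sub>M(X) = dim Hom(M, X)\<close> and \<open>\<theta>\<^sub>Q(X) = 0\<close> by rigidity.
  Evaluating the relation on the quotient of \<open>M\<close> by the trace of the summands whose coefficient has the
  sign opposite to that of \<open>c\<^sub>M\<close> shows that this quotient vanishes. Iterating, every element of \<open>M\<close> is
  a sum of values of arbitrarily long compositions of non-isomorphisms between indecomposables, and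
  these are zero by the lemma of Harada and Sai. So \<open>c\<^sub>M = 0\<close>; the projective summands are treated by
  the same argument with \<open>R\<^sub>1 = 0\<close>.
\<close>

section \<open>Linear algebra\<close>

text \<open>The translate is built from an arbitrarily chosen presentation and lives on a type of
  its own, so it is unsuited to comparing many modules. It is therefore eliminated at once: the
  absence of nonzero maps from N to the translate of M yields that every map R1 \<rightarrow> N
  factors through the presentation R1 \<rightarrow> R0 of M. This property (\<open>factors\<close>)
  passes to quotients of N, because R1 is projective, and hence to sums of submodules that have it;
  it is also the surjectivity that makes dim Hom(R0, N) - dim Hom(R1, N) equal to dim Hom(M, N). The
  failure of (b) gives it only for a presentation of a direct sum X_i \<oplus> Y_j; minimality is
  what carries it over to the presentations of the two summands. The trace is divided out because
  the opposite-sign modules then have no nonzero map to the quotient, so all surviving terms of the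
  relation have the same sign. As the summands live on an arbitrary type, they are replaced by
  isomorphic copies on sequences in the algebra, where dimensions over the base field are
  available.\<close>

text \<open>
  Definitions added to \<open>vector_space\<close> itself would be shadowed by their instances for \<open>real_vector\<close>.
\<close>

locale vspace = vector_space
begin

text \<open>The ambient spaces are in general infinite dimensional, and \<open>dim\<close> is 0 on a
  set whose span has no finite basis. Finiteness is therefore a property of subsets, and the
  spanning set \<open>B\<close> need not lie in \<open>V\<close>.\<close>

definition fin_dim :: "'b set \<Rightarrow> bool" where
  "fin_dim V \<longleftrightarrow> (\<exists>B. finite B \<and> V \<subseteq> span B)"

lemma fin_dim_subset: "fin_dim W \<Longrightarrow> U \<subseteq> W \<Longrightarrow> fin_dim U"
  unfolding fin_dim_def by blast

lemma fin_dim_finite_independent: "fin_dim V \<Longrightarrow> B \<subseteq> V \<Longrightarrow> independent B \<Longrightarrow> finite B"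
  unfolding fin_dim_def using independent_span_bound by blast

lemma fin_dim_basis:
  assumes "fin_dim V"
  obtains B where "finite B" "B \<subseteq> V" "independent B" "V \<subseteq> span B" "card B = dim V"
  using basis_exists[of V] fin_dim_finite_independent[OF assms] by metis

lemma dim_mono_fin: assumes "fin_dim W" "U \<subseteq> W" shows "dim U \<le> dim W"
proof -
  obtain B where "finite B" "B \<subseteq> W" "W \<subseteq> span B" "card B = dim W"
    using fin_dim_basis[OF assms(1)] by metis
  then show ?thesis using dim_le_card[of U B] assms(2) by auto
qed

lemma subspace_eq_of_dim_le:
  assumes "fin_dim W" "subspace U" "U \<subseteq> W" "dim W \<le> dim U" shows "U = W"
proof (rule ccontr)
  assume "U \<noteq> W"
  then obtain w where w: "w \<in> W" "w \<notin> U" using assms(3) by blast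
  obtain B where B: "finite B" "B \<subseteq> U" "independent B" "U \<subseteq> span B" "card B = dim U"
    using fin_dim_basis[OF fin_dim_subset[OF assms(1,3)]] by metis
  have "span B \<subseteq> U" using B(2) assms(2) by (simp add: span_minimal)
  then have "w \<notin> span B" using w by blast
  then have I: "independent (insert w B)" and "w \<notin> B"
    using B(3) independent_insertI span_base by blast+
  have "dim (insert w B) \<le> dim W"
    using dim_mono_fin[OF assms(1)] w B(2) assms(3) by blast
  moreover have "dim (insert w B) = Suc (card B)"
    using dim_eq_card_independent[OF I] B(1) \<open>w \<notin> B\<close> by simp
  ultimately show False using B(5) assms(4) by linarith
qed

lemma dim_eq_0_fin: assumes "fin_dim V" "dim V = 0" shows "V \<subseteq> {0}"
proof -
  obtain B where "finite B" "V \<subseteq> span B" "card B = dim V"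
    using fin_dim_basis[OF assms(1)] by metis
  then show ?thesis using assms(2) by (simp add: span_empty)
qed

lemma dim_zero: "dim {0} = 0"
  using dim_unique[of "{}" "{0}" 0] by (simp add: independent_empty)

end

locale vspace_pair = vs1: vspace s1 + vs2: vspace s2
  for s1 :: "'a::field \<Rightarrow> 'b::ab_group_add \<Rightarrow> 'b" and s2 :: "'a \<Rightarrow> 'c::ab_group_add \<Rightarrow> 'c"
begin

sublocale vector_space_pair s1 s2 ..

text \<open>Module homomorphisms are linear only on their carrier, whereas the linear algebra of the
  library concerns globally linear maps. Values on a basis of \<open>V\<close> determine a global
  map that agrees with \<open>f\<close> on \<open>V\<close>.\<close>

lemma linear_on_extend:
  assumes V: "vs1.subspace V"
    and add: "\<And>x y. x \<in> V \<Longrightarrow> y \<in> V \<Longrightarrow> f (x + y) = f x + f y"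
    and sc: "\<And>c x. x \<in> V \<Longrightarrow> f (s1 c x) = s2 c (f x)"
  obtains g where "Vector_Spaces.linear s1 s2 g" "\<And>x. x \<in> V \<Longrightarrow> g x = f x"
proof -
  obtain B where B: "B \<subseteq> V" "vs1.independent B" "V \<subseteq> vs1.span B"
    by (rule vs1.basis_exists)
  obtain g where g: "Vector_Spaces.linear s1 s2 g" "\<forall>x\<in>B. g x = f x"
    using linear_independent_extend[OF B(2), of f] by blast
  interpret g: Vector_Spaces.linear s1 s2 g by (fact g(1))
  have f0: "f 0 = 0" using sc[of 0 0] V by (simp add: vs1.subspace_0)
  have "vs1.subspace {x \<in> V. g x = f x}"
    using V by (auto simp: vs1.subspace_def add sc g.add g.scale f0)
  then have "vs1.span B \<subseteq> {x \<in> V. g x = f x}"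
    using B(1) g(2) by (intro vs1.span_minimal) auto
  with B(3) have "\<And>x. x \<in> V \<Longrightarrow> g x = f x" by blast
  with g(1) show thesis by (rule that)
qed

text \<open>A basis \<open>B0\<close> of the kernel is extended to a basis \<open>B\<close> of
  \<open>V\<close>. A vector in the span of \<open>B - B0\<close> that is killed also lies in the
  span of \<open>B0\<close>, so comparing the two expansions shows that it is zero; hence
  \<open>B - B0\<close> maps injectively onto a basis of the image.\<close>

lemma rank_nullity:
  assumes fin: "vs1.fin_dim V" and V: "vs1.subspace V"
    and add: "\<And>x y. x \<in> V \<Longrightarrow> y \<in> V \<Longrightarrow> f (x + y) = f x + f y"
    and sc: "\<And>c x. x \<in> V \<Longrightarrow> f (s1 c x) = s2 c (f x)"
  shows "vs1.dim V = vs2.dim (f ` V) + vs1.dim {x \<in> V. f x = 0}" and "vs2.fin_dim (f ` V)"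
proof -
  obtain g where g: "Vector_Spaces.linear s1 s2 g" and gf: "\<And>x. x \<in> V \<Longrightarrow> g x = f x"
    using linear_on_extend[of V f, OF V add sc] by metis
  interpret g: Vector_Spaces.linear s1 s2 g by (fact g)
  let ?N = "{x \<in> V. f x = 0}"
  obtain B0 where B0: "B0 \<subseteq> ?N" "vs1.independent B0" "?N \<subseteq> vs1.span B0" "card B0 = vs1.dim ?N"
    by (rule vs1.basis_exists)
  have "B0 \<subseteq> V" using B0(1) by blast
  then obtain B where B: "B0 \<subseteq> B" "B \<subseteq> V" "vs1.independent B" "V \<subseteq> vs1.span B"
    using B0(2) by (rule vs1.maximal_independent_subset_extend)
  have finB: "finite B" using vs1.fin_dim_finite_independent[OF fin] B by blast
  have spV: "vs1.span B = V" using B V vs1.span_minimal by blast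
  have sp': "vs1.span (B - B0) \<subseteq> V" using spV vs1.span_mono[of "B - B0" B] by blast
  have inj: "inj_on g (vs1.span (B - B0))"
  proof -
    have "x = 0" if x: "x \<in> vs1.span (B - B0)" "g x = 0" for x
    proof -
      have "x \<in> V" using x(1) sp' by blast
      then have "x \<in> ?N" using x(2) gf[of x] by simp
      then have "x \<in> range (\<lambda>u. \<Sum>b\<in>B0. s1 (u b) b)"
        using B0(3) vs1.span_finite[OF finite_subset[OF B(1) finB]] by blast
      then obtain u where u: "x = (\<Sum>b\<in>B0. s1 (u b) b)" by blast
      have "x \<in> range (\<lambda>u. \<Sum>b\<in>B - B0. s1 (u b) b)"
        using x(1) vs1.span_finite[OF finite_Diff[OF finB, of B0]] by simp
      then obtain w where w: "x = (\<Sum>b\<in>B - B0. s1 (w b) b)" by blast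
      define v where "v b = (if b \<in> B0 then u b else - w b)" for b
      have "(\<Sum>b\<in>B. s1 (v b) b) = (\<Sum>b\<in>B0. s1 (v b) b) + (\<Sum>b\<in>B - B0. s1 (v b) b)"
        using sum.subset_diff[OF B(1) finB] by (simp add: add.commute)
      also have "(\<Sum>b\<in>B0. s1 (v b) b) = (\<Sum>b\<in>B0. s1 (u b) b)" by (simp add: v_def)
      also have "(\<Sum>b\<in>B - B0. s1 (v b) b) = - (\<Sum>b\<in>B - B0. s1 (w b) b)"
        by (simp add: v_def sum_negf)
      also have "(\<Sum>b\<in>B0. s1 (u b) b) + - (\<Sum>b\<in>B - B0. s1 (w b) b) = 0"
        using u w by (metis add.right_inverse)
      finally have "(\<Sum>b\<in>B. s1 (v b) b) = 0" .
      then have "\<forall>b\<in>B. v b = 0"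
        using B(3) finB vs1.independent_explicit_finite_subsets[of B, THEN iffD1, rule_format, OF B(3) subset_refl finB]
        by simp
      then have "\<forall>b\<in>B0. u b = 0" using B(1) by (metis v_def subsetD)
      then show "x = 0" using u by simp
    qed
    then show ?thesis
      unfolding linear_inj_on_iff_eq_0[OF g vs1.subspace_span] by simp
  qed
  have ind: "vs2.independent (g ` (B - B0))"
    using linear_independent_injective_image[OF g vs1.independent_mono[OF B(3) Diff_subset] inj] .
  have "f ` V = g ` V" using gf by simp
  also have "\<dots> = g ` vs1.span B" using spV by simp
  also have "\<dots> = vs2.span (g ` B)" using linear_span_image[OF g] by simp
  also have "\<dots> = vs2.span (g ` (B - B0))"
  proof -
    have "g ` B \<subseteq> insert 0 (g ` (B - B0))" using B0(1) gf by auto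
    then show ?thesis
      by (metis vs2.span_insert_0 vs2.span_mono Diff_subset image_mono subset_antisym)
  qed
  finally have im: "f ` V = vs2.span (g ` (B - B0))" .
  have "vs2.dim (f ` V) = card (g ` (B - B0))"
    unfolding im using vs2.dim_span_eq_card_independent[OF ind] .
  also have "\<dots> = card (B - B0)"
    using inj by (metis card_image inj_on_subset vs1.span_superset)
  finally have d: "vs2.dim (f ` V) = card (B - B0)" .
  have "vs1.dim V = card B" using B vs1.basis_card_eq_dim by metis
  also have "\<dots> = card (B - B0) + card B0"
    using card_Diff_subset[OF finite_subset[OF B(1) finB] B(1)] card_mono[OF finB B(1)] by simp
  finally show "vs1.dim V = vs2.dim (f ` V) + vs1.dim ?N" using d B0(4) by simp
  show "vs2.fin_dim (f ` V)" unfolding vs2.fin_dim_def im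
    by (intro exI[of _ "g ` (B - B0)"]) (simp add: finB)
qed

lemma dim_bij:
  assumes fin: "vs1.fin_dim V" and V: "vs1.subspace V"
    and add: "\<And>x y. x \<in> V \<Longrightarrow> y \<in> V \<Longrightarrow> f (x + y) = f x + f y"
    and sc: "\<And>c x. x \<in> V \<Longrightarrow> f (s1 c x) = s2 c (f x)"
    and bij: "bij_betw f V W"
  shows "vs2.dim W = vs1.dim V"
proof -
  have f0: "f 0 = 0" using sc[of 0 0] V by (simp add: vs1.subspace_0)
  have V0: "0 \<in> V" using V by (rule vs1.subspace_0)
  have "x = 0" if "x \<in> V" "f x = 0" for x
    using inj_onD[OF bij_betw_imp_inj_on[OF bij], of x 0] that f0 V0 by simp
  then have "{x \<in> V. f x = 0} = {0}" using f0 V0 by blast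
  then show ?thesis
    using rank_nullity(1)[of V f, OF fin V add sc] bij_betw_imp_surj_on[OF bij]
    by (simp add: vs1.dim_zero)
qed

end

context vspace begin

text \<open>The map kills a basis of \<open>U\<close> and fixes the vectors completing it to a basis
  of \<open>V\<close>. Its image on \<open>V\<close> is a complement of \<open>U\<close> and serves
  as the carrier of quotient modules.\<close>

lemma projection_exists:
  assumes V: "subspace V" and U: "subspace U" "U \<subseteq> V"
  obtains g where "Vector_Spaces.linear scale scale g" "g ` V \<subseteq> V" "\<And>x. x \<in> V \<Longrightarrow> x - g x \<in> U"
    "\<And>x. x \<in> U \<Longrightarrow> g x = 0"
proof -
  interpret p: vspace_pair scale scale ..
  obtain B0 where B0: "B0 \<subseteq> U" "independent B0" "U \<subseteq> span B0"
    by (rule basis_exists)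
  obtain B where B: "B0 \<subseteq> B" "B \<subseteq> V" "independent B" "V \<subseteq> span B"
    using maximal_independent_subset_extend[of B0 V] B0 U by (metis subset_trans)
  obtain g where g: "Vector_Spaces.linear scale scale g" "\<forall>x\<in>B. g x = (if x \<in> B0 then 0 else x)"
    using p.linear_independent_extend[OF B(3), of "\<lambda>x. if x \<in> B0 then 0 else x"] by blast
  interpret g: Vector_Spaces.linear scale scale g by (fact g(1))
  have "subspace {x \<in> V. g x \<in> V \<and> x - g x \<in> U}"
    unfolding subspace_def
  proof (intro conjI allI ballI)
    show "0 \<in> {x \<in> V. g x \<in> V \<and> x - g x \<in> U}" using V U by (simp add: subspace_0)
  next
    fix x y assume "x \<in> {x \<in> V. g x \<in> V \<and> x - g x \<in> U}" "y \<in> {x \<in> V. g x \<in> V \<and> x - g x \<in> U}"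
    then show "x + y \<in> {x \<in> V. g x \<in> V \<and> x - g x \<in> U}"
      using V U subspace_add[of U "x - g x" "y - g y"]
      by (auto simp: subspace_add g.add algebra_simps)
  next
    fix c x assume "x \<in> {x \<in> V. g x \<in> V \<and> x - g x \<in> U}"
    then show "scale c x \<in> {x \<in> V. g x \<in> V \<and> x - g x \<in> U}"
      using V U subspace_scale[of U "x - g x" c]
      by (auto simp: subspace_scale g.scale scale_right_diff_distrib)
  qed
  moreover have "B \<subseteq> {x \<in> V. g x \<in> V \<and> x - g x \<in> U}"
    using g(2) B(2) B0(1) V U by (auto simp: subspace_0)
  ultimately have 1: "V \<subseteq> {x \<in> V. g x \<in> V \<and> x - g x \<in> U}"
    using span_minimal B(4) by blast
  have "span B0 \<subseteq> {x. g x = 0}"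
    using g(2) B(1) by (intro span_minimal) (auto simp: subspace_def g.add g.scale)
  then have "\<And>x. x \<in> U \<Longrightarrow> g x = 0" using B0(3) by blast
  with 1 g(1) show thesis by (intro that[of g]) auto
qed

lemma separating_functional:
  assumes B: "subspace B" and q: "q \<notin> B"
  obtains l where "Vector_Spaces.linear scale (*) l" "\<And>x. x \<in> B \<Longrightarrow> l x = 0" "l q = 1"
proof -
  interpret p: vector_space_pair scale "(*) :: 'a \<Rightarrow> 'a \<Rightarrow> 'a"
    by unfold_locales (auto simp: algebra_simps)
  obtain B0 where B0: "B0 \<subseteq> B" "independent B0" "B \<subseteq> span B0"
    by (rule basis_exists)
  then have "q \<notin> span B0" using B q span_minimal by blast
  then have I: "independent (insert q B0)" and "q \<notin> B0"
    using B0(2) independent_insertI span_base by blast+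
  obtain l where l: "Vector_Spaces.linear scale (*) l" "\<forall>x\<in>insert q B0. l x = (if x = q then 1 else 0)"
    using p.linear_independent_extend[OF I, of "\<lambda>x. if x = q then 1 else 0"] by blast
  interpret l: Vector_Spaces.linear scale "(*)" l by (fact l(1))
  have "span B0 \<subseteq> {x. l x = 0}"
    using l(2) \<open>q \<notin> B0\<close> by (intro span_minimal) (auto simp: subspace_def l.add l.scale)
  then show thesis using l B0(3) by (intro that[of l]) auto
qed

end

section \<open>Linear dependence and the marriage theorem\<close>

text \<open>Gaussian elimination on the coordinates: a pivot \<open>p\<close> with nonzero entry at
  \<open>j\<close> clears this coordinate in all other vectors and is then dropped, which lowers
  both cardinalities by one.\<close>

lemma exists_linear_dependence:
  fixes v :: "'i \<Rightarrow> 'j \<Rightarrow> real"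
  assumes "finite J" "finite I" "card J < card I"
  shows "\<exists>c. (\<exists>i\<in>I. c i \<noteq> 0) \<and> (\<forall>j\<in>J. (\<Sum>i\<in>I. c i * v i j) = 0)"
  using assms
proof (induction J arbitrary: I v rule: finite_induct)
  case empty
  then have "I \<noteq> {}" by auto
  then show ?case by (intro exI[of _ "\<lambda>_. 1"]) auto
next
  case (insert j J)
  show ?case
  proof (cases "\<forall>i\<in>I. v i j = 0")
    case True
    have "card J < card I" using insert by simp
    then obtain c where "\<exists>i\<in>I. c i \<noteq> 0" "\<forall>j\<in>J. (\<Sum>i\<in>I. c i * v i j) = 0"
      using insert.IH[OF insert.prems(1)] by blast
    then show ?thesis using True by (intro exI[of _ c]) auto
  next
    case False
    then obtain p where p: "p \<in> I" "v p j \<noteq> 0" by blast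
    let ?I = "I - {p}"
    let ?v = "\<lambda>i k. v i k - v i j / v p j * v p k"
    have "card J < card ?I" using insert p by simp
    then obtain c where c: "\<exists>i\<in>?I. c i \<noteq> 0" "\<forall>k\<in>J. (\<Sum>i\<in>?I. c i * ?v i k) = 0"
      using insert.IH[of ?I ?v] insert.prems(1) by auto
    \<comment> \<open>Back substitution: this coefficient of the pivot makes coordinate
      \<open>j\<close> of the combination vanish.\<close>
    define d where "d = - (\<Sum>i\<in>?I. c i * v i j) / v p j"
    let ?c = "c(p := d)"
    have s: "(\<Sum>i\<in>I. ?c i * v i k) = d * v p k + (\<Sum>i\<in>?I. c i * v i k)" for k
      using p insert.prems(1) by (simp add: sum.remove)
    have "(\<Sum>i\<in>I. ?c i * v i k) = 0" if k: "k \<in> insert j J" for k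
    proof (cases "k = j")
      case True
      then show ?thesis unfolding s using p(2) by (simp add: d_def)
    next
      case False
      then have "(\<Sum>i\<in>?I. c i * ?v i k) = 0" using k c(2) by blast
      also have "(\<Sum>i\<in>?I. c i * ?v i k)
          = (\<Sum>i\<in>?I. c i * v i k) - (\<Sum>i\<in>?I. c i * v i j) / v p j * v p k"
        by (simp add: right_diff_distrib sum_subtractf sum_distrib_right sum_divide_distrib mult.assoc)
      finally show ?thesis unfolding s by (simp add: d_def)
    qed
    moreover have "\<exists>i\<in>I. ?c i \<noteq> 0" using c(1) by auto
    ultimately show ?thesis by blast
  qed
qed

text \<open>
  Rado's proof: if some vertex has two neighbours, one of the two edges can be removed without
  violating the condition.
\<close>

lemma marriage:
  fixes N :: "'i \<Rightarrow> 'j set"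
  assumes "finite I" "\<And>i. i \<in> I \<Longrightarrow> finite (N i)" "\<And>J. J \<subseteq> I \<Longrightarrow> card J \<le> card (\<Union>(N ` J))"
  shows "\<exists>s. inj_on s I \<and> (\<forall>i\<in>I. s i \<in> N i)"
  using assms
proof (induction "\<Sum>i\<in>I. card (N i)" arbitrary: N rule: less_induct)
  case less
  note fin = less.prems(1,2) and hall = less.prems(3)
  have ne: "N i \<noteq> {}" if "i \<in> I" for i using hall[of "{i}"] that by auto
  show ?case
  proof (cases "\<forall>i\<in>I. card (N i) = 1")
    case True
    define s where "s i = the_elem (N i)" for i
    have Ns: "N i = {s i}" if "i \<in> I" for i
      using True that unfolding s_def by (metis card_1_singletonE the_elem_eq)
    have "inj_on s I"
    proof (rule inj_onI, rule ccontr)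
      fix x y assume *: "x \<in> I" "y \<in> I" "s x = s y" "x \<noteq> y"
      then have "card {x, y} \<le> card (\<Union>(N ` {x, y}))" using hall[of "{x, y}"] by blast
      then show False using * Ns by simp
    qed
    then show ?thesis using Ns by auto
  next
    case False
    then obtain i where i: "i \<in> I" "card (N i) \<noteq> 1" by blast
    then have "\<not> card (N i) \<le> 1" using ne[OF i(1)] fin(2)[OF i(1)]
      by (metis One_nat_def card_0_eq le_Suc_eq le_zero_eq)
    then obtain a b where ab: "a \<in> N i" "b \<in> N i" "a \<noteq> b"
      using card_le_Suc0_iff_eq[OF fin(2)[OF i(1)]] by auto
    let ?M = "\<lambda>x. N(i := N i - {x})"
    have dec: "(\<Sum>k\<in>I. card (?M x k)) < (\<Sum>k\<in>I. card (N k))" if "x \<in> N i" for x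
    proof (rule sum_strict_mono_ex1[OF fin(1)])
      show "\<forall>k\<in>I. card (?M x k) \<le> card (N k)" using fin(2) by (auto intro: card_mono)
      show "\<exists>k\<in>I. card (?M x k) < card (N k)"
        using i card_Diff1_less[OF fin(2)[OF i(1)] that] by (intro bexI[of _ i]) auto
    qed
    have finM: "\<And>k. k \<in> I \<Longrightarrow> finite (?M x k)" for x using fin(2) by auto
    have sub: "\<And>k. k \<in> I \<Longrightarrow> ?M x k \<subseteq> N k" for x by auto
    show ?thesis
    proof (cases "\<exists>x\<in>{a, b}. \<forall>J\<subseteq>I. card J \<le> card (\<Union>(?M x ` J))")
      case True
      then obtain x where x: "x \<in> {a, b}" "\<And>J. J \<subseteq> I \<Longrightarrow> card J \<le> card (\<Union>(?M x ` J))" by blast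
      have "x \<in> N i" using x ab by blast
      from less.hyps[OF dec[OF this] fin(1) finM x(2)]
      obtain s where "inj_on s I" "\<forall>k\<in>I. s k \<in> ?M x k" by blast
      then show ?thesis using sub by blast
    next
      case False
      \<comment> \<open>A violating set must contain \<open>i\<close>, because the neighbourhoods of
        all other vertices are unchanged. Taking \<open>i\<close> out of it turns the strict
        inequality into a weak one.\<close>
      have ex: "\<exists>K\<subseteq>I - {i}. card (\<Union>(N ` K) \<union> (N i - {x})) \<le> card K" if x: "x \<in> {a, b}" for x
      proof -
        obtain J where J: "J \<subseteq> I" "card (\<Union>(?M x ` J)) < card J"
          using False x by (meson not_le)
        have "i \<in> J"
        proof (rule ccontr)
          assume "i \<notin> J"
          then have "?M x ` J = N ` J" by auto
          then show False using J hall[OF J(1)] by simp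
        qed
        have finJ: "finite J" using J(1) fin(1) finite_subset by blast
        have "\<Union>(?M x ` J) = \<Union>(N ` (J - {i})) \<union> (N i - {x})" using \<open>i \<in> J\<close> by auto
        moreover have "card J = Suc (card (J - {i}))" using \<open>i \<in> J\<close> finJ by (metis card_Suc_Diff1)
        ultimately have "card (\<Union>(N ` (J - {i})) \<union> (N i - {x})) \<le> card (J - {i})"
          using J(2) by (metis less_Suc_eq_le)
        then show ?thesis using J(1) by blast
      qed
      obtain K where K: "K \<subseteq> I - {i}" "card (\<Union>(N ` K) \<union> (N i - {a})) \<le> card K" using ex by blast
      obtain L where L: "L \<subseteq> I - {i}" "card (\<Union>(N ` L) \<union> (N i - {b})) \<le> card L" using ex by blast
      let ?A = "\<Union>(N ` K) \<union> (N i - {a})" and ?B = "\<Union>(N ` L) \<union> (N i - {b})"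
      have finKL: "finite K" "finite L" using K L fin(1) by (meson finite_Diff finite_subset)+
      have finAB: "finite ?A" "finite ?B" using finKL K L i fin(2) by auto
      \<comment> \<open>Since \<open>a\<close> and \<open>b\<close> differ, the two punctured
        neighbourhoods of \<open>i\<close> together give all of \<open>N i\<close>. Hall's condition
        for \<open>insert i (K \<union> L)\<close> and for \<open>K \<inter> L\<close> then forces
        \<open>card ?A + card ?B\<close> to exceed \<open>card K + card L\<close>.\<close>
      have un: "?A \<union> ?B = \<Union>(N ` insert i (K \<union> L))" using ab by auto
      have "Suc (card (K \<union> L)) = card (insert i (K \<union> L))" using K L finKL by (auto simp: card_insert_if)
      also have "\<dots> \<le> card (?A \<union> ?B)" unfolding un using K L i by (intro hall) auto
      finally have 1: "Suc (card (K \<union> L)) \<le> card (?A \<union> ?B)" .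
      have "card (K \<inter> L) \<le> card (\<Union>(N ` (K \<inter> L)))" using K by (intro hall) auto
      also have "\<dots> \<le> card (?A \<inter> ?B)" using finAB by (intro card_mono) auto
      finally have 2: "card (K \<inter> L) \<le> card (?A \<inter> ?B)" .
      have "card ?A + card ?B = card (?A \<union> ?B) + card (?A \<inter> ?B)"
        using card_Un_Int[OF finAB] .
      moreover have "card K + card L = card (K \<union> L) + card (K \<inter> L)"
        using card_Un_Int[OF finKL] .
      ultimately show ?thesis using 1 2 K(2) L(2) by linarith
    qed
  qed
qed

section \<open>Modules over a ring\<close>

lemma
  assumes "left_module M"
  shows lm_0: "0 \<in> mcar M"
    and lm_add: "x \<in> mcar M \<Longrightarrow> y \<in> mcar M \<Longrightarrow> x + y \<in> mcar M"
    and lm_minus: "x \<in> mcar M \<Longrightarrow> - x \<in> mcar M"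
    and lm_act: "x \<in> mcar M \<Longrightarrow> act M a x \<in> mcar M"
    and lm_act_add: "x \<in> mcar M \<Longrightarrow> y \<in> mcar M \<Longrightarrow> act M a (x + y) = act M a x + act M a y"
    and lm_add_act: "x \<in> mcar M \<Longrightarrow> act M (a + b) x = act M a x + act M b x"
    and lm_mult: "x \<in> mcar M \<Longrightarrow> act M (a * b) x = act M a (act M b x)"
    and lm_one: "x \<in> mcar M \<Longrightarrow> act M 1 x = x"
  using assms unfolding left_module_def by blast+

lemma lm_diff: "left_module M \<Longrightarrow> x \<in> mcar M \<Longrightarrow> y \<in> mcar M \<Longrightarrow> x - y \<in> mcar M"
  using lm_add[of M x "- y"] lm_minus[of M y] by simp

lemma lm_act_0: "left_module M \<Longrightarrow> act M a 0 = 0"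
  using lm_act_add[of M 0 0 a] lm_0[of M] by simp

lemma lm_0_act: "left_module M \<Longrightarrow> x \<in> mcar M \<Longrightarrow> act M 0 x = 0"
  using lm_add_act[of M x 0 0] by simp

lemma lm_sum: "left_module M \<Longrightarrow> (\<And>i. i \<in> I \<Longrightarrow> f i \<in> mcar M) \<Longrightarrow> sum f I \<in> mcar M"
  by (induction I rule: infinite_finite_induct) (auto simp: lm_0 lm_add)

lemma lm_act_sum:
  "left_module M \<Longrightarrow> (\<And>i. i \<in> I \<Longrightarrow> f i \<in> mcar M) \<Longrightarrow> act M a (sum f I) = (\<Sum>i\<in>I. act M a (f i))"
  by (induction I rule: infinite_finite_induct) (auto simp: lm_act_0 lm_act_add lm_sum)

lemma HomI:
  assumes "\<And>x. x \<in> mcar M \<Longrightarrow> f x \<in> mcar N"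
    and "\<And>x y. x \<in> mcar M \<Longrightarrow> y \<in> mcar M \<Longrightarrow> f (x + y) = f x + f y"
    and "\<And>a x. x \<in> mcar M \<Longrightarrow> f (act M a x) = act N a (f x)"
    and "\<And>x. x \<notin> mcar M \<Longrightarrow> f x = 0"
  shows "f \<in> Hom M N"
  using assms unfolding Hom_def by blast

lemma
  assumes "f \<in> Hom M N"
  shows Hom_in: "x \<in> mcar M \<Longrightarrow> f x \<in> mcar N"
    and Hom_add: "x \<in> mcar M \<Longrightarrow> y \<in> mcar M \<Longrightarrow> f (x + y) = f x + f y"
    and Hom_act: "x \<in> mcar M \<Longrightarrow> f (act M a x) = act N a (f x)"
    and Hom_out: "x \<notin> mcar M \<Longrightarrow> f x = 0"
  using assms unfolding Hom_def by blast+

lemma Hom_0: "f \<in> Hom M N \<Longrightarrow> left_module M \<Longrightarrow> f 0 = 0"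
  using Hom_add[of f M N 0 0] lm_0[of M] by simp

lemma Hom_minus: "f \<in> Hom M N \<Longrightarrow> left_module M \<Longrightarrow> x \<in> mcar M \<Longrightarrow> f (- x) = - f x"
  using Hom_add[of f M N x "- x"] lm_minus[of M x] Hom_0[of f M N]
  by (simp add: eq_neg_iff_add_eq_0 add.commute)

lemma Hom_diff:
  "f \<in> Hom M N \<Longrightarrow> left_module M \<Longrightarrow> x \<in> mcar M \<Longrightarrow> y \<in> mcar M \<Longrightarrow> f (x - y) = f x - f y"
  using Hom_add[of f M N x "- y"] lm_minus[of M y] Hom_minus[of f M N y] by simp

lemma Hom_sum:
  "f \<in> Hom M N \<Longrightarrow> left_module M \<Longrightarrow> (\<And>i. i \<in> I \<Longrightarrow> g i \<in> mcar M) \<Longrightarrow> f (sum g I) = (\<Sum>i\<in>I. f (g i))"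
  by (induction I rule: infinite_finite_induct) (auto simp: Hom_0 Hom_add lm_sum)

lemma Hom_eqI:
  assumes "f \<in> Hom M N" "g \<in> Hom M L" "\<And>x. x \<in> mcar M \<Longrightarrow> f x = g x"
  shows "f = g"
proof
  fix x show "f x = g x"
    using assms by (cases "x \<in> mcar M") (auto simp: Hom_out)
qed

lemma Hom_zero: "left_module N \<Longrightarrow> (\<lambda>x. 0) \<in> Hom M N"
  by (intro HomI) (auto simp: lm_0 lm_act_0)

lemma Hom_plus: "left_module N \<Longrightarrow> f \<in> Hom M N \<Longrightarrow> g \<in> Hom M N \<Longrightarrow> (\<lambda>x. f x + g x) \<in> Hom M N"
  by (intro HomI) (auto simp: Hom_in Hom_add Hom_act Hom_out lm_add lm_act_add)

lemma Hom_uminus: "left_module M \<Longrightarrow> left_module N \<Longrightarrow> f \<in> Hom M N \<Longrightarrow> (\<lambda>x. - f x) \<in> Hom M N"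
proof (intro HomI)
  fix a x assume *: "left_module M" "left_module N" "f \<in> Hom M N" "x \<in> mcar M"
  have "act N a (f x) + act N a (- f x) = 0"
    using * lm_act_add[of N "f x" "- f x" a] by (simp add: Hom_in lm_minus lm_act_0)
  then show "- f (act M a x) = act N a (- f x)"
    using * by (simp add: Hom_act neg_eq_iff_add_eq_0)
qed (auto simp: Hom_in Hom_add Hom_out lm_minus)

lemma Hom_minus_fun:
  assumes "left_module M" "left_module N" "f \<in> Hom M N" "g \<in> Hom M N"
  shows "(\<lambda>x. f x - g x) \<in> Hom M N"
  using Hom_plus[OF assms(2,3) Hom_uminus[OF assms(1,2,4)]] by simp

lemma Hom_comp: "left_module N \<Longrightarrow> f \<in> Hom M N \<Longrightarrow> g \<in> Hom N L \<Longrightarrow> g \<circ> f \<in> Hom M L"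
  by (intro HomI) (auto simp: Hom_in Hom_add Hom_act Hom_out Hom_0)

text \<open>Elements of \<open>Hom\<close> vanish outside the domain, so that equal homomorphisms
  are equal functions; \<open>restr\<close> brings a function into this form.\<close>

definition restr :: "'m set \<Rightarrow> ('m \<Rightarrow> 'n::zero) \<Rightarrow> 'm \<Rightarrow> 'n" where
  "restr U f = (\<lambda>x. if x \<in> U then f x else 0)"

lemma restr_apply [simp]: "x \<in> U \<Longrightarrow> restr U f x = f x"
  by (simp add: restr_def)

abbreviation idm :: "('a, 'm::zero) lmod \<Rightarrow> 'm \<Rightarrow> 'm" where
  "idm M \<equiv> restr (mcar M) (\<lambda>x. x)"

lemma Hom_id: "left_module M \<Longrightarrow> idm M \<in> Hom M M"
  by (intro HomI) (auto simp: restr_def lm_add lm_act)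

lemma Hom_comp_id: "f \<in> Hom M N \<Longrightarrow> left_module M \<Longrightarrow> f \<circ> idm M = f"
  by (auto simp: fun_eq_iff restr_def Hom_0 Hom_out)

section \<open>Submodules and the factorization of homomorphisms\<close>

lemma submod_iff:
  assumes "left_module M"
  shows "submod U M \<longleftrightarrow> U \<subseteq> mcar M \<and> 0 \<in> U \<and> (\<forall>x\<in>U. \<forall>y\<in>U. x + y \<in> U) \<and>
    (\<forall>x\<in>U. - x \<in> U) \<and> (\<forall>a. \<forall>x\<in>U. act M a x \<in> U)"
  (is "?l \<longleftrightarrow> ?r")
proof
  assume ?l then show ?r unfolding submod_def left_module_def by simp
next
  assume r: ?r
  then have "\<And>x. x \<in> U \<Longrightarrow> x \<in> mcar M" by blast
  with r show ?l unfolding submod_def left_module_def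
    using assms by (auto simp: lm_act_add lm_add_act lm_mult lm_one)
qed

lemma submod_lm: "submod U M \<Longrightarrow> left_module (M\<lparr>mcar := U\<rparr>)"
  by (simp add: submod_def)

lemma submod_subset: "submod U M \<Longrightarrow> U \<subseteq> mcar M"
  by (simp add: submod_def)

lemma submod_zero: "left_module M \<Longrightarrow> submod {0} M"
  by (simp add: submod_iff lm_0 lm_act_0)

lemma submod_full: "left_module M \<Longrightarrow> submod (mcar M) M"
  by (simp add: submod_iff lm_0 lm_add lm_minus lm_act)

lemma submod_ker: "left_module M \<Longrightarrow> left_module N \<Longrightarrow> f \<in> Hom M N \<Longrightarrow> submod (ker M f) M"
  by (auto simp: submod_iff ker_def lm_0 lm_add lm_minus lm_act Hom_0 Hom_add Hom_minus Hom_act lm_act_0)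

lemma submod_preimage:
  assumes "left_module M" "left_module N" "f \<in> Hom M N" "submod U N"
  shows "submod {x \<in> mcar M. f x \<in> U} M"
  using assms
  by (auto simp: submod_iff lm_0 lm_add lm_minus lm_act Hom_0 Hom_add Hom_minus Hom_act)

lemma submod_image:
  assumes "left_module M" "left_module N" "f \<in> Hom M N" "submod U M"
  shows "submod (f ` U) N"
proof -
  have U: "U \<subseteq> mcar M" "0 \<in> U" "\<forall>x\<in>U. \<forall>y\<in>U. x + y \<in> U" "\<forall>x\<in>U. - x \<in> U" "\<forall>a. \<forall>x\<in>U. act M a x \<in> U"
    using assms(4) unfolding submod_iff[OF assms(1)] by auto
  have 1: "f x + f y \<in> f ` U" if "x \<in> U" "y \<in> U" for x y
    using that U(1,3) Hom_add[OF assms(3), of x y] by (metis image_eqI subsetD)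
  have 2: "- f x \<in> f ` U" if "x \<in> U" for x
    using that U(1,4) Hom_minus[OF assms(3,1), of x] by (metis image_eqI subsetD)
  have 3: "act N a (f x) \<in> f ` U" if "x \<in> U" for a x
    using that U(1,5) Hom_act[OF assms(3), of x a] by (metis image_eqI subsetD)
  have 4: "0 \<in> f ` U" using U(2) Hom_0[OF assms(3,1)] by force
  show ?thesis unfolding submod_iff[OF assms(2)]
  proof (intro conjI ballI allI)
    show "f ` U \<subseteq> mcar N" using U(1) Hom_in[OF assms(3)] by blast
  qed (use 1 2 3 4 in blast)+
qed

lemma submod_plus:
  assumes M: "left_module M" and U: "submod U M" and V: "submod V M"
  shows "submod {u + v |u v. u \<in> U \<and> v \<in> V} M"
proof -
  have U': "U \<subseteq> mcar M" "0 \<in> U" "\<And>x y. x \<in> U \<Longrightarrow> y \<in> U \<Longrightarrow> x + y \<in> U" "\<And>x. x \<in> U \<Longrightarrow> - x \<in> U"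
    "\<And>a x. x \<in> U \<Longrightarrow> act M a x \<in> U"
    using U unfolding submod_iff[OF M] by auto
  have V': "V \<subseteq> mcar M" "0 \<in> V" "\<And>x y. x \<in> V \<Longrightarrow> y \<in> V \<Longrightarrow> x + y \<in> V" "\<And>x. x \<in> V \<Longrightarrow> - x \<in> V"
    "\<And>a x. x \<in> V \<Longrightarrow> act M a x \<in> V"
    using V unfolding submod_iff[OF M] by auto
  let ?W = "{u + v |u v. u \<in> U \<and> v \<in> V}"
  have W: "u + v \<in> ?W" if "u \<in> U" "v \<in> V" for u v using that by blast
  show ?thesis unfolding submod_iff[OF M]
  proof (intro conjI ballI allI)
    show "?W \<subseteq> mcar M" using U'(1) V'(1) lm_add[OF M] by blast
    show "0 \<in> ?W" using W[OF U'(2) V'(2)] by simp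
  next
    fix x y assume "x \<in> ?W" "y \<in> ?W"
    then obtain u v u' v' where *: "x = u + v" "y = u' + v'" "u \<in> U" "v \<in> V" "u' \<in> U" "v' \<in> V" by blast
    have "x + y = (u + u') + (v + v')" unfolding * by (simp add: algebra_simps)
    then show "x + y \<in> ?W" using W[OF U'(3)[OF *(3,5)] V'(3)[OF *(4,6)]] by simp
  next
    fix x assume "x \<in> ?W"
    then obtain u v where *: "x = u + v" "u \<in> U" "v \<in> V" by blast
    have "- x = - u + - v" unfolding * by simp
    then show "- x \<in> ?W" using W[OF U'(4)[OF *(2)] V'(4)[OF *(3)]] by simp
  next
    fix a x assume "x \<in> ?W"
    then obtain u v where *: "x = u + v" "u \<in> U" "v \<in> V" by blast
    have "act M a x = act M a u + act M a v" unfolding *(1) using * U'(1) V'(1)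
      by (intro lm_act_add[OF M]) auto
    then show "act M a x \<in> ?W" using W[OF U'(5)[OF *(2)] V'(5)[OF *(3)]] by simp
  qed
qed

lemma Hom_sub_iff:
  "submod U N \<Longrightarrow> f \<in> Hom M (N\<lparr>mcar := U\<rparr>) \<longleftrightarrow> f \<in> Hom M N \<and> f ` mcar M \<subseteq> U"
  unfolding Hom_def submod_def by auto

lemma Hom_restr:
  assumes "f \<in> Hom M N" "submod U M" "left_module M" shows "restr U f \<in> Hom (M\<lparr>mcar := U\<rparr>) N"
proof -
  have U: "U \<subseteq> mcar M" "\<And>x y. x \<in> U \<Longrightarrow> y \<in> U \<Longrightarrow> x + y \<in> U" "\<And>a x. x \<in> U \<Longrightarrow> act M a x \<in> U"
    using assms(2) unfolding submod_iff[OF assms(3)] by auto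
  show ?thesis
    using U assms(1) by (intro HomI) (auto simp: restr_def subset_iff Hom_in Hom_add Hom_act)
qed

text \<open>The induced map is \<open>g\<close> after a set-theoretic section of \<open>f\<close>.
  Two preimages of a point differ by an element of the kernel of \<open>f\<close>, which
  \<open>g\<close> kills, so the choice does not matter.\<close>

lemma Hom_factor:
  assumes M: "left_module M" and N: "left_module N" and f: "f \<in> Hom M N" "f ` mcar M = mcar N"
    and g: "g \<in> Hom M Q" and k: "ker M f \<subseteq> ker M g"
  obtains h where "h \<in> Hom N Q" "h \<circ> f = g"
proof -
  define s where "s y = (SOME x. x \<in> mcar M \<and> f x = y)" for y
  have s: "s y \<in> mcar M" "f (s y) = y" if "y \<in> mcar N" for y
  proof -
    have "\<exists>x. x \<in> mcar M \<and> f x = y" using f(2) that by (metis imageE)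
    then show "s y \<in> mcar M" "f (s y) = y" unfolding s_def by (metis (mono_tags, lifting) someI_ex)+
  qed
  define h where "h = restr (mcar N) (g \<circ> s)"
  have hf: "h (f x) = g x" if x: "x \<in> mcar M" for x
  proof -
    have y: "f x \<in> mcar N" using x f by (simp add: Hom_in)
    have "f (s (f x) - x) = 0" using Hom_diff[OF f(1) M s(1)[OF y] x] s(2)[OF y] by simp
    then have "s (f x) - x \<in> ker M g" using k lm_diff[OF M s(1)[OF y] x] by (auto simp: ker_def)
    then have "g (s (f x)) = g x" using Hom_diff[OF g M s(1)[OF y] x] by (simp add: ker_def)
    then show ?thesis using y by (simp add: h_def)
  qed
  have "h \<in> Hom N Q"
  proof (rule HomI)
    fix y assume "y \<in> mcar N"
    then show "h y \<in> mcar Q" using s g by (simp add: h_def Hom_in)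
  next
    fix y z assume yz: "y \<in> mcar N" "z \<in> mcar N"
    have "h (f (s y + s z)) = g (s y) + g (s z)"
      using s yz g by (simp add: hf lm_add[OF M] Hom_add[OF g])
    then show "h (y + z) = h y + h z"
      using s yz by (simp add: Hom_add[OF f(1)] h_def)
  next
    fix a y assume y: "y \<in> mcar N"
    have "h (f (act M a (s y))) = act Q a (g (s y))"
      using s y by (simp add: hf lm_act[OF M] Hom_act[OF g])
    then show "h (act N a y) = act Q a (h y)"
      using s y by (simp add: Hom_act[OF f(1)] h_def)
  qed (simp add: h_def restr_def)
  moreover from this have "h \<circ> f = g"
    using hf Hom_comp[OF N f(1)] g by (intro Hom_eqI[of _ M Q g Q]) auto
  ultimately show thesis by (rule that)
qed

lemma Hom_inj_iff:
  assumes "left_module M" "f \<in> Hom M N"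
  shows "inj_on f (mcar M) \<longleftrightarrow> ker M f = {0}"
proof
  assume "inj_on f (mcar M)"
  then show "ker M f = {0}"
    using assms Hom_0[OF assms(2,1)] lm_0[OF assms(1)] unfolding ker_def inj_on_def by auto
next
  assume k: "ker M f = {0}"
  show "inj_on f (mcar M)"
  proof (rule inj_onI)
    fix x y assume *: "x \<in> mcar M" "y \<in> mcar M" "f x = f y"
    then have "x - y \<in> ker M f" using assms by (simp add: ker_def lm_diff Hom_diff)
    then show "x = y" using k by simp
  qed
qed

lemma Hom_inverse:
  assumes M: "left_module M" and N: "left_module N" and f: "f \<in> Hom M N" and b: "bij_betw f (mcar M) (mcar N)"
  obtains g where "g \<in> Hom N M" "\<And>x. x \<in> mcar M \<Longrightarrow> g (f x) = x" "\<And>y. y \<in> mcar N \<Longrightarrow> f (g y) = y"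
proof -
  have "ker M f \<subseteq> ker M (idm M)"
    using Hom_inj_iff[OF M f] b by (auto simp: bij_betw_def ker_def restr_def)
  then obtain g where g: "g \<in> Hom N M" "g \<circ> f = idm M"
    using Hom_factor[OF M N f _ Hom_id[OF M]] b by (auto simp: bij_betw_def)
  have gf: "g (f x) = x" if "x \<in> mcar M" for x
    using g(2) that by (metis comp_apply restr_apply)
  have "f (g y) = y" if y: "y \<in> mcar N" for y
  proof -
    obtain x where x: "x \<in> mcar M" "y = f x" using b y by (auto simp: bij_betw_def)
    then show ?thesis using gf by simp
  qed
  with g(1) gf show thesis by (rule that)
qed

lemma isoI:
  assumes "f \<in> Hom M N" "g \<in> Hom N M" "\<And>x. x \<in> mcar M \<Longrightarrow> g (f x) = x" "\<And>y. y \<in> mcar N \<Longrightarrow> f (g y) = y"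
  shows "M \<cong> N"
  unfolding iso_mod_def using assms
  by (intro bexI[of _ f] bij_betw_byWitness[where f' = g]) (auto simp: Hom_in)

lemma isoE:
  assumes "M \<cong> N" "left_module M" "left_module N"
  obtains f g where "f \<in> Hom M N" "g \<in> Hom N M" "\<And>x. x \<in> mcar M \<Longrightarrow> g (f x) = x"
    "\<And>y. y \<in> mcar N \<Longrightarrow> f (g y) = y"
  using assms Hom_inverse unfolding iso_mod_def by metis

lemma iso_refl: "left_module M \<Longrightarrow> M \<cong> M"
  by (rule isoI[of "idm M" _ _ "idm M"]) (auto intro: Hom_id)

lemma iso_sym: "M \<cong> N \<Longrightarrow> left_module M \<Longrightarrow> left_module N \<Longrightarrow> N \<cong> M"
  by (metis isoE isoI)

lemma iso_trans: "M \<cong> N \<Longrightarrow> N \<cong> L \<Longrightarrow> left_module M \<Longrightarrow> left_module N \<Longrightarrow> left_module L \<Longrightarrow> M \<cong> L"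
  unfolding iso_mod_def using Hom_comp bij_betw_trans by blast

lemma iso_of_same_kernel:
  assumes M: "left_module M" and N: "left_module N" "f \<in> Hom M N" "f ` mcar M = mcar N"
    and Q: "left_module Q" "g \<in> Hom M Q" "g ` mcar M = mcar Q" and k: "ker M f = ker M g"
  shows "N \<cong> Q"
proof -
  obtain h where h: "h \<in> Hom N Q" "h \<circ> f = g" using Hom_factor[OF M N Q(2)] k by blast
  obtain h' where h': "h' \<in> Hom Q N" "h' \<circ> g = f" using Hom_factor[OF M Q N(2)] k by blast
  show ?thesis
  proof (rule isoI[OF h(1) h'(1)])
    fix y assume "y \<in> mcar N"
    then obtain x where "x \<in> mcar M" "y = f x" using N(3) by blast
    then show "h' (h y) = y" using h(2) h'(2) by (metis comp_apply)
  next
    fix y assume "y \<in> mcar Q"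
    then obtain x where "x \<in> mcar M" "y = g x" using Q(3) by blast
    then show "h (h' y) = y" using h(2) h'(2) by (metis comp_apply)
  qed
qed

section \<open>Direct sums, retracts and internal decompositions\<close>

lemma msum_simps [simp]:
  "mcar (M \<oplus> N) = mcar M \<times> mcar N" "act (M \<oplus> N) a (x, y) = (act M a x, act N a y)"
  by (simp_all add: msum_def)

lemma lm_msum: "left_module M \<Longrightarrow> left_module N \<Longrightarrow> left_module (M \<oplus> N)"
  unfolding left_module_def msum_def by (auto simp: zero_prod_def)

lemma Hom_pair: "f \<in> Hom L M \<Longrightarrow> g \<in> Hom L N \<Longrightarrow> (\<lambda>x. (f x, g x)) \<in> Hom L (M \<oplus> N)"
  by (intro HomI) (auto simp: Hom_in Hom_add Hom_act Hom_out zero_prod_def)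

lemma Hom_fst: "left_module M \<Longrightarrow> left_module N \<Longrightarrow> restr (mcar (M \<oplus> N)) fst \<in> Hom (M \<oplus> N) M"
  by (intro HomI) (auto simp: restr_def lm_add lm_act)

lemma Hom_snd: "left_module M \<Longrightarrow> left_module N \<Longrightarrow> restr (mcar (M \<oplus> N)) snd \<in> Hom (M \<oplus> N) N"
  by (intro HomI) (auto simp: restr_def lm_add lm_act)

lemma lm_dsum: "(\<And>i. i \<in> I \<Longrightarrow> left_module (X i)) \<Longrightarrow> left_module (dsum I X)"
  unfolding left_module_def dsum_def by (auto simp: fun_eq_iff)

lemma Hom_dsum_proj:
  assumes "\<And>i. i \<in> I \<Longrightarrow> left_module (X i)" "i \<in> I"
  shows "restr (mcar (dsum I X)) (\<lambda>f. f i) \<in> Hom (dsum I X) (X i)"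
  using lm_dsum[OF assms(1)] assms
  by (intro HomI) (auto simp: restr_def dsum_def lm_add lm_act)

lemma Hom_dsum_incl:
  assumes "\<And>i. i \<in> I \<Longrightarrow> left_module (X i)" "i \<in> I"
  shows "restr (mcar (X i)) (\<lambda>x j. if j = i then x else 0) \<in> Hom (X i) (dsum I X)"
  using assms
  by (intro HomI) (auto simp: restr_def dsum_def lm_add lm_act lm_0 lm_act_0 fun_eq_iff)

text \<open>Being a direct summand is expressed by a split inclusion, without a complement. This
  makes sense across different ambient types and is transitive.\<close>

definition retract :: "('a::{ring,monoid_mult}, 'm::ab_group_add) lmod \<Rightarrow> ('a, 'n::ab_group_add) lmod \<Rightarrow> bool" where
  "retract M N \<longleftrightarrow> (\<exists>i\<in>Hom M N. \<exists>p\<in>Hom N M. \<forall>x\<in>mcar M. p (i x) = x)"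

lemma retract_trans:
  assumes "retract M N" "retract N L" "left_module M" "left_module N" "left_module L"
  shows "retract M L"
proof -
  obtain i p where 1: "i \<in> Hom M N" "p \<in> Hom N M" "\<forall>x\<in>mcar M. p (i x) = x"
    using assms unfolding retract_def by blast
  obtain j q where 2: "j \<in> Hom N L" "q \<in> Hom L N" "\<forall>x\<in>mcar N. q (j x) = x"
    using assms unfolding retract_def by blast
  have "j \<circ> i \<in> Hom M L" "p \<circ> q \<in> Hom L M" using 1 2 assms Hom_comp by blast+
  moreover have "\<forall>x\<in>mcar M. (p \<circ> q) ((j \<circ> i) x) = x" using 1 2 by (simp add: Hom_in)
  ultimately show ?thesis unfolding retract_def by blast
qed

lemma retract_iso: "M \<cong> N \<Longrightarrow> left_module M \<Longrightarrow> left_module N \<Longrightarrow> retract M N"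
  unfolding retract_def by (metis isoE)

lemma retract_dsum:
  assumes "\<And>i. i \<in> I \<Longrightarrow> left_module (X i)" "i \<in> I" shows "retract (X i) (dsum I X)"
proof -
  have "restr (mcar (X i)) (\<lambda>x j. if j = i then x else 0) x \<in> mcar (dsum I X)" if "x \<in> mcar (X i)" for x
    using Hom_in[OF Hom_dsum_incl[of I X i] that] assms by blast
  then show ?thesis
    unfolding retract_def using Hom_dsum_incl[of I X i] Hom_dsum_proj[of I X i] assms
    by (intro bexI[of _ "restr (mcar (X i)) (\<lambda>x j. if j = i then x else 0)"]
        bexI[of _ "restr (mcar (dsum I X)) (\<lambda>f. f i)"]) auto
qed

lemma retract_msum:
  assumes "left_module M" "left_module N"
  shows "retract M (M \<oplus> N)" "retract N (M \<oplus> N)"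
proof -
  have "(\<lambda>x. (idm M x, (\<lambda>x. 0) x)) \<in> Hom M (M \<oplus> N)"
    using Hom_pair[OF Hom_id[OF assms(1)] Hom_zero[OF assms(2)]] .
  then show "retract M (M \<oplus> N)"
    unfolding retract_def using Hom_fst[OF assms] lm_0[OF assms(2)]
    by (intro bexI[of _ "\<lambda>x. (idm M x, 0)"] bexI[of _ "restr (mcar (M \<oplus> N)) fst"]) auto
  have "(\<lambda>x. ((\<lambda>x. 0) x, idm N x)) \<in> Hom N (M \<oplus> N)"
    using Hom_pair[OF Hom_zero[OF assms(1)] Hom_id[OF assms(2)]] .
  then show "retract N (M \<oplus> N)"
    unfolding retract_def using Hom_snd[OF assms] lm_0[OF assms(1)]
    by (intro bexI[of _ "\<lambda>x. (0, idm N x)"] bexI[of _ "restr (mcar (M \<oplus> N)) snd"]) auto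
qed

text \<open>\<open>indecomposable\<close> ranges over modules on the ambient type of
  \<open>M\<close>, so it does not transport directly to an isomorphic copy on another type.
  Decompositions into submodules do transport. The zero module counts as
  \<open>indec\<close>.\<close>

definition indec :: "('a::{ring,monoid_mult}, 'm::ab_group_add) lmod \<Rightarrow> bool" where
  "indec M \<longleftrightarrow> (\<forall>U V. submod U M \<and> submod V M \<and> U \<inter> V = {0} \<and>
     (\<forall>x\<in>mcar M. \<exists>u\<in>U. \<exists>v\<in>V. x = u + v) \<longrightarrow> U = {0} \<or> V = {0})"

lemma indecomposable_imp_indec:
  fixes M :: "('a::{ring,monoid_mult}, 'm::ab_group_add) lmod"
  assumes "indecomposable M" shows "indec M"
  unfolding indec_def
proof (intro allI impI, elim conjE)
  fix U V assume U: "submod U M" and V: "submod V M" and i: "U \<inter> V = {0}"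
    and s: "\<forall>x\<in>mcar M. \<exists>u\<in>U. \<exists>v\<in>V. x = u + v"
  have M: "left_module M" using assms by (simp add: indecomposable_def)
  let ?U = "M\<lparr>mcar := U\<rparr>" and ?V = "M\<lparr>mcar := V\<rparr>"
  have U': "U \<subseteq> mcar M" "\<And>x. x \<in> U \<Longrightarrow> - x \<in> U" "\<And>x y. x \<in> U \<Longrightarrow> y \<in> U \<Longrightarrow> x + y \<in> U"
    using U unfolding submod_iff[OF M] by auto
  have V': "V \<subseteq> mcar M" "\<And>x. x \<in> V \<Longrightarrow> - x \<in> V" "\<And>x y. x \<in> V \<Longrightarrow> y \<in> V \<Longrightarrow> x + y \<in> V"
    using V unfolding submod_iff[OF M] by auto
  let ?f = "restr (U \<times> V) (\<lambda>(u, v). u + v)"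
  have lmU: "left_module ?U" "left_module ?V" using U V by (auto intro: submod_lm)
  have fH: "?f \<in> Hom (?U \<oplus> ?V) M"
  proof (rule HomI)
    fix x assume "x \<in> mcar (?U \<oplus> ?V)"
    then show "?f x \<in> mcar M" using U' V' lm_add[OF M] by (auto simp: subset_iff)
  next
    fix x y assume *: "x \<in> mcar (?U \<oplus> ?V)" "y \<in> mcar (?U \<oplus> ?V)"
    then have "x + y \<in> U \<times> V" using U' V' by auto
    with * show "?f (x + y) = ?f x + ?f y" by (auto simp: algebra_simps)
  next
    fix a x assume *: "x \<in> mcar (?U \<oplus> ?V)"
    then have "act (?U \<oplus> ?V) a x \<in> U \<times> V"
      using lm_act[OF lm_msum[OF lmU], of x a] by simp
    with * show "?f (act (?U \<oplus> ?V) a x) = act M a (?f x)"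
      using U' V' by (auto simp: lm_act_add[OF M] subset_iff)
  qed (simp add: restr_def)
  have "bij_betw ?f (mcar (?U \<oplus> ?V)) (mcar M)"
    unfolding bij_betw_def
  proof
    have "x = 0" if "x \<in> ker (?U \<oplus> ?V) ?f" for x
    proof -
      obtain u v where x1: "x = (u, v)" by (cases x)
      have x: "u \<in> U" "v \<in> V" "u + v = 0" using that x1 by (auto simp: ker_def)
      then have "u = - v" by (simp add: eq_neg_iff_add_eq_0)
      then have "u \<in> U \<inter> V" using x V'(2) by simp
      then have "u = 0" using i by blast
      then show ?thesis using x x1 by (simp add: zero_prod_def)
    qed
    moreover have "0 \<in> ker (?U \<oplus> ?V) ?f"
      using lm_0[OF lm_msum[OF lmU]] Hom_0[OF fH lm_msum[OF lmU]] by (simp add: ker_def)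
    ultimately show "inj_on ?f (mcar (?U \<oplus> ?V))"
      unfolding Hom_inj_iff[OF lm_msum[OF lmU] fH] by blast
    show "?f ` mcar (?U \<oplus> ?V) = mcar M"
    proof
      show "?f ` mcar (?U \<oplus> ?V) \<subseteq> mcar M" using Hom_in[OF fH] by blast
      show "mcar M \<subseteq> ?f ` mcar (?U \<oplus> ?V)"
      proof
        fix x assume "x \<in> mcar M"
        then obtain u v where "u \<in> U" "v \<in> V" "x = u + v" using s by blast
        then show "x \<in> ?f ` mcar (?U \<oplus> ?V)" by (intro image_eqI[of _ _ "(u, v)"]) auto
      qed
    qed
  qed
  then have "?U \<oplus> ?V \<cong> M" unfolding iso_mod_def using fH by blast
  then have "M \<cong> ?U \<oplus> ?V" using iso_sym lm_msum[OF lmU] M by blast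
  then have "mcar ?U = {0} \<or> mcar ?V = {0}"
    using assms lmU unfolding indecomposable_def by blast
  then show "U = {0} \<or> V = {0}" by simp
qed

lemma indec_imp_indecomposable:
  fixes M :: "('a::{ring,monoid_mult}, 'm::ab_group_add) lmod"
  assumes "indec M" "left_module M" "mcar M \<noteq> {0}" shows "indecomposable M"
  unfolding indecomposable_def
proof (intro conjI allI impI, (fact assms)+, elim conjE)
  fix U V :: "('a, 'm) lmod" assume U: "left_module U" and V: "left_module V" and "M \<cong> U \<oplus> V"
  then obtain f g where f: "f \<in> Hom M (U \<oplus> V)" and g: "g \<in> Hom (U \<oplus> V) M"
    and gf: "\<And>x. x \<in> mcar M \<Longrightarrow> g (f x) = x" and fg: "\<And>y. y \<in> mcar (U \<oplus> V) \<Longrightarrow> f (g y) = y"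
    using isoE[of M "U \<oplus> V"] assms lm_msum[OF U V] by metis
  note UV = lm_msum[OF U V]
  have sU: "submod (mcar U \<times> {0}) (U \<oplus> V)" "submod ({0} \<times> mcar V) (U \<oplus> V)"
    unfolding submod_iff[OF UV]
    using U V by (auto simp: zero_prod_def lm_0 lm_add lm_minus lm_act lm_act_0)
  let ?U = "g ` (mcar U \<times> {0})" and ?V = "g ` ({0} \<times> mcar V)"
  have "submod ?U M" "submod ?V M" using submod_image[OF UV assms(2) g] sU by auto
  moreover have "?U \<inter> ?V = {0}"
  proof -
    have "x = 0" if x: "x \<in> ?U" "x \<in> ?V" for x
    proof -
      obtain u v where *: "u \<in> mcar U" "v \<in> mcar V" "x = g (u, 0)" "x = g (0, v)" using x by auto
      then have "(u, 0) = (0, v)" using fg[of "(u, 0)"] fg[of "(0, v)"] U V by (simp add: lm_0)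
      then show ?thesis using * Hom_0[OF g UV] by (simp add: zero_prod_def)
    qed
    moreover have "0 \<in> ?U" "0 \<in> ?V"
      using Hom_0[OF g UV] lm_0[OF U] lm_0[OF V] by (force simp: zero_prod_def)+
    ultimately show ?thesis by blast
  qed
  moreover have "\<forall>x\<in>mcar M. \<exists>u\<in>?U. \<exists>v\<in>?V. x = u + v"
  proof
    fix x assume x: "x \<in> mcar M"
    obtain u v where uv: "f x = (u, v)" "u \<in> mcar U" "v \<in> mcar V" using Hom_in[OF f x] by auto
    have "x = g ((u, 0) + (0, v))" using gf[OF x] uv by simp
    also have "\<dots> = g (u, 0) + g (0, v)" using uv U V by (intro Hom_add[OF g]) (auto simp: lm_0)
    finally show "\<exists>u\<in>?U. \<exists>v\<in>?V. x = u + v" using uv by blast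
  qed
  ultimately have "?U = {0} \<or> ?V = {0}" using assms(1) unfolding indec_def by blast
  then show "mcar U = {0} \<or> mcar V = {0}"
  proof
    assume *: "?U = {0}"
    have "u = 0" if "u \<in> mcar U" for u
    proof -
      have "g (u, 0) = 0" using * that by blast
      then show ?thesis using that fg[of "(u, 0)"] Hom_0[OF f assms(2)] lm_0[OF V] by (simp add: zero_prod_def)
    qed
    then show ?thesis using lm_0[OF U] by blast
  next
    assume *: "?V = {0}"
    have "v = 0" if "v \<in> mcar V" for v
    proof -
      have "g (0, v) = 0" using * that by blast
      then show ?thesis using that fg[of "(0, v)"] Hom_0[OF f assms(2)] lm_0[OF U] by (simp add: zero_prod_def)
    qed
    then show ?thesis using lm_0[OF V] by blast
  qed
qed

lemma indec_iso:
  assumes "M \<cong> N" "left_module M" "left_module N" "indec M" shows "indec N"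
  unfolding indec_def
proof (intro allI impI, elim conjE)
  fix U V assume U: "submod U N" and V: "submod V N" and i: "U \<inter> V = {0}"
    and s: "\<forall>x\<in>mcar N. \<exists>u\<in>U. \<exists>v\<in>V. x = u + v"
  obtain f g where f: "f \<in> Hom M N" and g: "g \<in> Hom N M"
    and gf: "\<And>x. x \<in> mcar M \<Longrightarrow> g (f x) = x" and fg: "\<And>y. y \<in> mcar N \<Longrightarrow> f (g y) = y"
    using isoE[OF assms(1-3)] by metis
  have UN: "U \<subseteq> mcar N" "V \<subseteq> mcar N" using U V by (auto dest: submod_subset)
  have "submod (g ` U) M" "submod (g ` V) M" using submod_image[OF assms(3,2) g] U V by auto
  moreover have "g ` U \<inter> g ` V = {0}"
  proof -
    have "g ` U \<inter> g ` V = g ` (U \<inter> V)"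
      using UN fg by (intro inj_on_image_Int[symmetric, of _ "mcar N"]) (auto intro: inj_on_inverseI)
    then show ?thesis using i Hom_0[OF g assms(3)] by simp
  qed
  moreover have "\<forall>x\<in>mcar M. \<exists>u\<in>g ` U. \<exists>v\<in>g ` V. x = u + v"
  proof
    fix x assume x: "x \<in> mcar M"
    obtain u v where uv: "f x = u + v" "u \<in> U" "v \<in> V" using s Hom_in[OF f x] by blast
    have "x = g (u + v)" using gf[OF x] uv by simp
    also have "\<dots> = g u + g v" using uv UN by (intro Hom_add[OF g]) auto
    finally show "\<exists>u\<in>g ` U. \<exists>v\<in>g ` V. x = u + v" using uv by blast
  qed
  ultimately have "g ` U = {0} \<or> g ` V = {0}" using assms(4) unfolding indec_def by blast
  moreover have "W = {0}" if "g ` W = {0}" "W \<subseteq> mcar N" for W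
  proof -
    have "W = f ` g ` W" using that(2) fg by (force simp: image_image)
    then show ?thesis using that(1) Hom_0[OF f assms(2)] by simp
  qed
  ultimately show "U = {0} \<or> V = {0}" using UN by blast
qed

section \<open>Free and projective modules\<close>

definition free :: "nat \<Rightarrow> 'a::{ring,monoid_mult} seqmod" where
  "free k = \<lparr>mcar = {f. \<forall>i\<ge>k. f i = 0}, act = (\<lambda>a f i. a * f i)\<rparr>"

definition unit_vec :: "nat \<Rightarrow> nat \<Rightarrow> 'a::{ring,monoid_mult}" where
  "unit_vec i = (\<lambda>j. if j = i then 1 else 0)"

lemma sum_fun_apply: "(\<Sum>i\<in>I. f i) x = (\<Sum>i\<in>I. f i x)"
  by (induction I rule: infinite_finite_induct) auto

lemma lm_free: "left_module (free k)"
  unfolding left_module_def free_def by (auto simp: fun_eq_iff algebra_simps)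

lemma unit_vec_free: "i < k \<Longrightarrow> unit_vec i \<in> mcar (free k)"
  by (auto simp: unit_vec_def free_def)

lemma free_expand:
  assumes "x \<in> mcar (free k)" shows "x = (\<Sum>i<k. act (free k) (x i) (unit_vec i))"
proof
  fix j
  have "(\<Sum>i<k. act (free k) (x i) (unit_vec i)) j = (\<Sum>i<k. act (free k) (x i) (unit_vec i) j)"
    by (rule sum_fun_apply)
  also have "\<dots> = (\<Sum>i<k. if i = j then x i else 0)"
    by (intro sum.cong) (auto simp: free_def unit_vec_def)
  also have "\<dots> = x j" using assms by (simp add: free_def)
  finally show "x j = (\<Sum>i<k. act (free k) (x i) (unit_vec i)) j" ..
qed

lemma free_hom:
  assumes M: "left_module M" and m: "\<And>i. i < k \<Longrightarrow> m i \<in> mcar M"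
  shows "restr (mcar (free k)) (\<lambda>f. \<Sum>i<k. act M (f i) (m i)) \<in> Hom (free k) M"
proof (rule HomI)
  fix x y :: "nat \<Rightarrow> 'a" assume *: "x \<in> mcar (free k)" "y \<in> mcar (free k)"
  then have "x + y \<in> mcar (free k)" by (rule lm_add[OF lm_free])
  then show "restr (mcar (free k)) (\<lambda>f. \<Sum>i<k. act M (f i) (m i)) (x + y)
      = restr (mcar (free k)) (\<lambda>f. \<Sum>i<k. act M (f i) (m i)) x
      + restr (mcar (free k)) (\<lambda>f. \<Sum>i<k. act M (f i) (m i)) y"
    using * m by (simp add: lm_add_act[OF M] sum.distrib)
next
  fix a and x :: "nat \<Rightarrow> 'a" assume *: "x \<in> mcar (free k)"
  then have "act (free k) a x \<in> mcar (free k)" by (rule lm_act[OF lm_free])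
  moreover have "act M a (\<Sum>i<k. act M (x i) (m i)) = (\<Sum>i<k. act M (act (free k) a x i) (m i))"
    using m by (subst lm_act_sum[OF M]) (auto simp: lm_act[OF M] lm_mult[OF M] free_def intro!: sum.cong)
  ultimately show "restr (mcar (free k)) (\<lambda>f. \<Sum>i<k. act M (f i) (m i)) (act (free k) a x)
      = act M a (restr (mcar (free k)) (\<lambda>f. \<Sum>i<k. act M (f i) (m i)) x)"
    using * by simp
qed (auto simp: restr_def m intro!: lm_sum[OF M] lm_act[OF M])

lemma free_lift:
  assumes M: "left_module M" and N: "left_module N" and g: "g \<in> Hom M N" "g ` mcar M = mcar N"
    and f: "f \<in> Hom (free k) N"
  obtains h where "h \<in> Hom (free k) M" "g \<circ> h = f"
proof -
  have "\<exists>m. m \<in> mcar M \<and> g m = f (unit_vec i)" if "i < k" for i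
    using Hom_in[OF f unit_vec_free[OF that]] g(2) by (metis imageE)
  then obtain m where m: "\<And>i. i < k \<Longrightarrow> m i \<in> mcar M" "\<And>i. i < k \<Longrightarrow> g (m i) = f (unit_vec i)"
    by metis
  let ?h = "restr (mcar (free k)) (\<lambda>f. \<Sum>i<k. act M (f i) (m i))"
  have h: "?h \<in> Hom (free k) M" using free_hom[OF M m(1)] .
  have "(g \<circ> ?h) x = f x" if x: "x \<in> mcar (free k)" for x
  proof -
    have "f x = f (\<Sum>i<k. act (free k) (x i) (unit_vec i))" using free_expand[OF x] by simp
    also have "\<dots> = (\<Sum>i<k. f (act (free k) (x i) (unit_vec i)))"
      by (intro Hom_sum[OF f lm_free]) (auto intro: lm_act[OF lm_free] unit_vec_free)
    also have "\<dots> = (\<Sum>i<k. act N (x i) (f (unit_vec i)))"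
      by (intro sum.cong refl Hom_act[OF f]) (auto intro: unit_vec_free)
    also have "\<dots> = (\<Sum>i<k. g (act M (x i) (m i)))"
      using m by (intro sum.cong refl) (simp add: Hom_act[OF g(1)])
    also have "\<dots> = g (\<Sum>i<k. act M (x i) (m i))"
      using m by (intro Hom_sum[OF g(1) M, symmetric]) (auto intro: lm_act[OF M])
    finally show ?thesis using x by simp
  qed
  then have "g \<circ> ?h = f" using Hom_eqI[OF Hom_comp[OF M h g(1)] f] by blast
  with h show thesis by (rule that)
qed

text \<open>\<open>projective\<close> tests lifting only against modules on two fixed types. A
  retract of a free module of finite rank lifts against epimorphisms between modules on arbitrary
  types.\<close>

definition proj :: "('a::{ring,monoid_mult}, 'm::ab_group_add) lmod \<Rightarrow> bool" where
  "proj P \<longleftrightarrow> left_module P \<and> (\<exists>k. retract P (free k))"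

lemma proj_lift:
  assumes P: "proj P" and M: "left_module M" and N: "left_module N"
    and g: "g \<in> Hom M N" "g ` mcar M = mcar N" and f: "f \<in> Hom P N"
  obtains h where "h \<in> Hom P M" "g \<circ> h = f"
proof -
  obtain k i p where ip: "i \<in> Hom P (free k)" "p \<in> Hom (free k) P" "\<forall>x\<in>mcar P. p (i x) = x"
    using P unfolding proj_def retract_def by blast
  have Pm: "left_module P" using P by (simp add: proj_def)
  have "f \<circ> p \<in> Hom (free k) N" using Hom_comp[OF Pm ip(2) f] .
  then obtain h where h: "h \<in> Hom (free k) M" "g \<circ> h = f \<circ> p"
    using free_lift[OF M N g] by metis
  have hi: "h \<circ> i \<in> Hom P M" using Hom_comp[OF lm_free ip(1) h(1)] .
  moreover have "g \<circ> (h \<circ> i) = f"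
  proof (rule Hom_eqI[OF Hom_comp[OF M hi g(1)] f])
    fix x assume "x \<in> mcar P"
    then show "(g \<circ> (h \<circ> i)) x = f x" using h(2) ip(3) by (metis comp_apply)
  qed
  ultimately show thesis by (rule that)
qed

lemma proj_lift_sub:
  assumes P: "proj P" and M: "left_module M" and N: "left_module N"
    and g: "g \<in> Hom M N" and f: "f \<in> Hom P N" and sub: "f ` mcar P \<subseteq> g ` mcar M"
  obtains h where "h \<in> Hom P M" "g \<circ> h = f"
proof -
  have U: "submod (g ` mcar M) N" using submod_image[OF M N g submod_full[OF M]] .
  have "g \<in> Hom M (N\<lparr>mcar := g ` mcar M\<rparr>)" "f \<in> Hom P (N\<lparr>mcar := g ` mcar M\<rparr>)"
    using g f sub unfolding Hom_sub_iff[OF U] by auto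
  then show thesis using proj_lift[OF P M submod_lm[OF U], of g f] that by auto
qed

lemma proj_retract:
  assumes "retract P Q" "proj Q" "left_module P" shows "proj P"
  using assms retract_trans[OF assms(1) _ assms(3) _ lm_free] unfolding proj_def by blast

lemma fg_free_epi:
  assumes "fg_module M"
  obtains k f where "f \<in> Hom (free k) M" "f ` mcar (free k) = mcar M"
proof -
  obtain S where S: "finite S" "S \<subseteq> mcar M" "\<forall>x\<in>mcar M. \<exists>c. x = (\<Sum>s\<in>S. act M (c s) s)"
    and M: "left_module M" using assms unfolding fg_module_def by blast
  obtain m where m: "bij_betw m {0..<card S} S" using ex_bij_betw_nat_finite[OF S(1)] by blast
  let ?k = "card S"
  let ?f = "restr (mcar (free ?k)) (\<lambda>f. \<Sum>i<?k. act M (f i) (m i))"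
  have f: "?f \<in> Hom (free ?k) M"
    using m S(2) by (intro free_hom[OF M]) (auto simp: bij_betw_def atLeast0LessThan)
  have "x \<in> ?f ` mcar (free ?k)" if x: "x \<in> mcar M" for x
  proof -
    obtain c where c: "x = (\<Sum>s\<in>S. act M (c s) s)" using S(3) x by blast
    let ?y = "\<lambda>i. if i < ?k then c (m i) else 0"
    have y: "?y \<in> mcar (free ?k)" by (simp add: free_def)
    have "?f ?y = (\<Sum>i<?k. act M (c (m i)) (m i))" using y by simp
    also have "\<dots> = x" unfolding c
      using sum.reindex_bij_betw[OF m, of "\<lambda>s. act M (c s) s"] by (simp add: atLeast0LessThan)
    finally show ?thesis using y by blast
  qed
  then have "?f ` mcar (free ?k) = mcar M" using Hom_in[OF f] by blast
  with f show thesis by (rule that)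
qed

text \<open>Lifting the identity of \<open>P\<close> along an epimorphism from a free module of
  finite rank splits that epimorphism; this instance uses exactly the types that
  \<open>projective\<close> covers.\<close>

lemma projective_imp_proj:
  fixes P :: "('a::{ring,monoid_mult}, 'm::ab_group_add) lmod"
  assumes "projective P" "fg_module P" shows "proj P"
proof -
  have P: "left_module P" using assms(1) by (simp add: projective_def)
  obtain k and f :: "(nat \<Rightarrow> 'a) \<Rightarrow> 'm" where f: "f \<in> Hom (free k) P" "f ` mcar (free k) = mcar P"
    by (rule fg_free_epi[OF assms(2)])
  obtain h where h: "h \<in> Hom P (free k)" "f \<circ> h = idm P"
    using assms(1) lm_free P f Hom_id[OF P] unfolding projective_def by blast
  have "\<forall>x\<in>mcar P. f (h x) = x" using h(2) by (metis comp_apply restr_apply)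
  then show ?thesis unfolding proj_def retract_def using P h(1) f(1) by blast
qed

lemma proj_imp_projective:
  assumes "proj P" shows "projective P"
  unfolding projective_def
proof (intro conjI allI impI; (elim conjE)?)
  show "left_module P" using assms by (simp add: proj_def)
  fix M :: "'a seqmod" and N :: "('a, 'b) lmod" and g f
  assume "left_module M" "left_module N" "g \<in> Hom M N" "g ` mcar M = mcar N" "f \<in> Hom P N"
  then obtain h where "h \<in> Hom P M" "g \<circ> h = f" using proj_lift[OF assms, of M N g f] by blast
  then show "\<exists>h\<in>Hom P M. g \<circ> h = f" by blast
qed

section \<open>Modules as finite dimensional vector spaces\<close>

context fd_algebra
begin

definition sv :: "'k \<Rightarrow> (nat \<Rightarrow> 'a) \<Rightarrow> nat \<Rightarrow> 'a" where
  "sv c f = (\<lambda>i. scale c (f i))"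

definition sw :: "'k \<Rightarrow> ((nat \<Rightarrow> 'a) \<Rightarrow> nat \<Rightarrow> 'a) \<Rightarrow> (nat \<Rightarrow> 'a) \<Rightarrow> nat \<Rightarrow> 'a" where
  "sw c f = (\<lambda>x. sv c (f x))"

sublocale v: vspace sv
  by unfold_locales (auto simp: sv_def fun_eq_iff scale_right_distrib scale_left_distrib)

sublocale w: vspace sw
  by unfold_locales (auto simp: sw_def fun_eq_iff v.scale_right_distrib v.scale_left_distrib)

sublocale vv: vspace_pair sv sv ..

sublocale ww: vspace_pair sw sw ..

text \<open>
  The base field acts on a nice module by the pointwise scalar multiplication of the ambient group
  \<open>nat \<Rightarrow> 'a\<close>. So submodules are linear subspaces of that vector space, and \<open>Hom\<close> sets between nice
  modules are linear subspaces of a function space, which makes the library's \<open>dim\<close> applicable to both.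
\<close>

definition nice :: "'a seqmod \<Rightarrow> bool" where
  "nice M \<longleftrightarrow> left_module M \<and> (\<forall>c. \<forall>x\<in>mcar M. act M (scale c 1) x = sv c x) \<and> v.fin_dim (mcar M)"

lemma nice_lm: "nice M \<Longrightarrow> left_module M"
  and nice_act: "nice M \<Longrightarrow> x \<in> mcar M \<Longrightarrow> act M (scale c 1) x = sv c x"
  and nice_fin: "nice M \<Longrightarrow> v.fin_dim (mcar M)"
  by (simp_all add: nice_def)

lemma scale_one_mult: "scale c 1 * a = scale c a" "a * scale c 1 = scale c a"
  using scale_mult_left[of c 1 a] scale_mult_right[of c a 1] by simp_all

lemma nice_sv: "nice M \<Longrightarrow> x \<in> mcar M \<Longrightarrow> sv c x \<in> mcar M"
  using nice_act[of M x c] lm_act[OF nice_lm, of M x "scale c 1"] by simp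

text \<open>The elements \<open>scale c 1\<close> are central in the algebra, so each algebra
  element acts linearly over the base field.\<close>

lemma nice_act_sv:
  assumes "nice M" "x \<in> mcar M" shows "act M a (sv c x) = sv c (act M a x)"
proof -
  note M = nice_lm[OF assms(1)]
  have "act M a (sv c x) = act M (a * scale c 1) x"
    using assms by (simp add: nice_act[symmetric] lm_mult[OF M])
  also have "\<dots> = act M (scale c 1 * a) x" by (simp add: scale_one_mult)
  also have "\<dots> = sv c (act M a x)"
    using assms by (simp add: lm_mult[OF M] nice_act lm_act[OF M])
  finally show ?thesis .
qed

lemma nice_subspace:
  assumes "nice M" "submod U M" shows "v.subspace U"
proof -
  have U: "U \<subseteq> mcar M" "0 \<in> U" "\<And>x y. x \<in> U \<Longrightarrow> y \<in> U \<Longrightarrow> x + y \<in> U" "\<And>a x. x \<in> U \<Longrightarrow> act M a x \<in> U"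
    using assms(2) unfolding submod_iff[OF nice_lm[OF assms(1)]] by auto
  have "sv c x \<in> U" if "x \<in> U" for c x
    using U(4)[OF that, of "scale c 1"] nice_act[OF assms(1), of x c] U(1) that by (simp add: subset_iff)
  with U show ?thesis unfolding v.subspace_def by blast
qed

lemma nice_subspace': "nice M \<Longrightarrow> v.subspace (mcar M)"
  using nice_subspace[of M "mcar M"] submod_full[OF nice_lm, of M] by simp

lemma nice_sub: "nice M \<Longrightarrow> submod U M \<Longrightarrow> nice (M\<lparr>mcar := U\<rparr>)"
  unfolding nice_def using submod_lm[of U M] submod_subset[of U M] v.fin_dim_subset by auto

lemma Hom_sv: "nice M \<Longrightarrow> nice N \<Longrightarrow> f \<in> Hom M N \<Longrightarrow> x \<in> mcar M \<Longrightarrow> f (sv c x) = sv c (f x)"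
  using Hom_act[of f M N x "scale c 1"] Hom_in[of f M N x] by (simp add: nice_act)

lemma Hom_subspace:
  assumes "nice N" shows "w.subspace (Hom M N)"
  unfolding w.subspace_def
proof (intro conjI ballI allI)
  note N = nice_lm[OF assms]
  show "0 \<in> Hom M N" using Hom_zero[OF N] by (simp add: zero_fun_def)
  fix f assume f: "f \<in> Hom M N"
  show "f + g \<in> Hom M N" if "g \<in> Hom M N" for g
    using Hom_plus[OF N f that] by (simp add: plus_fun_def)
  show "sw c f \<in> Hom M N" for c
    using f by (intro HomI) (auto simp: sw_def Hom_in Hom_add Hom_act Hom_out nice_sv[OF assms]
        nice_act_sv[OF assms] v.scale_right_distrib)
qed

text \<open>The matrix units \<open>E b c\<close> for bases \<open>B\<close> and \<open>C\<close>
  span a space that contains every homomorphism. They are linear over the base field only and need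
  not belong to \<open>Hom M N\<close>, which \<open>fin_dim\<close> permits.\<close>

lemma Hom_fin_dim:
  assumes "nice M" "nice N" shows "w.fin_dim (Hom M N)"
proof -
  obtain B where B: "finite B" "B \<subseteq> mcar M" "v.independent B" "mcar M \<subseteq> v.span B"
    using v.fin_dim_basis[OF nice_fin[OF assms(1)]] by metis
  obtain C where C: "finite C" "C \<subseteq> mcar N" "v.independent C" "mcar N \<subseteq> v.span C"
    using v.fin_dim_basis[OF nice_fin[OF assms(2)]] by metis
  define E where "E b c = restr (mcar M) (\<lambda>x. sv (v.representation B x b) c)" for b c
  let ?S = "(\<lambda>(b, c). E b c) ` (B \<times> C)"
  have "f \<in> w.span ?S" if f: "f \<in> Hom M N" for f
  proof -
    have "f = (\<Sum>b\<in>B. \<Sum>c\<in>C. sw (v.representation C (f b) c) (E b c))" (is "f = ?r")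
    proof
      fix x
      have r: "?r x = (\<Sum>b\<in>B. \<Sum>c\<in>C. sv (v.representation C (f b) c) (E b c x))"
        by (simp add: sum_fun_apply sw_def)
      show "f x = ?r x"
      proof (cases "x \<in> mcar M")
        case False
        then show ?thesis unfolding r using Hom_out[OF f] by (simp add: E_def restr_def)
      next
        case True
        have fb: "f b = (\<Sum>c\<in>C. sv (v.representation C (f b) c) c)" if "b \<in> B" for b
          using v.sum_representation_eq[OF C(3) _ C(1) subset_refl, of "f b"] Hom_in[OF f] B(2) C(4) that
          by (metis subsetD)
        have "f x = f (\<Sum>b\<in>B. sv (v.representation B x b) b)"
          using v.sum_representation_eq[OF B(3) _ B(1) subset_refl, of x] True B(4)
          by (metis subsetD)
        also have "\<dots> = (\<Sum>b\<in>B. f (sv (v.representation B x b) b))"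
          using B(2) by (intro Hom_sum[OF f nice_lm[OF assms(1)]]) (auto intro: nice_sv[OF assms(1)])
        also have "\<dots> = (\<Sum>b\<in>B. sv (v.representation B x b) (f b))"
          using B(2) by (intro sum.cong refl Hom_sv[OF assms f]) auto
        also have "\<dots> = (\<Sum>b\<in>B. sv (v.representation B x b) (\<Sum>c\<in>C. sv (v.representation C (f b) c) c))"
          using fb by (intro sum.cong refl) simp
        also have "\<dots> = ?r x"
          unfolding r using True by (intro sum.cong refl) (simp add: E_def v.scale_sum_right mult.commute)
        finally show ?thesis .
      qed
    qed
    also have "\<dots> \<in> w.span ?S"
      by (intro w.span_sum w.span_scale w.span_base) auto
    finally show ?thesis .
  qed
  then show ?thesis unfolding w.fin_dim_def using B(1) C(1)
    by (intro exI[of _ ?S]) auto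
qed

lemma nice_fg:
  assumes "nice M" shows "fg_module M"
proof -
  obtain B where B: "finite B" "B \<subseteq> mcar M" "mcar M \<subseteq> v.span B"
    using v.fin_dim_basis[OF nice_fin[OF assms]] by metis
  have "\<exists>c. x = (\<Sum>s\<in>B. act M (c s) s)" if "x \<in> mcar M" for x
  proof -
    have "x \<in> range (\<lambda>u. \<Sum>b\<in>B. sv (u b) b)" using that B(3) v.span_finite[OF B(1)] by blast
    then obtain u where u: "x = (\<Sum>b\<in>B. sv (u b) b)" by blast
    have "x = (\<Sum>b\<in>B. act M (scale (u b) 1) b)"
      unfolding u using B(2) by (intro sum.cong refl) (auto simp: nice_act[OF assms])
    then show ?thesis by (intro exI[of _ "\<lambda>b. scale (u b) 1"])
  qed
  then show ?thesis unfolding fg_module_def using nice_lm[OF assms] B(1,2) by blast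
qed

lemma nice_free: "nice (free k)"
proof -
  obtain B where B: "finite B" "span B = UNIV" using finite_dimensional by blast
  define e :: "nat \<Rightarrow> 'a \<Rightarrow> nat \<Rightarrow> 'a" where "e i a = (\<lambda>j. if j = i then a else 0)" for i a
  let ?S = "(\<lambda>(i, b). e i b) ` ({..<k} \<times> B)"
  have e: "e i a \<in> v.span ?S" if "i < k" for i a
  proof -
    have "subspace {a. e i a \<in> v.span ?S}"
    proof (unfold subspace_def, intro conjI allI ballI)
      have "e i 0 = 0" by (auto simp: e_def fun_eq_iff)
      then show "0 \<in> {a. e i a \<in> v.span ?S}" by (simp add: v.span_zero)
      fix x assume x: "x \<in> {a. e i a \<in> v.span ?S}"
      show "x + y \<in> {a. e i a \<in> v.span ?S}" if "y \<in> {a. e i a \<in> v.span ?S}" for y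
      proof -
        have "e i (x + y) = e i x + e i y" by (auto simp: e_def fun_eq_iff)
        then show ?thesis using x that by (simp add: v.span_add)
      qed
      show "scale c x \<in> {a. e i a \<in> v.span ?S}" for c
      proof -
        have "e i (scale c x) = sv c (e i x)" by (auto simp: e_def fun_eq_iff sv_def)
        then show ?thesis using x by (simp add: v.span_scale)
      qed
    qed
    moreover have "B \<subseteq> {a. e i a \<in> v.span ?S}" using that by (auto intro: v.span_base)
    ultimately have "span B \<subseteq> {a. e i a \<in> v.span ?S}" by (intro span_minimal)
    then show ?thesis using B(2) by blast
  qed
  have "x \<in> v.span ?S" if x: "x \<in> mcar (free k)" for x
  proof -
    have "x = (\<Sum>i<k. e i (x i))"
      using free_expand[OF x] by (simp add: free_def unit_vec_def e_def if_distrib cong: if_cong)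
    also have "\<dots> \<in> v.span ?S" using e by (intro v.span_sum) auto
    finally show ?thesis .
  qed
  then have "v.fin_dim (mcar (free k))" unfolding v.fin_dim_def using B(1)
    by (intro exI[of _ ?S]) auto
  then show ?thesis unfolding nice_def using lm_free[of k]
    by (auto simp: free_def sv_def scale_one_mult)
qed

text \<open>The quotient is realized on a linear complement of \<open>U\<close>.\<close>

lemma nice_quotient:
  assumes M: "nice M" and U: "submod U M"
  obtains Q p where "nice Q" "p \<in> Hom M Q" "p ` mcar M = mcar Q" "ker M p = U"
proof -
  note Mm = nice_lm[OF M]
  have U': "U \<subseteq> mcar M" "0 \<in> U" "\<And>a x. x \<in> U \<Longrightarrow> act M a x \<in> U"
    using U unfolding submod_iff[OF Mm] by auto
  obtain g where g: "Vector_Spaces.linear sv sv g" "g ` mcar M \<subseteq> mcar M"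
    "\<And>x. x \<in> mcar M \<Longrightarrow> x - g x \<in> U" "\<And>x. x \<in> U \<Longrightarrow> g x = 0"
    using v.projection_exists[OF nice_subspace'[OF M] nice_subspace[OF M U] U'(1)] by metis
  interpret g: Vector_Spaces.linear sv sv g by (fact g(1))
  have gM: "g x \<in> mcar M" if "x \<in> mcar M" for x using g(2) that by blast
  have gg: "g (g x) = g x" if "x \<in> mcar M" for x
    using g(4)[OF g(3)[OF that]] by (simp add: g.diff)
  \<comment> \<open>\<open>x - g x\<close> lies in the submodule \<open>U\<close>, which is stable
    under the action and killed by \<open>g\<close>. This identity gives the associativity of the
    action transported to the complement.\<close>
  have gact: "g (act M a (g x)) = g (act M a x)" if x: "x \<in> mcar M" for a x
  proof -
    have "act M a x = act M a (x - g x) + act M a (g x)"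
      using lm_act_add[OF Mm, of "x - g x" "g x" a] lm_diff[OF Mm] gM x by simp
    then have "g (act M a x) = g (act M a (x - g x)) + g (act M a (g x))"
      by (simp add: g.add)
    then show ?thesis using g(4)[OF U'(3)[OF g(3)[OF x]]] by simp
  qed
  define Q where "Q = \<lparr>mcar = g ` mcar M, act = (\<lambda>a x. g (act M a x))\<rparr>"
  have QM: "y \<in> mcar M" "g y = y" if "y \<in> mcar Q" for y
    using that gM gg unfolding Q_def by auto
  have Q1: "left_module Q"
    unfolding left_module_def
  proof (intro conjI ballI allI)
    show "0 \<in> mcar Q" using lm_0[OF Mm] g.zero unfolding Q_def by force
    fix x assume x: "x \<in> mcar Q"
    have "g (- x) = - x" using QM[OF x] by (simp add: g.neg)
    then show "- x \<in> mcar Q" using lm_minus[OF Mm QM(1)[OF x]] unfolding Q_def by force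
    show "act Q 1 x = x" using QM[OF x] lm_one[OF Mm] by (simp add: Q_def)
    fix a
    show "act Q a x \<in> mcar Q" using QM[OF x] lm_act[OF Mm] by (simp add: Q_def)
    show "act Q (a * b) x = act Q a (act Q b x)" for b
      using QM[OF x] lm_act[OF Mm] by (simp add: Q_def lm_mult[OF Mm] gact)
    show "act Q (a + b) x = act Q a x + act Q b x" for b
      using QM[OF x] by (simp add: Q_def lm_add_act[OF Mm] g.add)
    fix y assume y: "y \<in> mcar Q"
    show "act Q a (x + y) = act Q a x + act Q a y"
      using QM[OF x] QM[OF y] by (simp add: Q_def lm_act_add[OF Mm] g.add)
    have "g (x + y) = x + y" using QM[OF x] QM[OF y] by (simp add: g.add)
    then show "x + y \<in> mcar Q" using lm_add[OF Mm QM(1)[OF x] QM(1)[OF y]] unfolding Q_def by force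
  qed
  have "act Q (scale c 1) x = sv c x" if "x \<in> mcar Q" for c x
    using QM[OF that] nice_act[OF M] by (simp add: Q_def g.scale)
  moreover have "v.fin_dim (mcar Q)"
    using v.fin_dim_subset[OF nice_fin[OF M]] QM by blast
  ultimately have Q: "nice Q" using Q1 by (simp add: nice_def)
  let ?p = "restr (mcar M) g"
  have "?p \<in> Hom M Q"
    by (intro HomI) (auto simp: restr_def Q_def g.add gact lm_add[OF Mm] lm_act[OF Mm])
  moreover have "?p ` mcar M = mcar Q" by (auto simp: Q_def)
  moreover have "ker M ?p = U"
    using g(3,4) U'(1) by (force simp: ker_def)
  ultimately show thesis using Q by (intro that)
qed

text \<open>A finitely generated module is isomorphic to a free module of finite rank modulo the
  kernel of an epimorphism, and this quotient can be realized on sequences. Afterwards only such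
  copies are measured.\<close>

lemma nice_copy:
  assumes "fg_module M" obtains N where "nice N" "M \<cong> N"
proof -
  have M: "left_module M" using assms by (simp add: fg_module_def)
  obtain k f where f: "f \<in> Hom (free k) M" "f ` mcar (free k) = mcar M"
    by (rule fg_free_epi[OF assms])
  obtain N p where N: "nice N" "p \<in> Hom (free k) N" "p ` mcar (free k) = mcar N" "ker (free k) p = ker (free k) f"
    using nice_quotient[OF nice_free submod_ker[OF lm_free M f(1)]] by metis
  have "M \<cong> N" using iso_of_same_kernel[OF lm_free M f nice_lm[OF N(1)] N(2,3)] N(4) by simp
  with N(1) show thesis by (rule that)
qed

lemma dim_rank_nullity:
  assumes "nice M" "nice N" "f \<in> Hom M N" "submod U M"
  shows "v.dim U = v.dim (f ` U) + v.dim {x \<in> U. f x = 0}"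
proof (rule vv.rank_nullity(1))
  have U: "U \<subseteq> mcar M" using assms(4) by (rule submod_subset)
  show "v.fin_dim U" using v.fin_dim_subset[OF nice_fin[OF assms(1)] U] .
  show "v.subspace U" using nice_subspace[OF assms(1,4)] .
  show "f (x + y) = f x + f y" if "x \<in> U" "y \<in> U" for x y using that U Hom_add[OF assms(3)] by blast
  show "f (sv c x) = sv c (f x)" if "x \<in> U" for c x using that U Hom_sv[OF assms(1-3)] by blast
qed

lemma submod_eqI:
  assumes "nice M" "submod U M" "submod V M" "U \<subseteq> V" "v.dim V \<le> v.dim U" shows "U = V"
  using v.subspace_eq_of_dim_le[OF v.fin_dim_subset[OF nice_fin[OF assms(1)] submod_subset[OF assms(3)]]
      nice_subspace[OF assms(1,2)] assms(4,5)] .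

lemma submod_dim_mono: "nice M \<Longrightarrow> submod V M \<Longrightarrow> U \<subseteq> V \<Longrightarrow> v.dim U \<le> v.dim V"
  by (intro v.dim_mono_fin v.fin_dim_subset[OF nice_fin submod_subset])

lemma endo_inj_iff_surj:
  assumes M: "nice M" and f: "f \<in> Hom M M"
  shows "ker M f = {0} \<longleftrightarrow> f ` mcar M = mcar M"
proof -
  note Mm = nice_lm[OF M]
  have k: "submod (ker M f) M" using submod_ker[OF Mm Mm f] .
  have i: "submod (f ` mcar M) M" using submod_image[OF Mm Mm f submod_full[OF Mm]] .
  have r: "v.dim (mcar M) = v.dim (f ` mcar M) + v.dim (ker M f)"
    using dim_rank_nullity[OF M M f submod_full[OF Mm]] by (simp add: ker_def)
  show ?thesis
  proof
    assume "ker M f = {0}"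
    then show "f ` mcar M = mcar M"
      using r v.dim_zero submod_eqI[OF M i submod_full[OF Mm]] submod_subset[OF i] by simp
  next
    assume "f ` mcar M = mcar M"
    then have "v.dim (ker M f) = 0" using r by simp
    then have "v.dim (ker M f) \<le> v.dim {0}" by simp
    then have "{0} = ker M f" using k Mm unfolding submod_iff[OF Mm]
      by (intro submod_eqI[OF M submod_zero[OF Mm] k]) auto
    then show "ker M f = {0}" ..
  qed
qed

end

section \<open>Minimal projective presentations and the Auslander--Reiten translation\<close>

lemma proj_free: "proj (free k)"
  unfolding proj_def using lm_free retract_iso[OF iso_refl[OF lm_free] lm_free lm_free] by blast

lemma Hom_incl: "submod U M \<Longrightarrow> restr U (\<lambda>x. x) \<in> Hom (M\<lparr>mcar := U\<rparr>) M"
  using Hom_id[OF submod_lm, of U M] Hom_sub_iff[of U M "restr U (\<lambda>x. x)" "M\<lparr>mcar := U\<rparr>"] by simp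

lemma superfluousD:
  assumes "superfluous L P" "submod U P" "\<And>x. x \<in> mcar P \<Longrightarrow> \<exists>u\<in>U. x - u \<in> L" "left_module P"
  shows "U = mcar P"
proof -
  have L: "submod L P" using assms(1) by (simp add: superfluous_def)
  have "{u + l |u l. u \<in> U \<and> l \<in> L} = mcar P"
  proof
    show "{u + l |u l. u \<in> U \<and> l \<in> L} \<subseteq> mcar P"
      using submod_subset[OF submod_plus[OF assms(4,2) L]] .
    show "mcar P \<subseteq> {u + l |u l. u \<in> U \<and> l \<in> L}"
    proof
      fix x assume "x \<in> mcar P"
      then obtain u where "u \<in> U" "x - u \<in> L" using assms(3) by blast
      moreover have "x = u + (x - u)" by simp
      ultimately show "x \<in> {u + l |u l. u \<in> U \<and> l \<in> L}" by blast
    qed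
  qed
  then show ?thesis using assms(1,2) unfolding superfluous_def by blast
qed

lemma cover_epi_onto:
  assumes P: "left_module P" and M: "left_module M" and p: "p \<in> Hom P M" "superfluous (ker P p) P"
    and N: "left_module N" and f: "f \<in> Hom N P" and s: "(p \<circ> f) ` mcar N = p ` mcar P"
  shows "f ` mcar N = mcar P"
proof (rule superfluousD[OF p(2) submod_image[OF N P f submod_full[OF N]] _ P])
  fix x assume x: "x \<in> mcar P"
  then have "p x \<in> (p \<circ> f) ` mcar N" using s by blast
  then obtain y where y: "y \<in> mcar N" "p x = p (f y)" by auto
  then have "x - f y \<in> ker P p"
    using x Hom_in[OF f] by (simp add: ker_def lm_diff[OF P] Hom_diff[OF p(1) P])
  then show "\<exists>u\<in>f ` mcar N. x - u \<in> ker P p" using y(1) by blast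
qed

context fd_algebra
begin

text \<open>
  Take \<open>P\<close> of least dimension. If \<open>U + ker p = P\<close>, then \<open>p\<close> lifts to an endomorphism \<open>h\<close> of \<open>P\<close> over
  \<open>M\<close> with image in \<open>U\<close>. By Fitting's lemma the stable image of \<open>h\<close> is a direct summand of \<open>P\<close>; it
  still maps onto \<open>M\<close>, so it is all of \<open>P\<close>.
\<close>

lemma nice_cover:
  fixes M :: "('a, 'm::ab_group_add) lmod"
  assumes "fg_module M"
  obtains P p where "nice P" "proj P" "p \<in> Hom P M" "p ` mcar P = mcar M" "superfluous (ker P p) P"
proof -
  have M: "left_module M" using assms by (simp add: fg_module_def)
  let ?C = "\<lambda>P p. nice P \<and> proj P \<and> p \<in> Hom P M \<and> p ` mcar P = mcar M"
  define D where "D d \<longleftrightarrow> (\<exists>P p. ?C P p \<and> v.dim (mcar P) = d)" for d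
  obtain k and f :: "(nat \<Rightarrow> 'a) \<Rightarrow> 'm" where "f \<in> Hom (free k) M" "f ` mcar (free k) = mcar M"
    by (rule fg_free_epi[OF assms])
  then have "?C (free k) f" using nice_free proj_free by blast
  then have "D (v.dim (mcar (free k)))" unfolding D_def by blast
  then have "D (LEAST d. D d)" by (rule LeastI)
  then obtain P p where P: "nice P" "proj P" and p: "p \<in> Hom P M" "p ` mcar P = mcar M"
    and d: "v.dim (mcar P) = (LEAST d. D d)" unfolding D_def by blast
  have least: "v.dim (mcar P) \<le> v.dim (mcar P')" if "?C P' p'" for P' p'
    unfolding d using that by (intro Least_le) (auto simp: D_def)
  note Pm = nice_lm[OF P(1)]
  have "superfluous (ker P p) P"
    unfolding superfluous_def
  proof (intro conjI allI impI; (elim conjE)?)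
    show "submod (ker P p) P" using submod_ker[OF Pm M p(1)] .
    fix U assume U: "submod U P" and s: "{u + l |u l. u \<in> U \<and> l \<in> ker P p} = mcar P"
    have UP: "U \<subseteq> mcar P" using submod_subset[OF U] .
    let ?U = "P\<lparr>mcar := U\<rparr>"
    have pU: "restr U p \<in> Hom ?U M" using Hom_restr[OF p(1) U Pm] .
    have "mcar M \<subseteq> restr U p ` mcar ?U"
    proof
      fix m assume "m \<in> mcar M"
      then obtain x where x: "x \<in> mcar P" "m = p x" using p(2) by blast
      then obtain u l where ul: "x = u + l" "u \<in> U" "l \<in> ker P p" using s by blast
      then have "m = p u" using x(2) UP Hom_add[OF p(1), of u l] by (auto simp: ker_def)
      then show "m \<in> restr U p ` mcar ?U" using ul(2) by force
    qed
    then have "restr U p ` mcar ?U = mcar M" using Hom_in[OF pU] by blast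
    then obtain h where h: "h \<in> Hom P ?U" "restr U p \<circ> h = p"
      using proj_lift[OF P(2) submod_lm[OF U] M pU _ p(1)] by blast
    have hP: "h \<in> Hom P P" and hU: "\<And>x. x \<in> mcar P \<Longrightarrow> h x \<in> U"
      using h(1) unfolding Hom_sub_iff[OF U] by auto
    have ph: "p (h x) = p x" if "x \<in> mcar P" for x
      using h(2) hU[OF that] by (metis comp_apply restr_apply)
    \<comment> \<open>The factor \<open>idm P\<close> matters for \<open>n = 0\<close> only, since
      \<open>h ^^ 0\<close> is not zero outside \<open>P\<close>.\<close>
    define H where "H n = (h ^^ n) \<circ> idm P" for n
    have H: "H n \<in> Hom P P" for n
    proof (induction n)
      case 0 then show ?case using Hom_comp_id[OF Hom_id[OF Pm] Pm] Hom_id[OF Pm] by (simp add: H_def)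
    next
      case (Suc n)
      have "H (Suc n) = h \<circ> H n" by (simp add: H_def comp_assoc)
      then show ?case using Hom_comp[OF Pm Suc hP] by (simp only:)
    qed
    have pH: "p (H n x) = p x" if "x \<in> mcar P" for n x
    proof (induction n)
      case 0 then show ?case using that by (simp add: H_def)
    next
      case (Suc n)
      have "H (Suc n) x = h (H n x)" by (simp add: H_def)
      then show ?case using Suc ph Hom_in[OF H that] by simp
    qed
    have HH: "H (m + n) x = H m (H n x)" if "x \<in> mcar P" for m n x
      using Hom_in[OF H that, of n] that by (simp add: H_def funpow_add)
    \<comment> \<open>The rank is minimized over the positive powers of \<open>h\<close>. For the
      minimal one, \<open>e\<close>, the power \<open>e \<circ> e\<close> cannot have smaller rank,
      so \<open>e\<close> maps its image onto itself. The successor guarantees that \<open>h\<close>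
      is applied last, which puts the image of \<open>e\<close> inside \<open>U\<close>.\<close>
    define d where "d n = v.dim (H (Suc n) ` mcar P)" for n
    obtain N where N: "\<And>n. d N \<le> d n" using ex_has_least_nat[of "\<lambda>_. True" 0 d] by blast
    define e where "e = H (Suc N)"
    let ?I = "e ` mcar P"
    have eH: "e \<in> Hom P P" unfolding e_def by (rule H)
    have I: "submod ?I P" using submod_image[OF Pm Pm eH submod_full[OF Pm]] .
    have IP: "?I \<subseteq> mcar P" using submod_subset[OF I] .
    have "H (Suc (N + Suc N)) ` mcar P = e ` ?I"
      using HH[of _ "Suc N" "Suc N"] by (auto simp: e_def image_image intro!: image_cong)
    then have "v.dim ?I \<le> v.dim (e ` ?I)"
      using N[of "N + Suc N"] by (simp add: d_def e_def)
    then have eI: "e ` ?I = ?I"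
      using submod_eqI[OF P(1) submod_image[OF Pm Pm eH I] I] IP by blast
    let ?P = "P\<lparr>mcar := ?I\<rparr>"
    have nP: "nice ?P" using nice_sub[OF P(1) I] .
    note lP = nice_lm[OF nP]
    have r1: "restr ?I e \<in> Hom ?P P" using Hom_restr[OF eH I Pm] .
    then have r: "restr ?I e \<in> Hom ?P ?P" unfolding Hom_sub_iff[OF I] using eI by auto
    have "restr ?I e ` mcar ?P = mcar ?P" using eI by (simp add: image_def)
    then have "bij_betw (restr ?I e) (mcar ?P) (mcar ?P)"
      using endo_inj_iff_surj[OF nP r] Hom_inj_iff[OF lP r] by (simp add: bij_betw_def)
    then obtain b where b: "b \<in> Hom ?P ?P" "\<And>x. x \<in> mcar ?P \<Longrightarrow> b (restr ?I e x) = x"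
      using Hom_inverse[OF lP lP r] by metis
    \<comment> \<open>On its stable image \<open>e\<close> is bijective with inverse
      \<open>b\<close>, so \<open>b \<circ> e\<close> is a retraction onto that image, which is
      therefore projective and competes with \<open>P\<close> for the least dimension.\<close>
    have "e \<in> Hom P ?P" unfolding Hom_sub_iff[OF I] using eH by auto
    then have "b \<circ> e \<in> Hom P ?P" using Hom_comp[OF lP _ b(1)] by blast
    moreover have "restr ?I (\<lambda>x. x) \<in> Hom ?P P"
      by (rule Hom_incl[OF I])
    moreover have "\<forall>x\<in>mcar ?P. (b \<circ> e) (restr ?I (\<lambda>x. x) x) = x" using b(2) by simp
    ultimately have "retract ?P P" unfolding retract_def by blast
    then have prP: "proj ?P" using proj_retract P(2) lP by blast
    have pI: "restr ?I p \<in> Hom ?P M" using Hom_restr[OF p(1) I Pm] .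
    have "mcar M \<subseteq> restr ?I p ` mcar ?P"
    proof
      fix m assume "m \<in> mcar M"
      then obtain x where x: "x \<in> mcar P" "m = p x" using p(2) by blast
      then have "m = restr ?I p (e x)" using pH[OF x(1)] by (simp add: e_def)
      then show "m \<in> restr ?I p ` mcar ?P" using x(1) by auto
    qed
    then have "restr ?I p ` mcar ?P = mcar M" using Hom_in[OF pI] by blast
    then have "v.dim (mcar P) \<le> v.dim ?I" using least[of ?P "restr ?I p"] nP prP pI by simp
    then have "?I = mcar P" using submod_eqI[OF P(1) I submod_full[OF Pm] IP] by simp
    moreover have "?I \<subseteq> U"
    proof -
      have "e x = h (H N x)" for x by (simp add: e_def H_def)
      then show ?thesis using hU Hom_in[OF H] by auto
    qed
    ultimately show "U = mcar P" using UP by blast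
  qed
  with P p show thesis by (intro that)
qed

lemma min_presentation_exists:
  fixes M :: "('a, 'm::ab_group_add) lmod"
  assumes "fg_module M"
  obtains P1 p1 P0 p0 where "min_proj_presentation M P1 p1 P0 p0" "nice P1" "nice P0"
proof -
  have M: "left_module M" using assms by (simp add: fg_module_def)
  obtain P0 p0 where P0: "nice P0" "proj P0" "p0 \<in> Hom P0 M" "p0 ` mcar P0 = mcar M"
    "superfluous (ker P0 p0) P0" by (rule nice_cover[OF assms])
  let ?K = "P0\<lparr>mcar := ker P0 p0\<rparr>"
  have K: "nice ?K" using nice_sub[OF P0(1) submod_ker[OF nice_lm[OF P0(1)] M P0(3)]] .
  obtain P1 p1 where P1: "nice P1" "proj P1" "p1 \<in> Hom P1 ?K" "p1 ` mcar P1 = mcar ?K"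
    "superfluous (ker P1 p1) P1" by (rule nice_cover[OF nice_fg[OF K]])
  have "min_proj_presentation M P1 p1 P0 p0"
    unfolding min_proj_presentation_def projective_cover_def
    using P0 P1 nice_fg proj_imp_projective by blast
  then show thesis using P1(1) P0(1) by (rule that)
qed

lemma min_presentationD:
  fixes M :: "('a, 'm::ab_group_add) lmod"
  assumes "min_proj_presentation M P1 p1 P0 p0" "left_module M"
  shows "proj P1" "proj P0" "p1 \<in> Hom P1 P0" "p0 \<in> Hom P0 M" "p0 ` mcar P0 = mcar M"
    "p1 ` mcar P1 = ker P0 p0" "superfluous (ker P1 p1) P1" "superfluous (ker P0 p0) P0"
proof -
  have *: "projective_cover P0 p0 M" "projective_cover P1 p1 (P0\<lparr>mcar := ker P0 p0\<rparr>)"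
    using assms(1) by (auto simp: min_proj_presentation_def)
  show "proj P1" "proj P0" using * projective_imp_proj by (auto simp: projective_cover_def)
  show "p0 \<in> Hom P0 M" "p0 ` mcar P0 = mcar M" "p1 ` mcar P1 = ker P0 p0" "superfluous (ker P1 p1) P1"
    "superfluous (ker P0 p0) P0"
    using * by (auto simp: projective_cover_def)
  then have "submod (ker P0 p0) P0"
    using submod_ker \<open>proj P0\<close> assms(2) by (auto simp: proj_def)
  then show "p1 \<in> Hom P1 P0" using * Hom_sub_iff by (auto simp: projective_cover_def)
qed

text \<open>For a minimal presentation of M this is the dual form of Hom(N, \<tau>M) = 0: the map
  Hom(P0, N) \<rightarrow> Hom(P1, N) induced by \<open>p1\<close> is surjective.\<close>

definition factors :: "'a seqmod \<Rightarrow> ((nat \<Rightarrow> 'a) \<Rightarrow> (nat \<Rightarrow> 'a)) \<Rightarrow> 'a seqmod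
    \<Rightarrow> ('a, 'n::ab_group_add) lmod \<Rightarrow> bool" where
  "factors P1 p1 P0 N \<longleftrightarrow> (\<forall>q\<in>Hom P1 N. \<exists>h\<in>Hom P0 N. h \<circ> p1 = q)"

lemma regular_simps [simp]: "mcar regular = UNIV" "act regular = (*)"
  by (simp_all add: regular_def)

lemma lm_regular: "left_module regular"
  unfolding left_module_def by (auto simp: algebra_simps)

text \<open>
  A linear form on \<open>Hom (P1, N)\<close> that vanishes on the maps factoring through \<open>p1\<close> sends
  \<open>x\<close> in \<open>N\<close> to the form \<open>h \<mapsto> l (p \<mapsto> h p x)\<close> on \<open>Hom (P1, A)\<close>.
\<close>

lemma factors_of_Hom_dual_transpose:
  assumes P1: "proj P1" and P0: "left_module P0" and p1: "p1 \<in> Hom P1 P0" and N: "nice N"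
    and z: "Hom N (dual_transpose scale P1 p1 P0) \<subseteq> {0}"
  shows "factors P1 p1 P0 N"
  unfolding factors_def
proof (rule ballI, rule ccontr)
  fix q assume q: "q \<in> Hom P1 N" and "\<not> (\<exists>h\<in>Hom P0 N. h \<circ> p1 = q)"
  note Nm = nice_lm[OF N]
  have P1m: "left_module P1" using P1 by (simp add: proj_def)
  let ?B = "(\<lambda>h. h \<circ> p1) ` Hom P0 N"
  have qB: "q \<notin> ?B" using \<open>\<not> _\<close> by blast
  have "w.subspace ?B"
    unfolding w.subspace_def
  proof (intro conjI ballI allI)
    note S = Hom_subspace[OF N, of P0]
    show "0 \<in> ?B" using w.subspace_0[OF S] by (intro image_eqI[of _ _ 0]) (auto simp: fun_eq_iff)
    fix x assume "x \<in> ?B"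
    then obtain f where f: "f \<in> Hom P0 N" "x = f \<circ> p1" by blast
    show "sw c x \<in> ?B" for c
      unfolding f(2) using w.subspace_scale[OF S f(1), of c]
      by (intro image_eqI[of _ _ "sw c f"]) (simp_all add: sw_def comp_def)
    fix y assume "y \<in> ?B"
    then obtain g where g: "g \<in> Hom P0 N" "y = g \<circ> p1" by blast
    show "x + y \<in> ?B"
      unfolding f(2) g(2) using w.subspace_add[OF S f(1) g(1)]
      by (intro image_eqI[of _ _ "f + g"]) (simp_all add: fun_eq_iff)
  qed
  then obtain l where l: "Vector_Spaces.linear sw (*) l" "\<And>x. x \<in> ?B \<Longrightarrow> l x = 0" "l q = 1"
    using w.separating_functional[OF _ qB] by metis
  interpret l: Vector_Spaces.linear sw "(*)" l by (fact l(1))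
  \<comment> \<open>\<open>t h x\<close> is \<open>h\<close> followed by the map a \<mapsto> a x
    from the algebra to \<open>N\<close>. Such maps generate Hom(P1, N) additively, because
    \<open>P1\<close> is projective and finitely generated.\<close>
  define t :: "((nat \<Rightarrow> 'a) \<Rightarrow> 'a) \<Rightarrow> (nat \<Rightarrow> 'a) \<Rightarrow> (nat \<Rightarrow> 'a) \<Rightarrow> nat \<Rightarrow> 'a"
    where "t h x = (\<lambda>p. act N (h p) x)" for h x
  have tH: "t h x \<in> Hom P N" if "h \<in> Hom P regular" "x \<in> mcar N" for P :: "'a seqmod" and h x
    using that unfolding t_def
    by (intro HomI) (auto simp: Hom_in Hom_add Hom_act Hom_out lm_act[OF Nm] lm_add_act[OF Nm]
        lm_mult[OF Nm] lm_0_act[OF Nm])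
  have t_add: "t (\<lambda>p. h p + h' p) x = t h x + t h' x" if "x \<in> mcar N" for h h' x
    using that by (auto simp: t_def lm_add_act[OF Nm])
  have t_add': "t h (x + y) = t h x + t h y" if "x \<in> mcar N" "y \<in> mcar N" for h x y
    using that by (auto simp: t_def lm_act_add[OF Nm])
  have t_act: "t (\<lambda>p. h p * a) x = t h (act N a x)" if "x \<in> mcar N" for h a x
    using that by (auto simp: t_def lm_mult[OF Nm])
  have t_sc: "t (\<lambda>p. scale c (h p)) x = sw c (t h x)" if x: "x \<in> mcar N" for h c x
  proof -
    have "act N (scale c a) x = sv c (act N a x)" for a
      using x by (metis lm_mult[OF Nm] lm_act[OF Nm] nice_act[OF N] scale_one_mult(1))
    then show ?thesis by (simp add: t_def sw_def)
  qed
  have R: "(\<lambda>p. h p * a) \<in> Hom P1 regular" if "h \<in> Hom P1 regular" for h a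
    using that by (intro HomI) (auto simp: Hom_add Hom_act Hom_out algebra_simps)
  have R': "(\<lambda>p. scale c (h p)) \<in> Hom P1 regular" if "h \<in> Hom P1 regular" for h c
    using that by (intro HomI) (auto simp: Hom_add Hom_act Hom_out scale_right_distrib scale_mult_right)
  define F where "F = restr (mcar N) (\<lambda>x h. if h \<in> Hom P1 regular then l (t h x) else 0)"
  have "F \<in> Hom N (dual_transpose scale P1 p1 P0)"
  proof (rule HomI)
    fix x assume x: "x \<in> mcar N"
    have "l (t (h \<circ> p1) x) = 0" if h: "h \<in> Hom P0 regular" for h
    proof -
      have "t (h \<circ> p1) x = t h x \<circ> p1" by (auto simp: t_def)
      then show ?thesis using l(2) tH[OF h x] by auto
    qed
    moreover have "h + h' \<in> Hom P1 regular" if "h \<in> Hom P1 regular" "h' \<in> Hom P1 regular" for h h'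
      using Hom_plus[OF lm_regular that] by (simp add: plus_fun_def)
    ultimately show "F x \<in> mcar (dual_transpose scale P1 p1 P0)"
      unfolding dual_transpose_def using x R' t_add[OF x] t_sc[OF x] Hom_comp[OF P0 p1]
      by (auto simp: F_def plus_fun_def[of _ "_ :: (nat \<Rightarrow> 'a) \<Rightarrow> 'a"] l.add[unfolded plus_fun_def[of _ "_ :: (nat \<Rightarrow> 'a) \<Rightarrow> nat \<Rightarrow> 'a"]] l.scale l.add)
  next
    fix x y assume "x \<in> mcar N" "y \<in> mcar N"
    then show "F (x + y) = F x + F y"
      by (auto simp: F_def fun_eq_iff t_add' l.add lm_add[OF Nm])
  next
    fix a x assume "x \<in> mcar N"
    then show "F (act N a x) = act (dual_transpose scale P1 p1 P0) a (F x)"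
      using R by (auto simp: F_def fun_eq_iff lm_act[OF Nm] dual_transpose_def t_act)
  qed (simp add: F_def restr_def)
  then have "F = 0" using z by blast
  then have lt: "l (t h x) = 0" if "h \<in> Hom P1 regular" "x \<in> mcar N" for h x
    using that by (auto simp: F_def restr_def fun_eq_iff split: if_splits)
  \<comment> \<open>The coordinates of \<open>i\<close> together with the images under
    \<open>p\<close> of the unit vectors form a dual basis of \<open>P1\<close>. It writes
    \<open>q\<close> as a sum of maps \<open>t h x\<close>, on which \<open>l\<close> vanishes,
    against \<open>l q = 1\<close>.\<close>
  obtain k i p where ip: "i \<in> Hom P1 (free k)" "p \<in> Hom (free k) P1" "\<forall>x\<in>mcar P1. p (i x) = x"
    using P1 unfolding proj_def retract_def by blast
  have i: "(\<lambda>x. i x j) \<in> Hom P1 regular" for j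
    using ip(1) by (intro HomI) (auto simp: Hom_add Hom_act Hom_out free_def)
  have qp: "q \<circ> p \<in> Hom (free k) N" using Hom_comp[OF P1m ip(2) q] .
  have pe: "q (p (unit_vec j)) \<in> mcar N" if "j < k" for j
    using Hom_in[OF q Hom_in[OF ip(2) unit_vec_free[OF that]]] .
  have "q = (\<Sum>j<k. t (\<lambda>x. i x j) (q (p (unit_vec j))))"
  proof (rule Hom_eqI[OF q])
    show "(\<Sum>j<k. t (\<lambda>x. i x j) (q (p (unit_vec j)))) \<in> Hom P1 N"
      using tH[OF i] pe by (intro w.subspace_sum[OF Hom_subspace[OF N]]) auto
    fix x assume x: "x \<in> mcar P1"
    have "q x = (q \<circ> p) (i x)" using ip(3) x by simp
    also have "\<dots> = (q \<circ> p) (\<Sum>j<k. act (free k) (i x j) (unit_vec j))"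
      using free_expand[OF Hom_in[OF ip(1) x]] by simp
    also have "\<dots> = (\<Sum>j<k. (q \<circ> p) (act (free k) (i x j) (unit_vec j)))"
      by (intro Hom_sum[OF qp lm_free]) (auto intro: lm_act[OF lm_free] unit_vec_free)
    also have "\<dots> = (\<Sum>j<k. act N (i x j) ((q \<circ> p) (unit_vec j)))"
      by (intro sum.cong refl Hom_act[OF qp]) (auto intro: unit_vec_free)
    finally show "q x = (\<Sum>j<k. t (\<lambda>x. i x j) (q (p (unit_vec j)))) x"
      by (simp add: t_def sum_fun_apply)
  qed
  then have "l q = (\<Sum>j<k. l (t (\<lambda>x. i x j) (q (p (unit_vec j)))))"
    using l.sum[of "\<lambda>j. t (\<lambda>x. i x j) (q (p (unit_vec j)))" "{..<k}"] by simp
  also have "\<dots> = 0" using lt[OF i] pe by simp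
  finally show False using l(3) by simp
qed

text \<open>
  The inclusion of \<open>M\<close> in \<open>T\<close> and the projection onto \<open>M\<close> lift to maps between the presentations.
  Their composition on the presentation of \<open>M\<close> need not be the identity, but it is invertible, as
  the presentation is minimal.
\<close>

lemma factors_transfer:
  assumes T: "left_module T" "min_proj_presentation T P1 p1 P0 p0"
    and M: "left_module M" "min_proj_presentation M R1 r1 R0 r0" "nice R1" "nice R0"
    and MT: "retract M T" and N: "left_module N" and fac: "factors P1 p1 P0 N"
  shows "factors R1 r1 R0 N"
  unfolding factors_def
proof
  fix q assume q: "q \<in> Hom R1 N"
  note P = min_presentationD[OF T(2,1)] and R = min_presentationD[OF M(2,1)]
  note R1 = nice_lm[OF M(3)] and R0 = nice_lm[OF M(4)]
  have P1: "left_module P1" and P0: "left_module P0" using P(1,2) by (auto simp: proj_def)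
  obtain i p where i: "i \<in> Hom M T" and p: "p \<in> Hom T M" and pi: "\<And>x. x \<in> mcar M \<Longrightarrow> p (i x) = x"
    using MT unfolding retract_def by blast
  obtain b0 where b0: "b0 \<in> Hom R0 P0" "p0 \<circ> b0 = i \<circ> r0"
    using proj_lift[OF R(2) P0 T(1) P(4,5) Hom_comp[OF M(1) R(4) i]] .
  obtain a0 where a0: "a0 \<in> Hom P0 R0" "r0 \<circ> a0 = p \<circ> p0"
    using proj_lift[OF P(2) R0 M(1) R(4,5) Hom_comp[OF T(1) P(4) p]] .
  have r01: "r0 (r1 x) = 0" if "x \<in> mcar R1" for x using R(6) that by (auto simp: ker_def)
  have p01: "p0 (p1 x) = 0" if "x \<in> mcar P1" for x using P(6) that by (auto simp: ker_def)
  have "(b0 \<circ> r1) ` mcar R1 \<subseteq> p1 ` mcar P1"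
  proof
    fix y assume "y \<in> (b0 \<circ> r1) ` mcar R1"
    then obtain x where x: "x \<in> mcar R1" "y = b0 (r1 x)" by auto
    have "p0 y = i (r0 (r1 x))" using b0(2) x(2) by (metis comp_apply)
    then have "p0 y = 0" using r01[OF x(1)] Hom_0[OF i M(1)] by simp
    then show "y \<in> p1 ` mcar P1"
      unfolding P(6) ker_def using x Hom_in[OF b0(1) Hom_in[OF R(3)]] by simp
  qed
  then obtain b1 where b1: "b1 \<in> Hom R1 P1" "p1 \<circ> b1 = b0 \<circ> r1"
    by (rule proj_lift_sub[OF R(1) P1 P0 P(3) Hom_comp[OF R0 R(3) b0(1)]])
  have "(a0 \<circ> p1) ` mcar P1 \<subseteq> r1 ` mcar R1"
  proof
    fix y assume "y \<in> (a0 \<circ> p1) ` mcar P1"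
    then obtain x where x: "x \<in> mcar P1" "y = a0 (p1 x)" by auto
    have "r0 y = p (p0 (p1 x))" using a0(2) x(2) by (metis comp_apply)
    then have "r0 y = 0" using p01[OF x(1)] Hom_0[OF p T(1)] by simp
    then show "y \<in> r1 ` mcar R1"
      unfolding R(6) ker_def using x Hom_in[OF a0(1) Hom_in[OF P(3)]] by simp
  qed
  then obtain a1 where a1: "a1 \<in> Hom P1 R1" "r1 \<circ> a1 = a0 \<circ> p1"
    by (rule proj_lift_sub[OF P(1) R1 R0 R(3) Hom_comp[OF P0 P(3) a0(1)]])
  let ?c0 = "a0 \<circ> b0" and ?c1 = "a1 \<circ> b1"
  have c0: "?c0 \<in> Hom R0 R0" using Hom_comp[OF P0 b0(1) a0(1)] .
  have c1: "?c1 \<in> Hom R1 R1" using Hom_comp[OF P1 b1(1) a1(1)] .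
  have rc0: "r0 (?c0 x) = r0 x" if "x \<in> mcar R0" for x
  proof -
    have "r0 (?c0 x) = p (p0 (b0 x))" using a0(2) by (metis comp_apply)
    also have "\<dots> = p (i (r0 x))" using b0(2) by (metis comp_apply)
    finally show ?thesis using pi Hom_in[OF R(4) that] by simp
  qed
  have rc1: "r1 (?c1 x) = ?c0 (r1 x)" for x
  proof -
    have "r1 (?c1 x) = a0 (p1 (b1 x))" using a1(2) by (metis comp_apply)
    also have "\<dots> = a0 (b0 (r1 x))" using b1(2) by (metis comp_apply)
    finally show ?thesis by simp
  qed
  \<comment> \<open>As \<open>?c0\<close> lies over the identity of \<open>M\<close>, it is
    surjective by minimality, hence injective by dimension. It then restricts to an automorphism of
    the kernel of \<open>r0\<close>, and with this \<open>?c1\<close> is surjective by the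
    minimality of the second cover.\<close>
  have "(r0 \<circ> ?c0) ` mcar R0 = r0 ` mcar R0" using rc0 by (auto simp: image_iff)
  then have "?c0 ` mcar R0 = mcar R0"
    by (rule cover_epi_onto[OF R0 M(1) R(4,8) R0 c0])
  then have k0: "ker R0 ?c0 = {0}" using endo_inj_iff_surj[OF M(4) c0] by blast
  let ?K = "R0\<lparr>mcar := ker R0 r0\<rparr>"
  have K: "submod (ker R0 r0) R0" using submod_ker[OF R0 M(1) R(4)] .
  have KR: "ker R0 r0 \<subseteq> mcar R0" by (auto simp: ker_def)
  have nK: "nice ?K" using nice_sub[OF M(4) K] .
  have "restr (ker R0 r0) ?c0 \<in> Hom ?K R0" using Hom_restr[OF c0 K R0] .
  moreover have "restr (ker R0 r0) ?c0 ` mcar ?K \<subseteq> ker R0 r0"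
    using rc0 Hom_in[OF c0] by (auto simp: ker_def)
  ultimately have cK: "restr (ker R0 r0) ?c0 \<in> Hom ?K ?K" unfolding Hom_sub_iff[OF K] by blast
  have "ker ?K (restr (ker R0 r0) ?c0) \<subseteq> ker R0 ?c0" using KR by (auto simp: ker_def)
  moreover have "0 \<in> ker ?K (restr (ker R0 r0) ?c0)"
    using Hom_0[OF cK nice_lm[OF nK]] lm_0[OF nice_lm[OF nK]] by (simp add: ker_def)
  ultimately have "ker ?K (restr (ker R0 r0) ?c0) = {0}" using k0 by blast
  then have sK: "restr (ker R0 r0) ?c0 ` mcar ?K = mcar ?K" using endo_inj_iff_surj[OF nK cK] by blast
  have "(r1 \<circ> ?c1) ` mcar R1 = r1 ` mcar R1"
  proof -
    have "(r1 \<circ> ?c1) ` mcar R1 = ?c0 ` r1 ` mcar R1" using rc1 by (auto simp: image_iff)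
    also have "\<dots> = ?c0 ` ker R0 r0" using R(6) by simp
    also have "\<dots> = restr (ker R0 r0) ?c0 ` ker R0 r0" by (intro image_cong) auto
    also have "\<dots> = r1 ` mcar R1" using sK R(6) by simp
    finally show ?thesis .
  qed
  then have s1: "?c1 ` mcar R1 = mcar R1"
    by (rule cover_epi_onto[OF R1 R0 R(3,7) R1 c1])
  then have "bij_betw ?c1 (mcar R1) (mcar R1)"
    using endo_inj_iff_surj[OF M(3) c1] Hom_inj_iff[OF R1 c1] by (simp add: bij_betw_def)
  then obtain d where d: "d \<in> Hom R1 R1" "\<And>x. x \<in> mcar R1 \<Longrightarrow> d (?c1 x) = x"
    using Hom_inverse[OF R1 R1 c1] by metis
  \<comment> \<open>The factor \<open>d\<close> undoes \<open>?c1 = a1 \<circ> b1\<close>: after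
    composing the extension \<open>h\<close> with \<open>b0\<close>, the map obtained on
    \<open>R1\<close> is \<open>q\<close> itself.\<close>
  have "q \<circ> (d \<circ> a1) \<in> Hom P1 N" using Hom_comp[OF R1 Hom_comp[OF R1 a1(1) d(1)] q] .
  then obtain h where h: "h \<in> Hom P0 N" "h \<circ> p1 = q \<circ> (d \<circ> a1)"
    using fac unfolding factors_def by blast
  have hb: "h \<circ> b0 \<in> Hom R0 N" using Hom_comp[OF P0 b0(1) h(1)] .
  have "h \<circ> b0 \<circ> r1 = q"
  proof (rule Hom_eqI[OF Hom_comp[OF R0 R(3) hb] q])
    fix x assume x: "x \<in> mcar R1"
    have "(h \<circ> b0 \<circ> r1) x = h (p1 (b1 x))" using b1(2) by (metis comp_apply)
    also have "\<dots> = q (d (?c1 x))" using h(2) by (metis comp_apply)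
    finally show "(h \<circ> b0 \<circ> r1) x = q x" using d(2)[OF x] by simp
  qed
  then show "\<exists>h\<in>Hom R0 N. h \<circ> r1 = q" using hb by blast
qed

text \<open>A map from \<open>N\<close> to the translate of \<open>T\<close>, composed with the
  retraction of \<open>T\<close> onto \<open>N\<close>, is an endomorphism-like map that rigidity
  kills, and the retraction is surjective. The two summands \<open>M\<close> and \<open>N\<close>
  may differ, which is what allows one to compare an X_i with a Y_j inside X_i \<oplus> Y_j.\<close>

lemma tau_rigid_factors:
  assumes T: "tau_rigid scale T" and M: "left_module M" "min_proj_presentation M R1 r1 R0 r0" "nice R1" "nice R0"
    and N: "nice N" and "retract M T" "retract N T"
  shows "factors R1 r1 R0 N"
proof -
  have fg: "fg_module T" and H: "Hom T (tau scale T) = {0}" using T by (auto simp: tau_rigid_def)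
  have Tm: "left_module T" using fg by (simp add: fg_module_def)
  obtain P1 p1 P0 p0 where S: "(SOME (P1, p1, P0, p0). min_proj_presentation T P1 p1 P0 p0) = (P1, p1, P0, p0)"
    by (metis prod_cases4)
  have "\<exists>x. case x of (P1, p1, P0, p0) \<Rightarrow> min_proj_presentation T P1 p1 P0 p0"
    using min_presentation_exists[OF fg] by (metis case_prodI)
  from someI_ex[OF this] S have P: "min_proj_presentation T P1 p1 P0 p0" by simp
  note D = min_presentationD[OF P Tm]
  have tau: "tau scale T = dual_transpose scale P1 p1 P0" by (simp add: tau_def S)
  obtain i p where ip: "i \<in> Hom N T" "p \<in> Hom T N" "\<forall>x\<in>mcar N. p (i x) = x"
    using assms(8) unfolding retract_def by blast
  have "f = 0" if f: "f \<in> Hom N (dual_transpose scale P1 p1 P0)" for f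
  proof
    have "f \<circ> p \<in> Hom T (tau scale T)" unfolding tau using Hom_comp[OF nice_lm[OF N] ip(2) f] .
    then have z: "f \<circ> p = 0" using H by blast
    fix x
    show "f x = 0 x"
    proof (cases "x \<in> mcar N")
      case True
      then have "f x = (f \<circ> p) (i x)" using ip(3) by simp
      then show ?thesis using z by simp
    next
      case False
      then show ?thesis using Hom_out[OF f] by simp
    qed
  qed
  moreover have "left_module P0" using D(2) by (simp add: proj_def)
  ultimately have "factors P1 p1 P0 N"
    using factors_of_Hom_dual_transpose[OF D(1) _ D(3) N] by blast
  then show ?thesis using factors_transfer[OF Tm P M assms(7) nice_lm[OF N]] by blast
qed

end

section \<open>Additive functions and paths of non-isomorphisms\<close>

context fd_algebra
begin

section \<open>Dimensions of homomorphism spaces and additive functions\<close>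

abbreviation hdim :: "'a seqmod \<Rightarrow> 'a seqmod \<Rightarrow> nat" where
  "hdim M N \<equiv> w.dim (Hom M N)"

lemma hdim_pos:
  assumes "nice M" "nice N" "f \<in> Hom M N" "f x \<noteq> 0" shows "hdim M N > 0"
proof (rule ccontr)
  assume "\<not> hdim M N > 0"
  then have "Hom M N \<subseteq> {0}" using w.dim_eq_0_fin[OF Hom_fin_dim[OF assms(1,2)]] by simp
  then show False using assms(3,4) by auto
qed

lemma hdim_zero: "Hom M N = {0} \<Longrightarrow> hdim M N = 0"
  by (simp add: w.dim_zero)

lemma Hom_eq_zeroI:
  assumes "left_module N" "\<And>f x. f \<in> Hom M N \<Longrightarrow> x \<in> mcar M \<Longrightarrow> f x = 0" shows "Hom M N = {0}"
proof -
  have "f = 0" if "f \<in> Hom M N" for f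
  proof
    fix x show "f x = 0 x" using assms(2) that by (cases "x \<in> mcar M") (auto simp: Hom_out)
  qed
  moreover have "0 \<in> Hom M N" using Hom_zero[OF assms(1)] by (simp add: zero_fun_def)
  ultimately show ?thesis by blast
qed

text \<open>Composition with \<open>p\<close> maps Hom(P, X) onto Hom(P, Q), as \<open>P\<close> is
  projective, and the maps it kills are those with values in the kernel of \<open>p\<close>. Rank
  and nullity give the formula.\<close>

lemma hdim_exact:
  assumes P: "nice P" "proj P" and X: "nice X" and Q: "nice Q" and p: "p \<in> Hom X Q" "p ` mcar X = mcar Q"
  shows "hdim P X = hdim P (X\<lparr>mcar := ker X p\<rparr>) + hdim P Q"
proof -
  note Pm = nice_lm[OF P(1)] and Xm = nice_lm[OF X] and Qm = nice_lm[OF Q]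
  have K: "submod (ker X p) X" using submod_ker[OF Xm Qm p(1)] .
  have fX: "f x \<in> mcar X" if "f \<in> Hom P X" for f x
    using that lm_0[OF Xm] by (cases "x \<in> mcar P") (auto simp: Hom_in Hom_out)
  have "w.dim (Hom P X) = w.dim ((\<lambda>f. p \<circ> f) ` Hom P X) + w.dim {f \<in> Hom P X. p \<circ> f = 0}"
  proof (rule ww.rank_nullity(1)[OF Hom_fin_dim[OF P(1) X] Hom_subspace[OF X]])
    show "p \<circ> (f + g) = (p \<circ> f) + (p \<circ> g)" if "f \<in> Hom P X" "g \<in> Hom P X" for f g
      by (intro ext) (simp add: Hom_add[OF p(1) fX[OF that(1)] fX[OF that(2)]])
    show "p \<circ> sw c f = sw c (p \<circ> f)" if "f \<in> Hom P X" for c f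
      by (intro ext) (simp add: sw_def Hom_sv[OF X Q p(1) fX[OF that]])
  qed
  moreover have "(\<lambda>f. p \<circ> f) ` Hom P X = Hom P Q"
  proof
    show "(\<lambda>f. p \<circ> f) ` Hom P X \<subseteq> Hom P Q" using Hom_comp[OF Xm _ p(1)] by blast
    show "Hom P Q \<subseteq> (\<lambda>f. p \<circ> f) ` Hom P X"
    proof
      fix g assume "g \<in> Hom P Q"
      then obtain h where "h \<in> Hom P X" "p \<circ> h = g" using proj_lift[OF P(2) Xm Qm p] by blast
      then show "g \<in> (\<lambda>f. p \<circ> f) ` Hom P X" by blast
    qed
  qed
  moreover have "{f \<in> Hom P X. p \<circ> f = 0} = Hom P (X\<lparr>mcar := ker X p\<rparr>)"
  proof -
    have "(p \<circ> f = 0) = (f ` mcar P \<subseteq> ker X p)" if f: "f \<in> Hom P X" for f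
    proof
      assume "p \<circ> f = 0"
      then have "p (f x) = 0" for x by (simp add: fun_eq_iff)
      then show "f ` mcar P \<subseteq> ker X p" using fX[OF f] by (auto simp: ker_def)
    next
      assume *: "f ` mcar P \<subseteq> ker X p"
      show "p \<circ> f = 0"
      proof
        fix x
        show "(p \<circ> f) x = 0 x"
          using * Hom_out[OF f, of x] Hom_0[OF p(1) Xm]
          by (cases "x \<in> mcar P") (auto simp: ker_def)
      qed
    qed
    then show ?thesis using Hom_sub_iff[OF K, of _ P] by auto
  qed
  ultimately show ?thesis by simp
qed

definition additive :: "('a seqmod \<Rightarrow> real) \<Rightarrow> bool" where
  "additive t \<longleftrightarrow> (\<forall>X Q p. nice X \<and> nice Q \<and> p \<in> Hom X Q \<and> p ` mcar X = mcar Q \<longrightarrow>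
     t X = t (X\<lparr>mcar := ker X p\<rparr>) + t Q)"

lemma additiveD:
  "additive t \<Longrightarrow> nice X \<Longrightarrow> nice Q \<Longrightarrow> p \<in> Hom X Q \<Longrightarrow> p ` mcar X = mcar Q \<Longrightarrow>
     t X = t (X\<lparr>mcar := ker X p\<rparr>) + t Q"
  unfolding additive_def by blast

lemma additive_hdim: "nice P \<Longrightarrow> proj P \<Longrightarrow> additive (\<lambda>X. real (hdim P X))"
  unfolding additive_def using hdim_exact by auto

lemma additive_diff: "additive s \<Longrightarrow> additive t \<Longrightarrow> additive (\<lambda>X. s X - t X)"
  unfolding additive_def by fastforce

lemma additive_sum: "(\<And>i. i \<in> I \<Longrightarrow> additive (t i)) \<Longrightarrow> additive (\<lambda>X. \<Sum>i\<in>I. c i * t i X)"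
  unfolding additive_def by (auto simp: sum.distrib[symmetric] distrib_left[symmetric] intro!: sum.cong)

text \<open>The zero map of \<open>X\<close> onto itself has kernel \<open>X\<close>, so additivity
  reads t X = t X + t X.\<close>

lemma additive_zero:
  assumes "additive t" "nice X" "mcar X = {0}" shows "t X = 0"
proof -
  have z: "(\<lambda>x. 0) \<in> Hom X X" using Hom_zero[OF nice_lm[OF assms(2)]] .
  have "ker X (\<lambda>x. 0 :: nat \<Rightarrow> 'a) = mcar X" by (auto simp: ker_def)
  then have "X\<lparr>mcar := ker X (\<lambda>x. 0 :: nat \<Rightarrow> 'a)\<rparr> = X" by simp
  moreover have "(\<lambda>x. 0 :: nat \<Rightarrow> 'a) ` mcar X = mcar X" using assms(3) by simp
  ultimately show ?thesis using additiveD[OF assms(1,2,2) z] by simp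
qed

lemma additive_iso:
  assumes "additive t" "nice X" "nice Y" "X \<cong> Y" shows "t X = t Y"
proof -
  obtain f where f: "f \<in> Hom X Y" "bij_betw f (mcar X) (mcar Y)" using assms(4) unfolding iso_mod_def by blast
  have k: "ker X f = {0}" using f(2) Hom_inj_iff[OF nice_lm[OF assms(2)] f(1)] by (simp add: bij_betw_def)
  have "nice (X\<lparr>mcar := {0}\<rparr>)" using nice_sub[OF assms(2) submod_zero[OF nice_lm[OF assms(2)]]] .
  then have "t (X\<lparr>mcar := {0}\<rparr>) = 0" using additive_zero[OF assms(1)] by simp
  then show ?thesis
    using additiveD[OF assms(1-3) f(1)] f(2) k by (simp add: bij_betw_def)
qed

text \<open>The kernel is a proper submodule of greatest dimension, so no submodule lies strictly
  between it and \<open>X\<close>. The dimension estimate drives the induction in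
  \<open>additive_eq_zero\<close>.\<close>

lemma simple_quotient:
  assumes X: "nice X" "mcar X \<noteq> {0}"
  obtains Q p where "nice Q" "simple_mod Q" "p \<in> Hom X Q" "p ` mcar X = mcar Q"
    "v.dim (ker X p) < v.dim (mcar X)"
proof -
  note Xm = nice_lm[OF X(1)]
  let ?P = "\<lambda>U. submod U X \<and> U \<noteq> mcar X"
  have "?P {0}" using submod_zero[OF Xm] X(2) by auto
  moreover have "\<forall>U. ?P U \<longrightarrow> v.dim U < Suc (v.dim (mcar X))"
    using submod_dim_mono[OF X(1) submod_full[OF Xm] submod_subset] by (auto simp: less_Suc_eq_le)
  ultimately obtain U where U: "?P U" and max: "\<And>V. ?P V \<Longrightarrow> v.dim V \<le> v.dim U"
    using ex_has_greatest_nat[of ?P "{0}" v.dim "Suc (v.dim (mcar X))"] by (metis order_less_imp_le)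
  obtain Q p where Q: "nice Q" "p \<in> Hom X Q" "p ` mcar X = mcar Q" "ker X p = U"
    using nice_quotient[OF X(1), of U] U by blast
  note Qm = nice_lm[OF Q(1)]
  have "simple_mod Q"
    unfolding simple_mod_def
  proof (intro conjI allI impI)
    show "mcar Q \<noteq> {0}"
    proof
      assume "mcar Q = {0}"
      then have "ker X p = mcar X" using Hom_in[OF Q(2)] by (auto simp: ker_def)
      then show False using Q(4) U by simp
    qed
    fix V assume V: "submod V Q"
    let ?W = "{x \<in> mcar X. p x \<in> V}"
    have W: "submod ?W X" using submod_preimage[OF Xm Qm Q(2) V] .
    have V': "V \<subseteq> mcar Q" "0 \<in> V" using V unfolding submod_iff[OF Qm] by auto
    have pW: "p ` ?W = V"
    proof
      show "V \<subseteq> p ` ?W"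
      proof
        fix y assume "y \<in> V"
        then obtain x where "x \<in> mcar X" "p x = y" using V'(1) Q(3) by (metis imageE subsetD)
        then show "y \<in> p ` ?W" using \<open>y \<in> V\<close> by blast
      qed
    qed blast
    show "V = {0} \<or> V = mcar Q"
    proof (cases "?W = mcar X")
      case True
      then show ?thesis using pW Q(3) by simp
    next
      case False
      have "U \<subseteq> ?W" using Q(4) V'(2) by (auto simp: ker_def)
      then have "U = ?W" using max[of ?W] W False U by (intro submod_eqI[OF X(1) _ W]) auto
      then have "p ` ker X p = V" using pW Q(4) by simp
      then have "V \<subseteq> {0}" by (auto simp: ker_def)
      then show ?thesis using V'(2) by blast
    qed
  qed (fact Qm)
  moreover have "v.dim (ker X p) < v.dim (mcar X)"
    using submod_eqI[OF X(1) _ submod_full[OF Xm], of U] U Q(4) submod_subset[of U X] by fastforce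
  ultimately show thesis using Q by (intro that)
qed

lemma additive_eq_zero:
  assumes t: "additive t" and s: "\<And>S. nice S \<Longrightarrow> simple_mod S \<Longrightarrow> t S = 0" and X: "nice X"
  shows "t X = 0"
  using X
proof (induction "v.dim (mcar X)" arbitrary: X rule: less_induct)
  case less
  note Xm = nice_lm[OF less.prems]
  show ?case
  proof (cases "mcar X = {0}")
    case True
    then show ?thesis using additive_zero[OF t less.prems] by simp
  next
    case False
    then obtain Q p where Q: "nice Q" "simple_mod Q" "p \<in> Hom X Q" "p ` mcar X = mcar Q"
      "v.dim (ker X p) < v.dim (mcar X)" using simple_quotient[OF less.prems] by metis
    have "nice (X\<lparr>mcar := ker X p\<rparr>)"
      using nice_sub[OF less.prems submod_ker[OF Xm nice_lm[OF Q(1)] Q(3)]] .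
    then have "t (X\<lparr>mcar := ker X p\<rparr>) = 0" using less.hyps[of "X\<lparr>mcar := ker X p\<rparr>"] Q(5) by simp
    then show ?thesis using additiveD[OF t less.prems Q(1,3,4)] s[OF Q(1,2)] by simp
  qed
qed

text \<open>Additive functions are determined by their values on one representative of each class of
  simple modules, which leaves \<open>num_simples\<close> coordinates. That this number is positive
  ensures that the set of classes is finite, since \<open>card\<close> assigns 0 to infinite
  sets.\<close>

lemma additive_dependence:
  assumes "finite I" "\<And>i. i \<in> I \<Longrightarrow> additive (t i)" "num_simples TYPE('a) > 0" "num_simples TYPE('a) < card I"
  obtains c where "\<exists>i\<in>I. c i \<noteq> 0" "\<And>X. nice X \<Longrightarrow> (\<Sum>i\<in>I. c i * t i X) = 0"
proof -
  let ?C = "{S :: 'a seqmod. simple_mod S} // iso_rel"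
  have "finite ?C" using assms(3) unfolding num_simples_def by (metis card.infinite less_irrefl)
  moreover have "card ?C < card I" using assms(4) by (simp add: num_simples_def)
  moreover define r where "r C = (SOME S :: 'a seqmod. S \<in> C \<and> nice S)" for C
  ultimately obtain c where c: "\<exists>i\<in>I. c i \<noteq> 0" "\<And>C. C \<in> ?C \<Longrightarrow> (\<Sum>i\<in>I. c i * t i (r C)) = 0"
    using exists_linear_dependence[of ?C I "\<lambda>i C. t i (r C)"] assms(1) by auto
  have "(\<Sum>i\<in>I. c i * t i S) = 0" if S: "nice S" "simple_mod S" for S
  proof -
    let ?D = "iso_rel `` {S}"
    have "S \<in> ?D" using nice_lm[OF S(1)] iso_refl by (auto simp: iso_rel_def)
    then have "\<exists>T. T \<in> ?D \<and> nice T" using S(1) by blast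
    then have "r ?D \<in> ?D \<and> nice (r ?D)" unfolding r_def by (rule someI_ex)
    then have "S \<cong> r ?D" "nice (r ?D)" by (auto simp: iso_rel_def)
    then have "t i S = t i (r ?D)" if "i \<in> I" for i using additive_iso assms(2) S(1) that by blast
    moreover have "?D \<in> ?C" using S(2) by (auto intro: quotientI)
    ultimately show ?thesis using c(2)[of ?D] by simp
  qed
  moreover have "additive (\<lambda>X. \<Sum>i\<in>I. c i * t i X)" using assms(2) by (rule additive_sum)
  ultimately have "(\<Sum>i\<in>I. c i * t i X) = 0" if "nice X" for X
    using additive_eq_zero[of "\<lambda>X. \<Sum>i\<in>I. c i * t i X" X] that by simp
  with c(1) show thesis by (rule that)
qed

text \<open>Minimality is left out, so that a projective module may be presented by its own identity
  and the zero module of relations.\<close>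

definition pres :: "'a seqmod \<Rightarrow> ((nat \<Rightarrow> 'a) \<Rightarrow> (nat \<Rightarrow> 'a)) \<Rightarrow> 'a seqmod
    \<Rightarrow> ((nat \<Rightarrow> 'a) \<Rightarrow> (nat \<Rightarrow> 'a)) \<Rightarrow> 'a seqmod \<Rightarrow> bool" where
  "pres R1 r1 R0 r0 M \<longleftrightarrow> nice R1 \<and> nice R0 \<and> proj R1 \<and> proj R0 \<and> r1 \<in> Hom R1 R0 \<and>
     r0 \<in> Hom R0 M \<and> r0 ` mcar R0 = mcar M \<and> r1 ` mcar R1 = ker R0 r0"

lemma presD:
  assumes "pres R1 r1 R0 r0 M"
  shows "nice R1" "nice R0" "proj R1" "proj R0" "r1 \<in> Hom R1 R0" "r0 \<in> Hom R0 M"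
    "r0 ` mcar R0 = mcar M" "r1 ` mcar R1 = ker R0 r0" "\<And>x. x \<in> mcar R1 \<Longrightarrow> r0 (r1 x) = 0"
  using assms unfolding pres_def by (auto simp: ker_def)

text \<open>The sequence 0 \<rightarrow> Hom(M, X) \<rightarrow> Hom(R0, X) \<rightarrow> Hom(R1, X)
  is exact for every presentation; \<open>factors\<close> says that its last map is onto.\<close>

lemma hdim_factors:
  assumes M: "nice M" and R: "pres R1 r1 R0 r0 M" and X: "nice X" and f: "factors R1 r1 R0 X"
  shows "hdim R0 X = hdim R1 X + hdim M X"
proof -
  note R = presD[OF R]
  note Xm = nice_lm[OF X] and Mm = nice_lm[OF M] and R0 = nice_lm[OF R(2)]
  have "w.dim (Hom R0 X) = w.dim ((\<lambda>f. f \<circ> r1) ` Hom R0 X) + w.dim {f \<in> Hom R0 X. f \<circ> r1 = 0}"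
    by (rule ww.rank_nullity(1)[OF Hom_fin_dim[OF R(2) X] Hom_subspace[OF X]])
      (auto simp: sw_def fun_eq_iff)
  moreover have "(\<lambda>f. f \<circ> r1) ` Hom R0 X = Hom R1 X"
  proof
    show "(\<lambda>f. f \<circ> r1) ` Hom R0 X \<subseteq> Hom R1 X" using Hom_comp[OF R0 R(5), of _ X] by auto
    show "Hom R1 X \<subseteq> (\<lambda>f. f \<circ> r1) ` Hom R0 X"
    proof
      fix q assume "q \<in> Hom R1 X"
      then obtain h where "h \<in> Hom R0 X" "h \<circ> r1 = q" using f unfolding factors_def by metis
      then show "q \<in> (\<lambda>f. f \<circ> r1) ` Hom R0 X" by (intro image_eqI[of _ _ h]) simp_all
    qed
  qed
  moreover have "w.dim {f \<in> Hom R0 X. f \<circ> r1 = 0} = w.dim (Hom M X)"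
  proof (rule ww.dim_bij[OF Hom_fin_dim[OF M X] Hom_subspace[OF X], of "\<lambda>g. g \<circ> r0"])
    show "bij_betw (\<lambda>g. g \<circ> r0) (Hom M X) {f \<in> Hom R0 X. f \<circ> r1 = 0}"
      unfolding bij_betw_def
    proof
      show "inj_on (\<lambda>g. g \<circ> r0) (Hom M X)"
      proof (rule inj_onI)
        fix g g' assume *: "g \<in> Hom M X" "g' \<in> Hom M X" "g \<circ> r0 = g' \<circ> r0"
        show "g = g'"
        proof (rule Hom_eqI[OF *(1,2)])
          fix y assume "y \<in> mcar M"
          then obtain x where "y = r0 x" using R(7) by blast
          then show "g y = g' y" using *(3) by (metis comp_apply)
        qed
      qed
      show "(\<lambda>g. g \<circ> r0) ` Hom M X = {f \<in> Hom R0 X. f \<circ> r1 = 0}"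
      proof
        show "(\<lambda>g. g \<circ> r0) ` Hom M X \<subseteq> {f \<in> Hom R0 X. f \<circ> r1 = 0}"
        proof
          fix f assume "f \<in> (\<lambda>g. g \<circ> r0) ` Hom M X"
          then obtain g where g: "g \<in> Hom M X" "f = g \<circ> r0" by blast
          have "f (r1 x) = 0" for x
            using R(9)[of x] Hom_out[OF R(5), of x] Hom_0[OF R(6) R0] Hom_0[OF g(1) Mm] g(2)
            by (cases "x \<in> mcar R1") auto
          then have "f \<circ> r1 = 0" by (simp add: fun_eq_iff)
          moreover have "f \<in> Hom R0 X" unfolding g(2) using Hom_comp[OF Mm R(6) g(1)] .
          ultimately show "f \<in> {f \<in> Hom R0 X. f \<circ> r1 = 0}" by blast
        qed
        show "{f \<in> Hom R0 X. f \<circ> r1 = 0} \<subseteq> (\<lambda>g. g \<circ> r0) ` Hom M X"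
        proof
          fix f assume "f \<in> {f \<in> Hom R0 X. f \<circ> r1 = 0}"
          then have f: "f \<in> Hom R0 X" and z: "\<And>x. f (r1 x) = 0" by (auto simp: fun_eq_iff)
          have "ker R0 r0 \<subseteq> ker R0 f" unfolding R(8)[symmetric]
            using z Hom_in[OF R(5)] by (auto simp: ker_def)
          then obtain h where "h \<in> Hom M X" "h \<circ> r0 = f"
            using Hom_factor[OF R0 Mm R(6,7) f] by blast
          then show "f \<in> (\<lambda>g. g \<circ> r0) ` Hom M X" by blast
        qed
      qed
    qed
  qed (auto simp: sw_def fun_eq_iff)
  ultimately show ?thesis by simp
qed

lemma factors_quotient:
  assumes R: "proj R1" "left_module R0" "r1 \<in> Hom R1 R0" and X: "left_module X" and Q: "left_module Q"
    and p: "p \<in> Hom X Q" "p ` mcar X = mcar Q" and f: "factors R1 r1 R0 X"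
  shows "factors R1 r1 R0 Q"
  unfolding factors_def
proof
  fix q assume "q \<in> Hom R1 Q"
  then obtain q' where q': "q' \<in> Hom R1 X" "p \<circ> q' = q" using proj_lift[OF R(1) X Q p] by metis
  then obtain h where h: "h \<in> Hom R0 X" "h \<circ> r1 = q'" using f unfolding factors_def by blast
  then have "p \<circ> h \<in> Hom R0 Q" "(p \<circ> h) \<circ> r1 = q"
    using Hom_comp[OF X h(1) p(1)] q'(2) by (auto simp: comp_assoc)
  then show "\<exists>h\<in>Hom R0 Q. h \<circ> r1 = q" by blast
qed

text \<open>The sum of \<open>U\<close> and the image of \<open>g\<close> is a quotient of the
  direct sum of \<open>U\<close> and \<open>N\<close>. On the direct sum the factorization is done
  componentwise, and it passes to quotients.\<close>

lemma factors_sum: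
  assumes R: "proj R1" "left_module R0" "r1 \<in> Hom R1 R0" and X: "left_module X" and U: "submod U X"
    and N: "left_module N" and g: "g \<in> Hom N X"
    and fU: "factors R1 r1 R0 (X\<lparr>mcar := U\<rparr>)" and fN: "factors R1 r1 R0 N"
  shows "factors R1 r1 R0 (X\<lparr>mcar := {u + y |u y. u \<in> U \<and> y \<in> g ` mcar N}\<rparr>)"
proof -
  let ?U = "X\<lparr>mcar := U\<rparr>" and ?W = "{u + y |u y. u \<in> U \<and> y \<in> g ` mcar N}"
  have gN: "submod (g ` mcar N) X" using submod_image[OF N X g submod_full[OF N]] .
  have W: "submod ?W X" using submod_plus[OF X U gN] .
  have UX: "U \<subseteq> mcar X" using submod_subset[OF U] .
  note Um = submod_lm[OF U]
  note UN = lm_msum[OF Um N]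
  let ?p = "restr (mcar (?U \<oplus> N)) (\<lambda>(u, y). u + g y)"
  have pX: "?p \<in> Hom (?U \<oplus> N) X"
  proof (rule HomI)
    fix x assume "x \<in> mcar (?U \<oplus> N)"
    then show "?p x \<in> mcar X" using UX Hom_in[OF g] lm_add[OF X] by (auto simp: subset_iff)
  next
    fix x y assume *: "x \<in> mcar (?U \<oplus> N)" "y \<in> mcar (?U \<oplus> N)"
    then show "?p (x + y) = ?p x + ?p y"
      using lm_add[OF UN *] Hom_add[OF g] by (auto simp: algebra_simps)
  next
    fix a x assume *: "x \<in> mcar (?U \<oplus> N)"
    then show "?p (act (?U \<oplus> N) a x) = act X a (?p x)"
      using lm_act[OF UN *, of a] UX Hom_act[OF g] Hom_in[OF g]
      by (auto simp: lm_act_add[OF X] subset_iff)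
  qed (simp add: restr_def)
  have im: "?p ` mcar (?U \<oplus> N) = ?W" by (force simp: restr_def)
  have p: "?p \<in> Hom (?U \<oplus> N) (X\<lparr>mcar := ?W\<rparr>)" unfolding Hom_sub_iff[OF W] using pX im by simp
  have "factors R1 r1 R0 (?U \<oplus> N)"
    unfolding factors_def
  proof
    fix q assume q: "q \<in> Hom R1 (?U \<oplus> N)"
    let ?q1 = "restr (mcar (?U \<oplus> N)) fst \<circ> q" and ?q2 = "restr (mcar (?U \<oplus> N)) snd \<circ> q"
    have "?q1 \<in> Hom R1 ?U" "?q2 \<in> Hom R1 N"
      using Hom_comp[OF UN q Hom_fst[OF Um N]] Hom_comp[OF UN q Hom_snd[OF Um N]] .
    then obtain h1 h2 where h: "h1 \<in> Hom R0 ?U" "h1 \<circ> r1 = ?q1" "h2 \<in> Hom R0 N" "h2 \<circ> r1 = ?q2"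
      using fU fN unfolding factors_def by meson
    have "(\<lambda>x. (h1 x, h2 x)) \<circ> r1 = q"
    proof
      fix x
      have "q x \<in> mcar (?U \<oplus> N)"
        using Hom_in[OF q] Hom_out[OF q] lm_0[OF UN] by (cases "x \<in> mcar R1") auto
      moreover have "h1 (r1 x) = ?q1 x" "h2 (r1 x) = ?q2 x" using h by (metis comp_apply)+
      ultimately show "((\<lambda>x. (h1 x, h2 x)) \<circ> r1) x = q x" by simp
    qed
    then show "\<exists>h\<in>Hom R0 (?U \<oplus> N). h \<circ> r1 = q" using Hom_pair[OF h(1,3)] by blast
  qed
  then show ?thesis
    using factors_quotient[OF R UN submod_lm[OF W] p] im by simp
qed

text \<open>By the ranks, \<open>B\<close> is the direct sum of the image of \<open>f\<close> and the kernel of \<open>g\<close>.\<close>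

lemma indec_split:
  assumes A: "nice A" and B: "nice B" "indec B" and D: "nice D" and f: "f \<in> Hom A B" and g: "g \<in> Hom B D"
    and r: "r > 0" "v.dim (f ` mcar A) \<le> r" "v.dim (g ` mcar B) \<le> r" "r \<le> v.dim (g ` f ` mcar A)"
  shows "ker B g = {0}" and "f ` mcar A = mcar B"
proof -
  note Am = nice_lm[OF A] and Bm = nice_lm[OF B(1)] and Dm = nice_lm[OF D]
  let ?U = "f ` mcar A" and ?V = "ker B g"
  have U: "submod ?U B" using submod_image[OF Am Bm f submod_full[OF Am]] .
  have V: "submod ?V B" using submod_ker[OF Bm Dm g] .
  have UB: "?U \<subseteq> mcar B" using submod_subset[OF U] .
  have gU: "submod (g ` ?U) D" using submod_image[OF Bm Dm g U] .
  have gB: "submod (g ` mcar B) D" using submod_image[OF Bm Dm g submod_full[OF Bm]] .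
  have rU: "v.dim ?U = v.dim (g ` ?U) + v.dim {x \<in> ?U. g x = 0}"
    using dim_rank_nullity[OF B(1) D g U] .
  have UV: "{x \<in> ?U. g x = 0} = ?U \<inter> ?V" using UB by (auto simp: ker_def)
  have fin: "v.fin_dim (?U \<inter> ?V)" using v.fin_dim_subset[OF nice_fin[OF B(1)]] UB by blast
  have "v.dim (?U \<inter> ?V) = 0" using rU r UV by simp
  then have "?U \<inter> ?V \<subseteq> {0}" using v.dim_eq_0_fin[OF fin] by simp
  moreover have "0 \<in> ?U" "0 \<in> ?V" using U V unfolding submod_iff[OF Bm] by auto
  ultimately have i: "?U \<inter> ?V = {0}" by blast
  have e: "g ` ?U = g ` mcar B"
    using submod_eqI[OF D gU gB] UB r by (meson image_mono order_trans)
  have s: "\<forall>x\<in>mcar B. \<exists>u\<in>?U. \<exists>v\<in>?V. x = u + v"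
  proof
    fix x assume x: "x \<in> mcar B"
    then obtain u where u: "u \<in> ?U" "g x = g u" using e by (metis imageE imageI)
    then have "u \<in> mcar B" using UB by blast
    then have "x - u \<in> ?V" using x u lm_diff[OF Bm] Hom_diff[OF g Bm] by (simp add: ker_def)
    moreover have "x = u + (x - u)" by simp
    ultimately show "\<exists>u\<in>?U. \<exists>v\<in>?V. x = u + v" using u(1) by blast
  qed
  have "?U \<noteq> {0}"
  proof
    assume "?U = {0}"
    then have "g ` ?U = {0}" using Hom_0[OF g Bm] by simp
    then show False using r v.dim_zero by simp
  qed
  then show V0: "?V = {0}" using B(2) U V i s unfolding indec_def by blast
  have "mcar B \<subseteq> ?U"
  proof
    fix x assume "x \<in> mcar B"
    then obtain u v where "u \<in> ?U" "v \<in> ?V" "x = u + v" using s by blast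
    then show "x \<in> ?U" using V0 by simp
  qed
  then show "?U = mcar B" using UB by blast
qed

text \<open>
  The step of the Harada--Sai lemma: if paths of length \<open>n\<close> have rank at most \<open>r\<close>, then paths of
  length \<open>2 n + 1\<close> have smaller rank.
\<close>

lemma rank_drop:
  assumes A: "nice A" and B: "nice B" "indec B" and C: "nice C" "indec C" and D: "nice D"
    and f: "f \<in> Hom A B" and e: "e \<in> Hom B C" and g: "g \<in> Hom C D" and ni: "\<not> B \<cong> C"
    and r: "r > 0" "v.dim (f ` mcar A) \<le> r" "v.dim (g ` mcar C) \<le> r"
  shows "v.dim (g ` e ` f ` mcar A) < r"
proof (rule ccontr)
  assume "\<not> ?thesis"
  then have r': "r \<le> v.dim (g ` e ` f ` mcar A)" by simp
  note Am = nice_lm[OF A] and Bm = nice_lm[OF B(1)] and Cm = nice_lm[OF C(1)] and Dm = nice_lm[OF D]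
  have ge: "g \<circ> e \<in> Hom B D" using Hom_comp[OF Cm e g] .
  have ef: "e \<circ> f \<in> Hom A C" using Hom_comp[OF Bm f e] .
  have sub: "e ` mcar B \<subseteq> mcar C" using Hom_in[OF e] by blast
  have sA: "submod (f ` mcar A) B" using submod_image[OF Am Bm f submod_full[OF Am]] .
  have gC: "submod (g ` mcar C) D" using submod_image[OF Cm Dm g submod_full[OF Cm]] .
  have d1: "v.dim ((g \<circ> e) ` mcar B) \<le> r"
    using submod_dim_mono[OF D gC, of "(g \<circ> e) ` mcar B"] sub r(3) by (force simp: image_comp[symmetric])
  have d2: "v.dim ((e \<circ> f) ` mcar A) \<le> r"
    using dim_rank_nullity[OF B(1) C(1) e sA] r(2) by (simp add: image_comp)
  \<comment> \<open>If the rank did not drop, \<open>indec_split\<close> would apply at both ends of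
    \<open>e\<close>: at \<open>B\<close>, with \<open>g \<circ> e\<close>, it makes
    \<open>e\<close> injective, and at \<open>C\<close>, with \<open>e \<circ> f\<close>, it makes
    \<open>e\<close> surjective.\<close>
  have "ker B (g \<circ> e) = {0}"
    using indec_split(1)[OF A B D f ge r(1,2) d1] r' by (simp add: image_comp comp_assoc)
  moreover have "ker B e \<subseteq> ker B (g \<circ> e)" using Hom_0[OF g Cm] by (auto simp: ker_def)
  moreover have "0 \<in> ker B e" using lm_0[OF Bm] Hom_0[OF e Bm] by (simp add: ker_def)
  ultimately have "ker B e = {0}" by blast
  then have "inj_on e (mcar B)" using Hom_inj_iff[OF Bm e] by simp
  moreover have "e ` mcar B = mcar C"
  proof -
    have "(e \<circ> f) ` mcar A = mcar C"
      using indec_split(2)[OF A C D ef g r(1) d2 r(3)] r' by (simp add: image_comp comp_assoc)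
    moreover have "(e \<circ> f) ` mcar A \<subseteq> e ` mcar B" using Hom_in[OF f] by auto
    ultimately show ?thesis using sub by blast
  qed
  ultimately have "B \<cong> C" unfolding iso_mod_def bij_betw_def using e by blast
  with ni show False ..
qed

section \<open>The lemma of Harada and Sai for a finite family of indecomposable modules\<close>

primrec paths :: "('i \<Rightarrow> 'a seqmod) \<Rightarrow> ('i \<Rightarrow> 'i \<Rightarrow> bool) \<Rightarrow> nat \<Rightarrow> 'i \<Rightarrow> 'i
    \<Rightarrow> ((nat \<Rightarrow> 'a) \<Rightarrow> (nat \<Rightarrow> 'a)) set" where
  "paths M E 0 j i = {f. i = j \<and> f = idm (M i)}"
| "paths M E (Suc n) j i = {f \<circ> g |f g k. E k i \<and> f \<in> Hom (M k) (M i) \<and> g \<in> paths M E n j k}"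

context
  fixes M :: "'i \<Rightarrow> 'a seqmod" and E :: "'i \<Rightarrow> 'i \<Rightarrow> bool" and S :: "'i set"
  assumes finS: "finite S" and nM: "\<And>i. i \<in> S \<Longrightarrow> nice (M i)" and iM: "\<And>i. i \<in> S \<Longrightarrow> indec (M i)"
    and ES: "\<And>i j. E i j \<Longrightarrow> i \<in> S \<and> j \<in> S \<and> \<not> M i \<cong> M j"
begin

lemma paths_Hom: "h \<in> paths M E n j i \<Longrightarrow> i \<in> S \<Longrightarrow> j \<in> S \<and> h \<in> Hom (M j) (M i)"
proof (induction n arbitrary: i h)
  case 0
  then show ?case using Hom_id[OF nice_lm[OF nM]] by auto
next
  case (Suc n)
  then obtain f g k where *: "h = f \<circ> g" "E k i" "f \<in> Hom (M k) (M i)" "g \<in> paths M E n j k" by auto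
  then have "k \<in> S" using ES by blast
  then show ?case using Suc.IH[OF *(4)] * Hom_comp[OF nice_lm[OF nM]] by blast
qed

lemma paths_add:
  "h \<in> paths M E (m + n) j i \<Longrightarrow> i \<in> S \<Longrightarrow>
    \<exists>k\<in>S. \<exists>f\<in>paths M E m k i. \<exists>g\<in>paths M E n j k. \<forall>x\<in>mcar (M j). h x = f (g x)"
proof (induction m arbitrary: i h)
  case 0
  then have "h \<in> Hom (M j) (M i)" using paths_Hom[of h n j i] by simp
  then have "\<forall>x\<in>mcar (M j). h x = idm (M i) (h x)" by (auto simp: Hom_in)
  then show ?case using 0 by (intro bexI[of _ i] bexI[of _ "idm (M i)"] bexI[of _ h]) auto
next
  case (Suc m)
  then obtain f g k where *: "h = f \<circ> g" "E k i" "f \<in> Hom (M k) (M i)" "g \<in> paths M E (m + n) j k" by auto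
  then have "k \<in> S" using ES by blast
  then obtain l f' g' where l: "l \<in> S" "f' \<in> paths M E m l k" "g' \<in> paths M E n j l"
    "\<forall>x\<in>mcar (M j). g x = f' (g' x)" using Suc.IH[OF *(4)] by blast
  then have "f \<circ> f' \<in> paths M E (Suc m) l i" using * by auto
  then show ?case using l *(1) by (intro bexI[of _ l] bexI[of _ "f \<circ> f'"] bexI[of _ g']) auto
qed

text \<open>Passing from length n to 2 n + 1 lowers the bound on the rank by one: a path of the new
  length is a path of length n, a single edge, and another path of length n, and
  \<open>rank_drop\<close> applies to the edge. Because \<open>d - m\<close> is truncated
  subtraction, a bound that has already reached 0 is treated separately.\<close>

lemma paths_rank:
  assumes d: "\<And>i. i \<in> S \<Longrightarrow> v.dim (mcar (M i)) \<le> d"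
  shows "\<exists>n. \<forall>i\<in>S. \<forall>j. \<forall>h\<in>paths M E n j i. v.dim (h ` mcar (M j)) \<le> d - m"
proof (induction m)
  case 0
  have "v.dim (h ` mcar (M j)) \<le> d" if "i \<in> S" "h \<in> paths M E 0 j i" for i j h
    using that d by simp
  then show ?case by (intro exI[of _ 0]) auto
next
  case (Suc m)
  then obtain n where n: "\<And>i j h. i \<in> S \<Longrightarrow> h \<in> paths M E n j i \<Longrightarrow> v.dim (h ` mcar (M j)) \<le> d - m" by blast
  have "v.dim (h ` mcar (M j)) \<le> d - Suc m" if i: "i \<in> S" and h: "h \<in> paths M E (n + Suc n) j i" for i j h
  proof -
    obtain k f g' where k: "k \<in> S" "f \<in> paths M E n k i" "g' \<in> paths M E (Suc n) j k"
      "\<forall>x\<in>mcar (M j). h x = f (g' x)" using paths_add[OF h i] by blast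
    then obtain e g l where l: "g' = e \<circ> g" "E l k" "e \<in> Hom (M l) (M k)" "g \<in> paths M E n j l" by auto
    have lS: "l \<in> S" using ES l by blast
    have H: "j \<in> S" "f \<in> Hom (M k) (M i)" "g \<in> Hom (M j) (M l)"
      using paths_Hom[OF k(2) i] paths_Hom[OF l(4) lS] by auto
    have him: "h ` mcar (M j) = f ` e ` g ` mcar (M j)" using k(4) l(1) by (auto simp: image_iff)
    show ?thesis
    proof (cases "d - m = 0")
      case True
      have "submod (g ` mcar (M j)) (M l)"
        using submod_image[OF _ _ H(3) submod_full] nice_lm nM H(1) lS by blast
      then have "v.dim (f ` e ` g ` mcar (M j)) \<le> v.dim (g ` mcar (M j))"
        using dim_rank_nullity[of "M l" "M i" "f \<circ> e" "g ` mcar (M j)"] nM lS i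
          Hom_comp[OF nice_lm[OF nM[OF k(1)]] l(3) H(2)] by (simp add: image_comp)
      then show ?thesis using n[OF lS l(4)] True him by simp
    next
      case False
      then have "v.dim (f ` e ` g ` mcar (M j)) < d - m"
        using rank_drop[OF nM[OF H(1)] nM[OF lS] iM[OF lS] nM[OF k(1)] iM[OF k(1)] nM[OF i] H(3) l(3) H(2)]
          ES[OF l(2)] n[OF lS l(4)] n[OF i k(2)] by simp
      then show ?thesis using him by simp
    qed
  qed
  then show ?case by blast
qed

lemma paths_vanish:
  "\<exists>n. \<forall>i\<in>S. \<forall>j. \<forall>h\<in>paths M E n j i. h ` mcar (M j) \<subseteq> {0}"
proof -
  \<comment> \<open>The additional 0 keeps the maximum defined when \<open>S\<close> is
    empty.\<close>
  let ?d = "Max (insert 0 ((\<lambda>i. v.dim (mcar (M i))) ` S))"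
  obtain n where n: "\<forall>i\<in>S. \<forall>j. \<forall>h\<in>paths M E n j i. v.dim (h ` mcar (M j)) \<le> ?d - ?d"
    using paths_rank[of ?d ?d] finS by auto
  have "h ` mcar (M j) \<subseteq> {0}" if i: "i \<in> S" and h: "h \<in> paths M E n j i" for i j h
  proof -
    have H: "h \<in> Hom (M j) (M i)" using paths_Hom[OF h i] by blast
    have "v.fin_dim (h ` mcar (M j))"
      using v.fin_dim_subset[OF nice_fin[OF nM[OF i]]] Hom_in[OF H] by blast
    then show ?thesis using v.dim_eq_0_fin n i h by simp
  qed
  then show ?thesis by blast
qed

text \<open>The hypothesis \<open>gen\<close> says that each module is generated by the images of
  the maps along edges into it; speaking of submodules \<open>W\<close> containing these images
  avoids sums of arbitrary families. By induction, with \<open>W\<close> pulled back along an edge,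
  the images of paths of any length n generate too. Once all these paths vanish,
  \<open>W = {0}\<close> is admissible.\<close>

lemma generated_imp_zero:
  assumes gen: "\<And>i W. i \<in> S \<Longrightarrow> submod W (M i) \<Longrightarrow>
      (\<And>k f. E k i \<Longrightarrow> f \<in> Hom (M k) (M i) \<Longrightarrow> f ` mcar (M k) \<subseteq> W) \<Longrightarrow> W = mcar (M i)"
    and i: "i \<in> S"
  shows "mcar (M i) = {0}"
proof -
  have *: "W = mcar (M i)" if "i \<in> S" "submod W (M i)"
    "\<And>j h. h \<in> paths M E n j i \<Longrightarrow> h ` mcar (M j) \<subseteq> W" for n i W
    using that
  proof (induction n arbitrary: i W)
    case 0
    have "idm (M i) \<in> paths M E 0 i i" by simp
    then have "idm (M i) ` mcar (M i) \<subseteq> W" using 0(3) by blast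
    then show ?case using submod_subset[OF 0(2)] by auto
  next
    case (Suc n)
    show ?case
    proof (rule gen[OF Suc.prems(1,2)])
      fix k f assume k: "E k i" and f: "f \<in> Hom (M k) (M i)"
      have kS: "k \<in> S" using ES[OF k] by blast
      let ?W = "{x \<in> mcar (M k). f x \<in> W}"
      have "?W = mcar (M k)"
      proof (rule Suc.IH[OF kS])
        show "submod ?W (M k)"
          using submod_preimage[OF nice_lm[OF nM[OF kS]] nice_lm[OF nM[OF Suc.prems(1)]] f Suc.prems(2)] .
        fix j h assume h: "h \<in> paths M E n j k"
        then have "f \<circ> h \<in> paths M E (Suc n) j i" using k f by auto
        then have "(f \<circ> h) ` mcar (M j) \<subseteq> W" by (rule Suc.prems(3))
        moreover have "h \<in> Hom (M j) (M k)" using paths_Hom[OF h kS] by blast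
        ultimately show "h ` mcar (M j) \<subseteq> ?W" by (auto simp: Hom_in)
      qed
      then show "f ` mcar (M k) \<subseteq> W" by blast
    qed
  qed
  obtain n where "\<forall>i\<in>S. \<forall>j. \<forall>h\<in>paths M E n j i. h ` mcar (M j) \<subseteq> {0}" using paths_vanish by blast
  then show ?thesis using *[OF i submod_zero[OF nice_lm[OF nM[OF i]]], of n] i by blast
qed

end

end

section \<open>The number of summands of a \<open>\<tau>\<close>-rigid pair\<close>

context fd_algebra
begin

text \<open>
  The submodule \<open>U\<close> is the trace of the modules \<open>M k\<close> in \<open>X\<close>; choosing it as a maximal submodule with
  the factorization property avoids infinite sums of submodules.
\<close>

lemma maximal_factoring_submodule:
  assumes X: "nice X" and W: "submod W X"
    and K: "\<And>k. k \<in> K \<Longrightarrow> nice (M k) \<and> pres (R1 k) (r1 k) (R0 k) (r0 k) (M k)"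
    and fM: "\<And>k l. k \<in> K \<Longrightarrow> l \<in> K \<Longrightarrow> factors (R1 k) (r1 k) (R0 k) (M l)"
    and sub: "\<And>k f. k \<in> K \<Longrightarrow> f \<in> Hom (M k) X \<Longrightarrow> f ` mcar (M k) \<subseteq> W"
  obtains U where "submod U X" "U \<subseteq> W" "\<And>k. k \<in> K \<Longrightarrow> factors (R1 k) (r1 k) (R0 k) (X\<lparr>mcar := U\<rparr>)"
    "\<And>k f. k \<in> K \<Longrightarrow> f \<in> Hom (M k) X \<Longrightarrow> f ` mcar (M k) \<subseteq> U"
proof -
  note Xm = nice_lm[OF X]
  let ?G = "\<lambda>U. submod U X \<and> U \<subseteq> W \<and> (\<forall>k\<in>K. factors (R1 k) (r1 k) (R0 k) (X\<lparr>mcar := U\<rparr>))"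
  have W': "W \<subseteq> mcar X" "0 \<in> W" "\<And>x y. x \<in> W \<Longrightarrow> y \<in> W \<Longrightarrow> x + y \<in> W"
    using W unfolding submod_iff[OF Xm] by auto
  have "factors P1 p1 P0 (X\<lparr>mcar := {0}\<rparr>)" for P1 p1 P0
    unfolding factors_def
  proof
    note Z = submod_zero[OF Xm]
    fix q assume "q \<in> Hom P1 (X\<lparr>mcar := {0}\<rparr>)"
    then have "q x = 0" for x using Hom_in[of q P1 "X\<lparr>mcar := {0}\<rparr>" x] Hom_out[of q P1 "X\<lparr>mcar := {0}\<rparr>" x]
      by (cases "x \<in> mcar P1") auto
    then have "(\<lambda>x. 0) \<circ> p1 = q" by (simp add: fun_eq_iff)
    then show "\<exists>h\<in>Hom P0 (X\<lparr>mcar := {0}\<rparr>). h \<circ> p1 = q" using Hom_zero[OF submod_lm[OF Z]] by blast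
  qed
  then have "?G {0}" using submod_zero[OF Xm] W'(2) by blast
  moreover have "\<forall>U. ?G U \<longrightarrow> v.dim U < Suc (v.dim (mcar X))"
    using submod_dim_mono[OF X submod_full[OF Xm] submod_subset] by (auto simp: less_Suc_eq_le)
  ultimately obtain U where U: "?G U" and max: "\<And>V. ?G V \<Longrightarrow> v.dim V \<le> v.dim U"
    using ex_has_greatest_nat[of ?G "{0}" v.dim "Suc (v.dim (mcar X))"] by (metis order_less_imp_le)
  have "f ` mcar (M k) \<subseteq> U" if k: "k \<in> K" and f: "f \<in> Hom (M k) X" for k f
  proof -
    note Mk = nice_lm[OF K[OF k, THEN conjunct1]]
    \<comment> \<open>Enlarging \<open>U\<close> by the image of \<open>f\<close> keeps all its
      properties, since \<open>M k\<close> itself has the factorization property and the image stays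
      in \<open>W\<close>. By the maximality of the dimension nothing is added.\<close>
    let ?V = "{u + y |u y. u \<in> U \<and> y \<in> f ` mcar (M k)}"
    have fM': "submod (f ` mcar (M k)) X" using submod_image[OF Mk Xm f submod_full[OF Mk]] .
    have V: "submod ?V X" using submod_plus[OF Xm _ fM'] U by blast
    have "factors (R1 l) (r1 l) (R0 l) (X\<lparr>mcar := ?V\<rparr>)" if l: "l \<in> K" for l
      using factors_sum[OF _ _ _ Xm _ Mk f _ fM[OF l k]] presD[OF K[OF l, THEN conjunct2]] nice_lm U l by blast
    moreover have "?V \<subseteq> W" using U sub[OF k f] W'(3) by blast
    ultimately have "v.dim ?V \<le> v.dim U" using max V by blast
    moreover have "0 \<in> f ` mcar (M k)" "0 \<in> U" using fM' U unfolding submod_iff[OF Xm] by auto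
    then have "U \<subseteq> ?V" "f ` mcar (M k) \<subseteq> ?V" by (force, force)
    ultimately show ?thesis using submod_eqI[OF X _ V] U by blast
  qed
  with U show thesis by (intro that) auto
qed

text \<open>Only the coefficients \<open>c\<close> over \<open>A\<close> are treated, with arbitrary
  rather than minimal presentations, so that the projective summands can later be put in the place
  of the modules \<open>M i\<close>.\<close>

lemma coefficients_vanish:
  fixes A :: "'i set" and B :: "'j set"
  assumes fin: "finite A" "finite B"
    and M: "\<And>i. i \<in> A \<Longrightarrow> nice (M i) \<and> indec (M i) \<and> mcar (M i) \<noteq> {0} \<and> pres (R1 i) (r1 i) (R0 i) (r0 i) (M i)"
    and ni: "\<And>i j. i \<in> A \<Longrightarrow> j \<in> A \<Longrightarrow> i \<noteq> j \<Longrightarrow> \<not> M i \<cong> M j"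
    and fac: "\<And>i j. i \<in> A \<Longrightarrow> j \<in> A \<Longrightarrow> factors (R1 i) (r1 i) (R0 i) (M j)"
    and Q: "\<And>k. k \<in> B \<Longrightarrow> nice (Q k) \<and> proj (Q k)"
    and QM: "\<And>k i. k \<in> B \<Longrightarrow> i \<in> A \<Longrightarrow> Hom (Q k) (M i) = {0}"
    and c: "\<And>X. nice X \<Longrightarrow>
      (\<Sum>i\<in>A. c i * (real (hdim (R0 i) X) - real (hdim (R1 i) X))) + (\<Sum>k\<in>B. c' k * real (hdim (Q k) X)) = 0"
    and i: "i \<in> A"
  shows "c i = 0"
proof (rule ccontr)
  assume "c i \<noteq> 0"
  define S where "S = {i \<in> A. c i \<noteq> 0}"
  \<comment> \<open>Edges join indices with coefficients of opposite sign. In particular they join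
    different indices, hence non-isomorphic modules, as a path of non-isomorphisms requires.\<close>
  define E where "E k i \<longleftrightarrow> k \<in> A \<and> i \<in> A \<and> c k * c i < 0" for k i
  have finS: "finite S" using fin by (simp add: S_def)
  have nM: "nice (M i)" if "i \<in> A" for i using M that by blast
  have ES: "i \<in> S \<and> j \<in> S \<and> \<not> M i \<cong> M j" if "E i j" for i j
  proof -
    have "i \<noteq> j" using that by (auto simp: E_def not_less)
    then show ?thesis using that ni by (auto simp: E_def S_def)
  qed
  have gen: "W = mcar (M i)" if i: "i \<in> S" and W: "submod W (M i)"
    and sub: "\<And>k f. E k i \<Longrightarrow> f \<in> Hom (M k) (M i) \<Longrightarrow> f ` mcar (M k) \<subseteq> W" for i W
  proof (rule ccontr)
    assume "W \<noteq> mcar (M i)"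
    have iA: "i \<in> A" "c i \<noteq> 0" using i by (auto simp: S_def)
    note X = nM[OF iA(1)]
    note Xm = nice_lm[OF X]
    obtain U where U: "submod U (M i)" "U \<subseteq> W"
      "\<And>k. k \<in> {k. E k i} \<Longrightarrow> factors (R1 k) (r1 k) (R0 k) (M i\<lparr>mcar := U\<rparr>)"
      "\<And>k f. k \<in> {k. E k i} \<Longrightarrow> f \<in> Hom (M k) (M i) \<Longrightarrow> f ` mcar (M k) \<subseteq> U"
      by (rule maximal_factoring_submodule[OF X W, of "{k. E k i}" M R1 r1 R0 r0])
        (use M fac sub in \<open>auto simp: E_def\<close>)
    obtain Y p where Y: "nice Y" "p \<in> Hom (M i) Y" "p ` mcar (M i) = mcar Y" "ker (M i) p = U"
      using nice_quotient[OF X U(1)] by metis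
    note Ym = nice_lm[OF Y(1)]
    have "U \<noteq> mcar (M i)" using U(2) submod_subset[OF W] \<open>W \<noteq> _\<close> by blast
    then obtain x where x: "p x \<noteq> 0" using Y(4) submod_subset[OF U(1)] by (auto simp: ker_def)
    have t: "real (hdim (R0 j) Y) - real (hdim (R1 j) Y) = real (hdim (M j) Y)" if j: "j \<in> A" for j
    proof -
      have P: "pres (R1 j) (r1 j) (R0 j) (r0 j) (M j)" using M j by blast
      have "factors (R1 j) (r1 j) (R0 j) Y"
        using factors_quotient[OF presD(3)[OF P] nice_lm[OF presD(2)[OF P]] presD(5)[OF P] Xm Ym Y(2,3)
            fac[OF j iA(1)]] .
      then show ?thesis using hdim_factors[OF nM[OF j] P Y(1)] by simp
    qed
    have q: "hdim (Q k) Y = 0" if k: "k \<in> B" for k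
    proof (rule hdim_zero, rule Hom_eq_zeroI[OF Ym])
      fix f y assume f: "f \<in> Hom (Q k) Y"
      then obtain g where g: "g \<in> Hom (Q k) (M i)" "p \<circ> g = f"
        using proj_lift[OF _ Xm Ym Y(2,3) f] Q[OF k] by blast
      then have "g = 0" using QM[OF k iA(1)] by blast
      then show "f y = 0" using g(2) Hom_0[OF Y(2) Xm] by auto
    qed
    \<comment> \<open>The quotient by the trace is torsion-free. A map \<open>f\<close> from
      \<open>M k\<close> to \<open>Y\<close> lifts on \<open>R0 k\<close> to a map \<open>g\<close>
      into \<open>M i\<close> that sends the relations into \<open>U\<close>. As \<open>U\<close>
      has the factorization property, some \<open>s\<close> with values in \<open>U\<close> agrees
      with \<open>g\<close> on the relations, so \<open>g - s\<close> descends to a map from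
      \<open>M k\<close> to \<open>M i\<close>. The image of that map is in \<open>U\<close> too,
      hence so are the values of \<open>g\<close>, and \<open>f\<close> vanishes.\<close>
    have h: "hdim (M k) Y = 0" if k: "E k i" for k
    proof (rule hdim_zero, rule Hom_eq_zeroI[OF Ym])
      fix f y assume f: "f \<in> Hom (M k) Y" and y: "y \<in> mcar (M k)"
      have kA: "k \<in> A" using k by (simp add: E_def)
      have P: "pres (R1 k) (r1 k) (R0 k) (r0 k) (M k)" using M kA by blast
      note R = presD[OF P] and Mm = nice_lm[OF nM[OF kA]]
      note R1 = nice_lm[OF R(1)] and R0 = nice_lm[OF R(2)]
      obtain g where g: "g \<in> Hom (R0 k) (M i)" "p \<circ> g = f \<circ> r0 k"
        using proj_lift[OF R(4) Xm Ym Y(2,3) Hom_comp[OF Mm R(6) f]] .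
      have "(g \<circ> r1 k) ` mcar (R1 k) \<subseteq> U"
      proof
        fix z assume "z \<in> (g \<circ> r1 k) ` mcar (R1 k)"
        then obtain x where x: "x \<in> mcar (R1 k)" "z = g (r1 k x)" by auto
        have "p z = f (r0 k (r1 k x))" using g(2) x(2) by (metis comp_apply)
        then have "p z = 0" using R(9)[OF x(1)] Hom_0[OF f Mm] by simp
        then show "z \<in> U" using Y(4) x Hom_in[OF g(1) Hom_in[OF R(5)]] by (auto simp: ker_def)
      qed
      then have "g \<circ> r1 k \<in> Hom (R1 k) (M i\<lparr>mcar := U\<rparr>)"
        unfolding Hom_sub_iff[OF U(1)] using Hom_comp[OF R0 R(5) g(1)] by blast
      then obtain s where s: "s \<in> Hom (R0 k) (M i\<lparr>mcar := U\<rparr>)" "s \<circ> r1 k = g \<circ> r1 k"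
        using U(3)[of k] k unfolding factors_def by blast
      have s': "s \<in> Hom (R0 k) (M i)" "s ` mcar (R0 k) \<subseteq> U" using s(1) unfolding Hom_sub_iff[OF U(1)] by auto
      let ?d = "\<lambda>x. g x - s x"
      have d: "?d \<in> Hom (R0 k) (M i)" using Hom_minus_fun[OF R0 Xm g(1) s'(1)] .
      have "ker (R0 k) (r0 k) \<subseteq> ker (R0 k) ?d"
      proof
        fix z assume z: "z \<in> ker (R0 k) (r0 k)"
        then obtain x where "z = r1 k x" using R(8) by (metis imageE)
        then have "s z = g z" using s(2) by (metis comp_apply)
        then show "z \<in> ker (R0 k) ?d" using z by (simp add: ker_def)
      qed
      then obtain e where e: "e \<in> Hom (M k) (M i)" "e \<circ> r0 k = ?d"
        using Hom_factor[OF R0 Mm R(6,7) d] by blast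
      obtain z where z: "z \<in> mcar (R0 k)" "y = r0 k z" using y R(7) by blast
      have "e y = g z - s z" using e(2) z(2) by (metis comp_apply)
      then have "g z = e y + s z" by simp
      moreover have "e y \<in> U" "s z \<in> U" using U(4)[of k e] k e(1) y s'(2) z(1) by auto
      moreover have "p u = 0" "u \<in> mcar (M i)" if "u \<in> U" for u using Y(4) that by (auto simp: ker_def)
      ultimately have "p (g z) = 0" using Hom_add[OF Y(2), of "e y" "s z"] by simp
      then show "f y = 0" using g(2) z(2) by (metis comp_apply)
    qed
    have "0 = c i * ((\<Sum>j\<in>A. c j * (real (hdim (R0 j) Y) - real (hdim (R1 j) Y)))
        + (\<Sum>k\<in>B. c' k * real (hdim (Q k) Y)))"
      using c[OF Y(1)] by simp
    also have "\<dots> = c i * (\<Sum>j\<in>A. c j * real (hdim (M j) Y))"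
      using t q by simp
    also have "\<dots> = (\<Sum>j\<in>A. c j * c i * real (hdim (M j) Y))"
      by (simp add: sum_distrib_left mult.assoc mult.left_commute)
    \<comment> \<open>A term with negative coefficient belongs to an edge into \<open>i\<close> and
      is zero by \<open>h\<close>. The term of \<open>i\<close> is positive, because
      \<open>p\<close> is a nonzero element of Hom(M i, Y).\<close>
    also have "\<dots> > 0"
    proof (rule sum_pos2[OF fin(1) iA(1)])
      show "0 < c i * c i * real (hdim (M i) Y)"
        using hdim_pos[OF X Y(1,2) x] iA(2)
        by (auto simp: zero_less_mult_iff linorder_neq_iff)
      show "0 \<le> c j * c i * real (hdim (M j) Y)" if "j \<in> A" for j
        using h[of j] that iA(1) by (cases "c j * c i < 0") (auto simp: E_def)
    qed
    finally show False by simp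
  qed
  have "mcar (M i) = {0}"
    using generated_imp_zero[of S M E, OF finS _ _ ES gen] M i \<open>c i \<noteq> 0\<close> unfolding S_def by blast
  then show False using M[OF i] by blast
qed

theorem tau_rigid_pair_bound:
  fixes A B :: "'i set"
  assumes fin: "finite A" "finite B" and AB: "A \<inter> B = {}" and n: "num_simples TYPE('a) > 0"
    and M: "\<And>i. i \<in> A \<union> B \<Longrightarrow> nice (M i) \<and> indec (M i) \<and> mcar (M i) \<noteq> {0}"
    and ni: "\<And>i j. i \<in> A \<union> B \<Longrightarrow> j \<in> A \<union> B \<Longrightarrow> i \<noteq> j \<Longrightarrow> \<not> M i \<cong> M j"
    and R: "\<And>i. i \<in> A \<Longrightarrow> pres (R1 i) (r1 i) (R0 i) (r0 i) (M i)"
    and fac: "\<And>i j. i \<in> A \<Longrightarrow> j \<in> A \<Longrightarrow> factors (R1 i) (r1 i) (R0 i) (M j)"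
    and P: "\<And>k. k \<in> B \<Longrightarrow> proj (M k)"
    and PM: "\<And>k i. k \<in> B \<Longrightarrow> i \<in> A \<Longrightarrow> Hom (M k) (M i) = {0}"
  shows "card A + card B \<le> num_simples TYPE('a)"
proof (rule ccontr)
  assume "\<not> ?thesis"
  then have lt: "num_simples TYPE('a) < card (A \<union> B)" using card_Un_disjoint[OF fin AB] by simp
  define t where "t i X = (if i \<in> A then real (hdim (R0 i) X) - real (hdim (R1 i) X)
      else real (hdim (M i) X))" for i X
  have "additive (t i)" if "i \<in> A \<union> B" for i
  proof (cases "i \<in> A")
    case True
    then show ?thesis unfolding t_def
      using additive_diff[OF additive_hdim additive_hdim] presD(1-4)[OF R[OF True]] by simp
  next
    case False
    then show ?thesis unfolding t_def using additive_hdim M P that by simp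
  qed
  then obtain c where c: "\<exists>i\<in>A \<union> B. c i \<noteq> 0" "\<And>X. nice X \<Longrightarrow> (\<Sum>i\<in>A \<union> B. c i * t i X) = 0"
    using additive_dependence[of "A \<union> B" t] fin n lt by blast
  have c': "(\<Sum>i\<in>A. c i * (real (hdim (R0 i) X) - real (hdim (R1 i) X))) + (\<Sum>k\<in>B. c k * real (hdim (M k) X)) = 0"
    if "nice X" for X
  proof -
    have "(\<Sum>k\<in>B. c k * t k X) = (\<Sum>k\<in>B. c k * real (hdim (M k) X))"
      using AB by (intro sum.cong) (auto simp: t_def)
    then show ?thesis
      using c(2)[OF that] sum.union_disjoint[OF fin AB, of "\<lambda>i. c i * t i X"] by (simp add: t_def)
  qed
  have cA: "c i = 0" if "i \<in> A" for i
    by (rule coefficients_vanish[OF fin, of M R1 r1 R0 r0 M c c]) (use M ni R fac P PM c' that in auto)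
  \<comment> \<open>\<open>free 0\<close> is the zero module of relations. With the coefficients
    over \<open>A\<close> already zero, the remaining relation involves the modules over
    \<open>B\<close> alone, so the second family can be empty.\<close>
  have "c k = 0" if k: "k \<in> B" for k
  proof (rule coefficients_vanish[where A = B and B = "{} :: 'i set" and M = M and ?R1.0 = "\<lambda>_. free 0"
        and ?r1.0 = "\<lambda>_ _. 0" and ?R0.0 = M and ?r0.0 = "\<lambda>k. idm (M k)" and Q = M and c = c and c' = c])
    have z: "(\<lambda>_. 0) \<in> Hom (free 0) (M k)" if "k \<in> B" for k using Hom_zero[OF nice_lm] M that by blast
    have f0: "mcar (free 0 :: 'a seqmod) = {0}" by (auto simp: free_def)
    have p0: "proj (free 0 :: 'a seqmod)" by (rule proj_free)
    fix k assume k: "k \<in> B"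
    have Mk: "left_module (M k)" using M k nice_lm by blast
    have "ker (M k) (idm (M k)) = {0}" using lm_0[OF Mk] by (auto simp: ker_def)
    then show "nice (M k) \<and> indec (M k) \<and> mcar (M k) \<noteq> {0} \<and> pres (free 0) (\<lambda>_. 0) (M k) (idm (M k)) (M k)"
      unfolding pres_def using M[of k] k nice_free[of 0] p0 P[OF k] z[OF k] Hom_id[OF Mk] f0
      by simp
    show "factors (free 0) (\<lambda>_. 0) (M k) (M j)" if j: "j \<in> B" for j
      unfolding factors_def
    proof
      fix q assume q: "q \<in> Hom (free 0) (M j)"
      have "q x = 0" for x using Hom_0[OF q lm_free] Hom_out[OF q, of x] f0 by (cases "x = 0") auto
      then have "(\<lambda>_. 0) \<circ> (\<lambda>_. 0) = q" by (simp add: fun_eq_iff)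
      then show "\<exists>h\<in>Hom (M k) (M j). h \<circ> (\<lambda>_. 0) = q"
        using Hom_zero[OF nice_lm, of "M j" "M k"] M j by blast
    qed
  next
    fix X :: "'a seqmod" assume X: "nice X"
    have "hdim (free 0) X = 0"
    proof (rule hdim_zero, rule Hom_eq_zeroI[OF nice_lm[OF X]])
      fix f and x :: "nat \<Rightarrow> 'a" assume f: "f \<in> Hom (free 0) X" and x: "x \<in> mcar (free 0)"
      then have "x = 0" by (auto simp: free_def)
      then show "f x = 0" using Hom_0[OF f lm_free] by simp
    qed
    then show "(\<Sum>i\<in>B. c i * (real (hdim (M i) X) - real (hdim (free 0) X)))
        + (\<Sum>k\<in>{}. c k * real (hdim (M k) X)) = 0"
      using c'[OF X] cA by simp
  qed (use fin ni k in auto)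
  with cA c(1) show False by blast
qed

end

section \<open>Comparing two support \<open>\<tau>\<close>-tilting pairs\<close>

lemma dsum_simps:
  "f \<in> mcar (dsum I X) \<longleftrightarrow> (\<forall>i\<in>I. f i \<in> mcar (X i)) \<and> (\<forall>i. i \<notin> I \<longrightarrow> f i = 0)"
  "act (dsum I X) a f = (\<lambda>i. if i \<in> I then act (X i) a (f i) else 0)"
  by (simp_all add: dsum_def)

text \<open>\<open>basic_module\<close> and \<open>in_add\<close> look for summands on the ambient
  type of the whole sum, where \<open>X i\<close> does not live; the one-term sum is its copy
  there.\<close>

lemma iso_dsum_singleton: "left_module (X i) \<Longrightarrow> X i \<cong> dsum {i} X"
  using Hom_dsum_incl[of "{i}" X i] Hom_dsum_proj[of "{i}" X i]
  by (intro isoI[of "restr (mcar (X i)) (\<lambda>x j. if j = i then x else 0)" _ _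
        "restr (mcar (dsum {i} X)) (\<lambda>f. f i)"]) (auto simp: dsum_simps restr_def fun_eq_iff)

lemma direct_summand_dsum:
  fixes X :: "nat \<Rightarrow> ('a::{ring,monoid_mult}, 'm::ab_group_add) lmod"
  assumes X: "\<And>i. i \<in> I \<Longrightarrow> left_module (X i)" and j: "j \<in> I"
  shows "direct_summand (dsum {j} X) (dsum I X)"
proof -
  let ?J = "dsum {j} X" and ?K = "dsum (I - {j}) X"
  have lm: "left_module ?J" "left_module ?K" "left_module (dsum I X)" using X j by (auto intro!: lm_dsum)
  note lmJK = lm_msum[OF lm(1,2)]
  let ?f = "restr (mcar (?J \<oplus> ?K)) (\<lambda>(f, g). f + g)"
  let ?g = "restr (mcar (dsum I X)) (\<lambda>f. ((\<lambda>i. if i = j then f i else 0), (\<lambda>i. if i = j then 0 else f i)))"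
  have add: "f + g \<in> mcar (dsum I X)" if "f \<in> mcar ?J" "g \<in> mcar ?K" for f g
  proof -
    have "f i + g i \<in> mcar (X i)" if "i \<in> I" for i
      using \<open>f \<in> _\<close> \<open>g \<in> _\<close> that by (cases "i = j") (auto simp: dsum_simps)
    moreover have "f i + g i = 0" if "i \<notin> I" for i
      using \<open>f \<in> _\<close> \<open>g \<in> _\<close> that j by (cases "i = j") (auto simp: dsum_simps)
    ultimately show ?thesis by (simp add: dsum_simps(1))
  qed
  have "?J \<oplus> ?K \<cong> dsum I X"
  proof (rule isoI[of ?f _ _ ?g])
    show "?f \<in> Hom (?J \<oplus> ?K) (dsum I X)"
    proof (rule HomI)
      fix x assume *: "x \<in> mcar (?J \<oplus> ?K)"
      then obtain f g where x: "x = (f, g)" "f \<in> mcar ?J" "g \<in> mcar ?K" by auto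
      then show "?f x \<in> mcar (dsum I X)" using * x(1) add by simp
    next
      fix x y assume *: "x \<in> mcar (?J \<oplus> ?K)" "y \<in> mcar (?J \<oplus> ?K)"
      then show "?f (x + y) = ?f x + ?f y" using lm_add[OF lmJK *] by (auto simp: algebra_simps)
    next
      fix a x assume *: "x \<in> mcar (?J \<oplus> ?K)"
      then obtain f g where x: "x = (f, g)" "f \<in> mcar ?J" "g \<in> mcar ?K" by auto
      have "act ?J a f + act ?K a g = act (dsum I X) a (f + g)"
      proof
        fix i
        show "(act ?J a f + act ?K a g) i = act (dsum I X) a (f + g) i"
          using x(2,3) j by (cases "i = j") (auto simp: dsum_simps)
      qed
      then show "?f (act (?J \<oplus> ?K) a x) = act (dsum I X) a (?f x)"
        using lm_act[OF lmJK *, of a] * x(1) by simp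
    qed (simp add: restr_def)
    show "?g \<in> Hom (dsum I X) (?J \<oplus> ?K)"
    proof (rule HomI)
      fix x assume "x \<in> mcar (dsum I X)"
      then show "?g x \<in> mcar (?J \<oplus> ?K)" using j by (auto simp: dsum_simps)
    next
      fix x y assume *: "x \<in> mcar (dsum I X)" "y \<in> mcar (dsum I X)"
      then show "?g (x + y) = ?g x + ?g y" using lm_add[OF lm(3) *] by (auto simp: fun_eq_iff)
    next
      fix a x assume *: "x \<in> mcar (dsum I X)"
      then show "?g (act (dsum I X) a x) = act (?J \<oplus> ?K) a (?g x)"
        using lm_act[OF lm(3) *, of a] j by (auto simp: dsum_simps fun_eq_iff)
    qed (simp add: restr_def zero_prod_def)
    show "?g (?f x) = x" if "x \<in> mcar (?J \<oplus> ?K)" for x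
    proof -
      obtain f g where x1: "x = (f, g)" by (cases x)
      then have x: "x = (f, g)" "f \<in> mcar ?J" "g \<in> mcar ?K" using that by simp_all
      then have "f + g \<in> mcar (dsum I X)" by (intro add)
      then show ?thesis using x by (auto simp: dsum_simps fun_eq_iff)
    qed
    show "?f (?g y) = y" if "y \<in> mcar (dsum I X)" for y
    proof -
      have "?g y \<in> mcar (?J \<oplus> ?K)" using that j by (auto simp: dsum_simps)
      then show ?thesis using that by (auto simp: fun_eq_iff)
    qed
  qed
  then show ?thesis unfolding direct_summand_def using lm by blast
qed

lemma in_add_dsum:
  fixes X :: "nat \<Rightarrow> ('a::{ring,monoid_mult}, 'm::ab_group_add) lmod"
  assumes X: "\<And>i. i \<in> I \<Longrightarrow> left_module (X i)" and j: "j \<in> I"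
  shows "in_add (X j) (dsum I X)"
proof -
  let ?Z = "\<lambda>_ :: nat. dsum {j} X"
  have lm: "left_module (dsum {j} X)" using X j by (auto intro!: lm_dsum)
  have "X j \<cong> dsum {j} X" using iso_dsum_singleton[of X j] X[OF j] by simp
  moreover have "dsum {j} X \<cong> dsum {0} ?Z" using iso_dsum_singleton[of ?Z 0] lm by simp
  ultimately have "X j \<cong> dsum {0} ?Z"
    using iso_trans X j lm lm_dsum[of "{0}" ?Z] by blast
  moreover have "{0} = {..<1 :: nat}" by auto
  ultimately have "X j \<cong> dsum {..<1} ?Z" by simp
  moreover have "\<forall>k<1. direct_summand (?Z k) (dsum I X)" using direct_summand_dsum[of I X j] X j by simp
  ultimately show ?thesis unfolding in_add_def using X[OF j]
    by (intro conjI exI[of _ "1 :: nat"] exI[of _ ?Z])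
qed

text \<open>The sum is rewritten over indices starting from 0, with the one-term copies as summands,
  which is the shape of decomposition that \<open>basic_module\<close> quantifies over.\<close>

lemma dsum_regroup:
  fixes X :: "nat \<Rightarrow> ('a::{ring,monoid_mult}, 'm::ab_group_add) lmod"
  assumes X: "\<And>i. i \<in> {a+1..a+m} \<Longrightarrow> left_module (X i)"
  shows "dsum {a+1..a+m} X \<cong> dsum {..<m} (\<lambda>k. dsum {a+1+k} X)"
proof -
  let ?M = "dsum {a+1..a+m} X" and ?N = "dsum {..<m} (\<lambda>k. dsum {a+1+k} X)"
  have lm: "left_module ?M" "left_module ?N" using X by (auto intro!: lm_dsum)
  let ?f = "restr (mcar ?M) (\<lambda>f k i. if k < m \<and> i = a+1+k then f i else 0)"
  let ?g = "restr (mcar ?N) (\<lambda>g i. if i \<in> {a+1..a+m} then g (i - (a+1)) i else 0)"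
  have fN: "?f x \<in> mcar ?N" if "x \<in> mcar ?M" for x
    using that by (auto simp: dsum_simps)
  have gM: "?g x \<in> mcar ?M" if x: "x \<in> mcar ?N" for x
  proof -
    have "x (i - (a+1)) i \<in> mcar (X i)" if i: "i \<in> {a+1..a+m}" for i
    proof -
      have "i - (a+1) < m" "a + 1 + (i - (a+1)) = i" using i by auto
      then show ?thesis using x unfolding dsum_simps by (metis lessThan_iff singletonI)
    qed
    then show ?thesis using x by (auto simp: dsum_simps)
  qed
  show ?thesis
  proof (rule isoI[of ?f _ _ ?g])
    show "?f \<in> Hom ?M ?N"
    proof (rule HomI)
      fix x y assume *: "x \<in> mcar ?M" "y \<in> mcar ?M"
      then show "?f (x + y) = ?f x + ?f y" using lm_add[OF lm(1) *] by (auto simp: fun_eq_iff)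
    next
      fix c x assume *: "x \<in> mcar ?M"
      then show "?f (act ?M c x) = act ?N c (?f x)"
        using lm_act[OF lm(1) *, of c] by (auto simp: dsum_simps(2) fun_eq_iff)
    qed (use fN in \<open>auto simp: restr_def\<close>)
    show "?g \<in> Hom ?N ?M"
    proof (rule HomI)
      fix x y assume *: "x \<in> mcar ?N" "y \<in> mcar ?N"
      then show "?g (x + y) = ?g x + ?g y" using lm_add[OF lm(2) *] by (auto simp: fun_eq_iff)
    next
      fix c x assume *: "x \<in> mcar ?N"
      then show "?g (act ?N c x) = act ?M c (?g x)"
        using lm_act[OF lm(2) *, of c] by (auto simp: dsum_simps(2) fun_eq_iff)
    qed (use gM in \<open>auto simp: restr_def\<close>)
    show "?g (?f x) = x" if "x \<in> mcar ?M" for x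
      using fN[OF that] that by (auto simp: fun_eq_iff dsum_simps(1))
    show "?f (?g y) = y" if y: "y \<in> mcar ?N" for y
    proof (intro ext)
      fix k i
      have "y k i = 0" if "\<not> (k < m \<and> i = a+1+k)"
        using y that unfolding dsum_simps(1) by (cases "k < m") auto
      then show "?f (?g y) k i = y k i" using gM[OF y] y by auto
    qed
  qed
qed

lemma basic_dsum_not_iso:
  fixes X :: "nat \<Rightarrow> ('a::{ring,monoid_mult}, 'm::ab_group_add) lmod"
  assumes b: "basic_module (dsum {a+1..a+m} X)" and X: "\<And>i. i \<in> {a+1..a+m} \<Longrightarrow> indecomposable (X i)"
    and ij: "i \<in> {a+1..a+m}" "j \<in> {a+1..a+m}" "i \<noteq> j"
  shows "\<not> X i \<cong> X j"
proof
  assume iso: "X i \<cong> X j"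
  have lm: "left_module (X i)" if "i \<in> {a+1..a+m}" for i using X[OF that] by (simp add: indecomposable_def)
  have lmd: "left_module (dsum {i} X)" if "i \<in> {a+1..a+m}" for i using lm[OF that] by (auto intro: lm_dsum)
  have sing: "X i \<cong> dsum {i} X" if "i \<in> {a+1..a+m}" for i using iso_dsum_singleton[of X i] lm[OF that] by simp
  have "indecomposable (dsum {i} X)" if i: "i \<in> {a+1..a+m}" for i
  proof (rule indec_imp_indecomposable[OF indec_iso[OF sing[OF i] lm[OF i] lmd[OF i] indecomposable_imp_indec[OF X[OF i]]] lmd[OF i]])
    show "mcar (dsum {i} X) \<noteq> {0}"
    proof
      assume z: "mcar (dsum {i} X) = {0}"
      have "x = 0" if x: "x \<in> mcar (X i)" for x
      proof -
        have "(\<lambda>j. if j = i then x else 0) \<in> mcar (dsum {i} X)" using x by (auto simp: dsum_simps)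
        then have "(\<lambda>j. if j = i then x else 0) = 0" using z by blast
        from fun_cong[OF this, of i] show ?thesis by simp
      qed
      then have "mcar (X i) = {0}" using lm_0[OF lm[OF i]] by blast
      then show False using X[OF i] by (simp add: indecomposable_def)
    qed
  qed
  then have ind: "\<forall>k<m. indecomposable (dsum {a+1+k} X)" by auto
  have regr: "dsum {a+1..a+m} X \<cong> dsum {..<m} (\<lambda>k. dsum {a+1+k} X)" using lm by (rule dsum_regroup)
  have "\<forall>k<m. \<forall>l<m. k \<noteq> l \<longrightarrow> \<not> dsum {a+1+k} X \<cong> dsum {a+1+l} X"
    using spec[OF spec[OF b[unfolded basic_module_def, THEN conjunct2], of m], of "\<lambda>k. dsum {a+1+k} X"]
      ind regr by simp
  moreover have "i - (a+1) < m" "j - (a+1) < m" "i - (a+1) \<noteq> j - (a+1)" using ij by auto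
  ultimately have "\<not> dsum {a+1+(i-(a+1))} X \<cong> dsum {a+1+(j-(a+1))} X" by blast
  then have "\<not> dsum {i} X \<cong> dsum {j} X" using ij by simp
  moreover have "dsum {i} X \<cong> X i" using iso_sym[OF sing[OF ij(1)] lm[OF ij(1)] lmd[OF ij(1)]] .
  then have "dsum {i} X \<cong> X j" using iso_trans[OF _ iso] lm lmd ij by blast
  then have "dsum {i} X \<cong> dsum {j} X" using iso_trans[OF _ sing[OF ij(2)]] lm lmd ij by blast
  ultimately show False by blast
qed

lemma Hom_zero_iso:
  assumes "M \<cong> N" "left_module M" "left_module N" "Hom M N = {0}" shows "mcar M = {0}"
proof -
  obtain f g where fg: "f \<in> Hom M N" "g \<in> Hom N M" "\<And>x. x \<in> mcar M \<Longrightarrow> g (f x) = x"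
    using isoE[OF assms(1-3)] by metis
  then have "f = 0" using assms(4) by blast
  then have "x = 0" if "x \<in> mcar M" for x using fg(3)[OF that] Hom_0[OF fg(2) assms(3)] by simp
  then show ?thesis using lm_0[OF assms(2)] by blast
qed

text \<open>A map between the summands extends to the large modules by a retraction before it and an
  inclusion after it; the original map can be recovered from this composite.\<close>

lemma Hom_zero_retract:
  assumes "retract M P" "retract N T" "Hom P T = {0}"
    and lm: "left_module M" "left_module N" "left_module P" "left_module T"
  shows "Hom M N = {0}"
proof -
  obtain i p where ip: "i \<in> Hom M P" "p \<in> Hom P M" "\<forall>x\<in>mcar M. p (i x) = x"
    using assms(1) unfolding retract_def by blast
  obtain j q where jq: "j \<in> Hom N T" "q \<in> Hom T N" "\<forall>x\<in>mcar N. q (j x) = x"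
    using assms(2) unfolding retract_def by blast
  have "f = 0" if f: "f \<in> Hom M N" for f
  proof
    fix x
    have "j \<circ> (f \<circ> p) \<in> Hom P T" using Hom_comp[OF lm(2) Hom_comp[OF lm(1) ip(2) f] jq(1)] .
    then have z: "j \<circ> (f \<circ> p) = 0" using assms(3) by blast
    show "f x = 0 x"
    proof (cases "x \<in> mcar M")
      case True
      then have "f x = q ((j \<circ> (f \<circ> p)) (i x))" using ip(3) jq(3) Hom_in[OF f] by simp
      then show ?thesis using z Hom_0[OF jq(2) lm(4)] by simp
    next
      case False
      then show ?thesis using Hom_out[OF f] by simp
    qed
  qed
  moreover have "0 \<in> Hom M N" using Hom_zero[OF lm(2)] by (simp add: zero_fun_def)
  ultimately show ?thesis by blast
qed

context fd_algebra
begin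

text \<open>This stands for Hom(Y, \<tau>X) = 0. Ranging over all copies on sequences and all
  minimal presentations makes it independent of the choices made when a family is replaced by
  copies.\<close>

definition compatible :: "('a, 'm::ab_group_add) lmod \<Rightarrow> ('a, 'm) lmod \<Rightarrow> bool" where
  "compatible X Y \<longleftrightarrow> (\<forall>M N R1 r1 R0 r0. nice M \<and> nice N \<and> M \<cong> X \<and> N \<cong> Y \<and>
     min_proj_presentation M R1 r1 R0 r0 \<and> nice R1 \<and> nice R0 \<longrightarrow> factors R1 r1 R0 N)"

lemma compatibleI:
  assumes T: "tau_rigid scale T" and r: "retract X T" "retract Y T" and lm: "left_module X" "left_module Y"
  shows "compatible X Y"
  unfolding compatible_def
proof (intro allI impI, elim conjE)
  fix M N R1 r1 R0 r0
  assume *: "nice M" "nice N" "M \<cong> X" "N \<cong> Y" "min_proj_presentation M R1 r1 R0 r0" "nice R1" "nice R0"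
  have Tm: "left_module T" using T by (simp add: tau_rigid_def fg_module_def)
  have "retract M T" "retract N T"
    using retract_trans[OF retract_iso r(1)] retract_trans[OF retract_iso r(2)] * lm Tm nice_lm by blast+
  then show "factors R1 r1 R0 N" using tau_rigid_factors[OF T nice_lm[OF *(1)] *(5-7,2)] by blast
qed

lemma compatible_family_bound:
  fixes Z :: "'i \<Rightarrow> ('a, 'm::ab_group_add) lmod"
  assumes fin: "finite A" "finite B" and AB: "A \<inter> B = {}" and n: "num_simples TYPE('a) > 0"
    and Z: "\<And>i. i \<in> A \<union> B \<Longrightarrow> fg_module (Z i) \<and> indecomposable (Z i)"
    and ni: "\<And>i j. i \<in> A \<union> B \<Longrightarrow> j \<in> A \<union> B \<Longrightarrow> i \<noteq> j \<Longrightarrow> \<not> Z i \<cong> Z j"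
    and comp: "\<And>i j. i \<in> A \<Longrightarrow> j \<in> A \<Longrightarrow> compatible (Z i) (Z j)"
    and P: "\<And>k. k \<in> B \<Longrightarrow> proj (Z k)"
    and PZ: "\<And>k i. k \<in> B \<Longrightarrow> i \<in> A \<Longrightarrow> Hom (Z k) (Z i) = {0}"
  shows "card A + card B \<le> num_simples TYPE('a)"
proof -
  have lm: "left_module (Z i)" if "i \<in> A \<union> B" for i using Z[OF that] by (simp add: fg_module_def)
  have "\<exists>N. nice N \<and> Z i \<cong> N" if "i \<in> A \<union> B" for i using nice_copy Z[OF that] by metis
  then obtain M where M: "\<And>i. i \<in> A \<union> B \<Longrightarrow> nice (M i)" "\<And>i. i \<in> A \<union> B \<Longrightarrow> Z i \<cong> M i" by metis
  have Mm: "left_module (M i)" if "i \<in> A \<union> B" for i using nice_lm M(1)[OF that] by blast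
  have MZ: "M i \<cong> Z i" if "i \<in> A \<union> B" for i using iso_sym[OF M(2) lm Mm] that by blast
  have "\<exists>R. case R of (R1, r1, R0, r0) \<Rightarrow> min_proj_presentation (M i) R1 r1 R0 r0 \<and> nice R1 \<and> nice R0"
    if i: "i \<in> A \<union> B" for i
  proof -
    obtain R1 r1 R0 r0 where "min_proj_presentation (M i) R1 r1 R0 r0" "nice R1" "nice R0"
      using min_presentation_exists[OF nice_fg[OF M(1)[OF i]]] .
    then show ?thesis by (intro exI[of _ "(R1, r1, R0, r0)"]) simp
  qed
  then have "\<exists>R. \<forall>i\<in>A \<union> B.
    (case R i of (R1, r1, R0, r0) \<Rightarrow> min_proj_presentation (M i) R1 r1 R0 r0 \<and> nice R1 \<and> nice R0)"
    by (intro bchoice ballI)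
  then obtain R where R: "\<forall>i\<in>A \<union> B.
    (case R i of (R1, r1, R0, r0) \<Rightarrow> min_proj_presentation (M i) R1 r1 R0 r0 \<and> nice R1 \<and> nice R0)" ..
  define R1 r1 R0 r0 where "R1 i = fst (R i)" and "r1 i = fst (snd (R i))"
    and "R0 i = fst (snd (snd (R i)))" and "r0 i = snd (snd (snd (R i)))" for i
  have mp: "min_proj_presentation (M i) (R1 i) (r1 i) (R0 i) (r0 i) \<and> nice (R1 i) \<and> nice (R0 i)"
    if "i \<in> A \<union> B" for i
    using bspec[OF R that] by (simp add: R1_def r1_def R0_def r0_def case_prod_beta)
  show ?thesis
  proof (rule tau_rigid_pair_bound[OF fin AB n, of M R1 r1 R0 r0])
    fix i assume i: "i \<in> A \<union> B"
    have ind: "indecomposable (Z i)" using Z[OF i] by blast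
    have "indec (M i)" using indec_iso[OF M(2)[OF i] lm[OF i] Mm[OF i] indecomposable_imp_indec[OF ind]] .
    moreover have "mcar (M i) \<noteq> {0}"
    proof
      assume z: "mcar (M i) = {0}"
      have "Hom (Z i) (M i) = {0}"
        by (rule Hom_eq_zeroI[OF Mm[OF i]]) (use z Hom_in in fastforce)
      then have "mcar (Z i) = {0}" using Hom_zero_iso[OF M(2)[OF i] lm[OF i] Mm[OF i]] by blast
      then show False using ind by (simp add: indecomposable_def)
    qed
    ultimately show "nice (M i) \<and> indec (M i) \<and> mcar (M i) \<noteq> {0}" using M(1)[OF i] by blast
    fix j assume j: "j \<in> A \<union> B" and ij: "i \<noteq> j"
    show "\<not> M i \<cong> M j"
    proof
      assume "M i \<cong> M j"
      then have "Z i \<cong> M j" using iso_trans[OF M(2)[OF i]] lm Mm i j by blast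
      then have "Z i \<cong> Z j" using iso_trans[OF _ MZ[OF j]] lm Mm i j by blast
      then show False using ni[OF i j ij] by blast
    qed
  next
    fix i assume i: "i \<in> A"
    then have mi: "min_proj_presentation (M i) (R1 i) (r1 i) (R0 i) (r0 i)" "nice (R1 i)" "nice (R0 i)"
      using mp by auto
    show "pres (R1 i) (r1 i) (R0 i) (r0 i) (M i)"
      unfolding pres_def using min_presentationD[OF mi(1) Mm] mi(2,3) i by simp
    show "factors (R1 i) (r1 i) (R0 i) (M j)" if j: "j \<in> A" for j
      using comp[OF i j] mi M(1)[of i] M(1)[of j] MZ[of i] MZ[of j] i j unfolding compatible_def by blast
  next
    fix k assume k: "k \<in> B"
    show "proj (M k)"
      using proj_retract[OF retract_iso[OF MZ Mm lm] P[OF k] Mm] k by blast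
    show "Hom (M k) (M i) = {0}" if i: "i \<in> A" for i
      using Hom_zero_retract[OF retract_iso[OF MZ Mm lm] retract_iso[OF MZ Mm lm] PZ[OF k i] Mm Mm lm lm] i k
      by blast
  qed
qed

lemma basic_pair_summands:
  fixes X :: "nat \<Rightarrow> ('a, 'm::ab_group_add) lmod"
  assumes r: "r \<le> n" and X: "\<And>i. i \<in> {1..n} \<Longrightarrow> fg_module (X i) \<and> indecomposable (X i)"
    and b: "basic_support_tau_tilting_pair scale (dsum {1..r} X) (dsum {r+1..n} X)"
  shows "\<And>i j. i \<in> {1..n} \<Longrightarrow> j \<in> {1..n} \<Longrightarrow> i \<noteq> j \<Longrightarrow> \<not> X i \<cong> X j"
    and "\<And>i j. i \<in> {1..r} \<Longrightarrow> j \<in> {1..r} \<Longrightarrow> compatible (X i) (X j)"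
    and "\<And>k. k \<in> {r+1..n} \<Longrightarrow> proj (X k)"
    and "\<And>k i. k \<in> {r+1..n} \<Longrightarrow> i \<in> {1..r} \<Longrightarrow> Hom (X k) (X i) = {0}"
proof -
  let ?T = "dsum {1..r} X" and ?P = "dsum {r+1..n} X"
  have T: "tau_rigid scale ?T" and P: "fg_module ?P" "projective ?P" and PT: "Hom ?P ?T = {0}"
    and bT: "basic_module ?T" and bP: "basic_module ?P"
    using b unfolding basic_support_tau_tilting_pair_def support_tau_tilting_pair_def tau_rigid_pair_def by auto
  have lm: "left_module (X i)" if "i \<in> {1..n}" for i using X[OF that] by (simp add: fg_module_def)
  have lmT: "left_module ?T" "left_module ?P" using lm r by (auto intro!: lm_dsum)
  have rT: "retract (X i) ?T" if "i \<in> {1..r}" for i using that r lm by (intro retract_dsum) auto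
  have rP: "retract (X i) ?P" if "i \<in> {r+1..n}" for i using that lm by (intro retract_dsum) auto
  show "compatible (X i) (X j)" if "i \<in> {1..r}" "j \<in> {1..r}" for i j
    using compatibleI[OF T rT[OF that(1)] rT[OF that(2)]] lm that r by simp
  show "proj (X k)" if k: "k \<in> {r+1..n}" for k
    using proj_retract[OF rP[OF k] projective_imp_proj[OF P(2,1)]] lm k by simp
  show HPT: "Hom (X k) (X i) = {0}" if "k \<in> {r+1..n}" "i \<in> {1..r}" for k i
    using Hom_zero_retract[OF rP[OF that(1)] rT[OF that(2)] PT _ _ lmT(2,1)] lm that r by simp
  \<comment> \<open>Basicness of the two parts says nothing about a projective summand against a
    module summand; here an isomorphism would be a nonzero element of a zero Hom group.\<close>
  have cross: "\<not> X k \<cong> X i" if "k \<in> {r+1..n}" "i \<in> {1..r}" for k i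
    using Hom_zero_iso[OF _ _ _ HPT[OF that]] lm[of k] lm[of i] X[of k] that r
    by (auto simp: indecomposable_def)
  show "\<not> X i \<cong> X j" if ij: "i \<in> {1..n}" "j \<in> {1..n}" "i \<noteq> j" for i j
  proof -
    consider "i \<le> r" "j \<le> r" | "i > r" "j > r" | "i > r" "j \<le> r" | "i \<le> r" "j > r" by linarith
    then show ?thesis
    proof cases
      case 1
      then show ?thesis using basic_dsum_not_iso[of 0 r X i j] bT X ij r by simp
    next
      case 2
      then show ?thesis using basic_dsum_not_iso[of r "n - r" X i j] bP X ij r by simp
    next
      case 3
      then show ?thesis using cross ij by simp
    next
      case 4
      then have "\<not> X j \<cong> X i" using cross ij by simp
      then show ?thesis using iso_sym lm ij by blast
    qed
  qed
qed

end

theorem theorem2p1: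
  fixes scale :: "'k::field \<Rightarrow> 'a::{ring,monoid_mult} \<Rightarrow> 'a"
    and X Y :: "nat \<Rightarrow> ('a, 'm::ab_group_add) lmod"
    and n r r' :: nat
  assumes "fd_algebra scale"
    and "basic_module (regular :: ('a, 'a) lmod)"
    and "n = num_simples TYPE('a)"
    and "r \<le> n" and "r' \<le> n"
    and "\<And>i. i \<in> {1..n} \<Longrightarrow> fg_module (X i) \<and> indecomposable (X i)"
    and "\<And>i. i \<in> {1..n} \<Longrightarrow> fg_module (Y i) \<and> indecomposable (Y i)"
    and "T = dsum {1..r} X" and "P = dsum {r+1..n} X"
    and "T' = dsum {1..r'} Y" and "P' = dsum {r'+1..n} Y"
    and "basic_support_tau_tilting_pair scale T P"
    and "basic_support_tau_tilting_pair scale T' P'"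
  shows "\<exists>s b. s permutes {1..n} \<and>
           bij_betw b (X ` {1..n}) (Y ` {1..n}) \<and> (\<forall>i\<in>{1..n}. b (X i) = Y (s i)) \<and>
           (\<forall>i\<in>{1..n}.
              X i \<cong> Y (s i) \<or>
              \<not> tau_rigid scale (X i \<oplus> Y (s i)) \<or>
              (in_add (Y (s i)) P' \<and> \<not> tau_rigid_pair scale (X i) (Y (s i))) \<or>
              (in_add (X i) P \<and> \<not> tau_rigid_pair scale (Y (s i)) (X i)))"
proof -
  interpret fd_algebra scale by fact
  note X = assms(6) and Y = assms(7) and r = assms(4) and r' = assms(5)
  have bX: "basic_support_tau_tilting_pair scale (dsum {1..r} X) (dsum {r+1..n} X)"
    and bY: "basic_support_tau_tilting_pair scale (dsum {1..r'} Y) (dsum {r'+1..n} Y)"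
    using assms(8-13) by simp_all
  note XX = basic_pair_summands[OF r X bX] and YY = basic_pair_summands[OF r' Y bY]
  have lmX: "left_module (X i)" and lmY: "left_module (Y i)" if "i \<in> {1..n}" for i
    using X[OF that] Y[OF that] by (auto simp: fg_module_def)
  define R where "R i j \<longleftrightarrow> X i \<cong> Y j \<or> \<not> tau_rigid scale (X i \<oplus> Y j) \<or>
              (in_add (Y j) P' \<and> \<not> tau_rigid_pair scale (X i) (Y j)) \<or>
              (in_add (X i) P \<and> \<not> tau_rigid_pair scale (Y j) (X i))" for i j
  let ?N = "\<lambda>i. {j \<in> {1..n}. R i j}"
  have hall: "card J \<le> card (\<Union>(?N ` J))" if J: "J \<subseteq> {1..n}" for J
  proof (cases "n = 0")
    \<comment> \<open>The bound on families asks for a positive number of simple modules; for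
      \<open>n = 0\<close> the set \<open>J\<close> is empty.\<close>
    case True
    then show ?thesis using J by simp
  next
    case False
    define K where "K = {1..n} - \<Union>(?N ` J)"
    have K: "K \<subseteq> {1..n}" by (auto simp: K_def)
    have JK: "\<not> X i \<cong> Y j" "tau_rigid scale (X i \<oplus> Y j)"
      "in_add (Y j) P' \<Longrightarrow> tau_rigid_pair scale (X i) (Y j)"
      "in_add (X i) P \<Longrightarrow> tau_rigid_pair scale (Y j) (X i)" if "i \<in> J" "j \<in> K" for i j
      using that unfolding K_def R_def by blast+
    have YX: "\<not> Y j \<cong> X i" if "i \<in> J" "j \<in> K" for i j
      using JK(1)[OF that] iso_sym[of "Y j" "X i"] lmX lmY that J K by blast
    \<comment> \<open>Conditions (c) and (d) speak only about modules in the additive closure of the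
      projective part, which is verified for the indices beyond \<open>r\<close> and
      \<open>r'\<close>. Their failure then provides the vanishing of Hom between the two
      families.\<close>
    have addP: "in_add (X k) P" if "k \<in> J" "k > r" for k
      unfolding assms(9) using in_add_dsum[of "{r+1..n}" X k] lmX that J by auto
    have addP': "in_add (Y k) P'" if "k \<in> K" "k > r'" for k
      unfolding assms(11) using in_add_dsum[of "{r'+1..n}" Y k] lmY that K by auto
    have NX: "\<not> X i \<cong> X j" if "i \<in> J" "j \<in> J" "i \<noteq> j" for i j
      using XX(1) that J by blast
    have NY: "\<not> Y i \<cong> Y j" if "i \<in> K" "j \<in> K" "i \<noteq> j" for i j
      using YY(1) that K by blast
    have XY: "compatible (X i) (Y j)" "compatible (Y j) (X i)" if "i \<in> J" "j \<in> K" for i j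
    proof -
      have "left_module (X i)" "left_module (Y j)" using that J K lmX lmY by auto
      then show "compatible (X i) (Y j)" "compatible (Y j) (X i)"
        using compatibleI[OF JK(2)[OF that]] retract_msum[of "X i" "Y j"] by blast+
    qed
    have HXY: "Hom (X k) (Y j) = {0}" if "k \<in> J" "k > r" "j \<in> K" for k j
      using JK(4)[OF that(1,3) addP[OF that(1,2)]] by (simp add: tau_rigid_pair_def)
    have HYX: "Hom (Y k) (X i) = {0}" if "k \<in> K" "k > r'" "i \<in> J" for k i
      using JK(3)[OF that(3,1) addP'[OF that(1,2)]] by (simp add: tau_rigid_pair_def)
    have fin: "finite J" "finite K" using J K finite_subset by blast+
    \<comment> \<open>The sum type keeps the two families apart: \<open>A\<close> collects the
      module summands of both pairs and \<open>B\<close> the projective ones.\<close>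
    define A where "A = Inl ` {i \<in> J. i \<le> r} \<union> Inr ` {j \<in> K. j \<le> r'}"
    define B where "B = Inl ` {i \<in> J. i > r} \<union> Inr ` {j \<in> K. j > r'}"
    let ?Z = "case_sum X Y"
    have finAB: "finite A" "finite B" using fin by (auto simp: A_def B_def)
    have AB: "A \<inter> B = {}" by (auto simp: A_def B_def)
    have un: "A \<union> B = J <+> K" by (auto simp: A_def B_def Plus_def image_iff)
    have "card A + card B \<le> num_simples TYPE('a)"
    proof (rule compatible_family_bound[OF finAB AB, of ?Z])
      show "0 < num_simples TYPE('a)" using False assms(3) by simp
      show "fg_module (?Z i) \<and> indecomposable (?Z i)" if "i \<in> A \<union> B" for i
        using that X Y J K unfolding un by auto
      show "\<not> ?Z i \<cong> ?Z j" if "i \<in> A \<union> B" "j \<in> A \<union> B" "i \<noteq> j" for i j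
        using that JK(1) YX NX NY unfolding un by (cases i; cases j) auto
      show "compatible (?Z i) (?Z j)" if "i \<in> A" "j \<in> A" for i j
        using that XY XX(2) YY(2) J K unfolding A_def by (auto simp: subset_iff)
      show "proj (?Z k)" if "k \<in> B" for k
        using that XX(3) YY(3) J K unfolding B_def by (auto simp: subset_iff)
      show "Hom (?Z k) (?Z i) = {0}" if "k \<in> B" "i \<in> A" for k i
        using that HXY HYX XX(4) YY(4) J K unfolding A_def B_def by (auto simp: subset_iff)
    qed
    also have "card A + card B = card J + card K"
      using card_Un_disjoint[OF finAB AB] un card_Plus[OF fin] by simp
    finally have le: "card J + card K \<le> n" using assms(3) by simp
    define U where "U = \<Union>(?N ` J)"
    have U: "U \<subseteq> {1..n}" "K = {1..n} - U" by (auto simp: U_def K_def)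
    have "card K = n - card U" unfolding U(2) using U(1) by (simp add: card_Diff_subset finite_subset)
    moreover have "card U \<le> n" using card_mono[OF _ U(1)] by simp
    ultimately have "card J \<le> card U" using le by linarith
    then show ?thesis by (simp add: U_def)
  qed
  obtain s where s: "inj_on s {1..n}" "\<forall>i\<in>{1..n}. s i \<in> ?N i"
    using marriage[of "{1..n}" ?N] hall by auto
  \<comment> \<open>A permutation of \<open>{1..n}\<close> has to fix all other numbers, on which
    \<open>s\<close> is arbitrary.\<close>
  define p where "p i = (if i \<in> {1..n} then s i else i)" for i
  have "s ` {1..n} \<subseteq> {1..n}" using s(2) by auto
  then have "s ` {1..n} = {1..n}" using s(1) by (intro card_subset_eq) (auto simp: card_image)
  then have "bij_betw s {1..n} {1..n}" using s(1) by (simp add: bij_betw_def)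
  then have "bij_betw p {1..n} {1..n}"
    using bij_betw_cong[of "{1..n}" p s] by (simp add: p_def)
  then have p: "p permutes {1..n}" by (rule bij_imp_permutes) (auto simp: p_def)
  \<comment> \<open>Non-isomorphic modules are in particular different, so a module determines its
    index and the permutation induces a map between the two sets of modules.\<close>
  have iX: "inj_on X {1..n}"
  proof (rule inj_onI, rule ccontr)
    fix i j assume *: "i \<in> {1..n}" "j \<in> {1..n}" "X i = X j" "i \<noteq> j"
    have "\<not> X i \<cong> X j" using XX(1)[OF _ *(1,2,4)] by blast
    then show False using iso_refl[OF lmX[OF *(1)]] *(3) by simp
  qed
  have iY: "inj_on Y {1..n}"
  proof (rule inj_onI, rule ccontr)
    fix i j assume *: "i \<in> {1..n}" "j \<in> {1..n}" "Y i = Y j" "i \<noteq> j"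
    have "\<not> Y i \<cong> Y j" using YY(1)[OF _ *(1,2,4)] by blast
    then show False using iso_refl[OF lmY[OF *(1)]] *(3) by simp
  qed
  define b where "b = Y \<circ> p \<circ> inv_into {1..n} X"
  have "bij_betw b (X ` {1..n}) (Y ` {1..n})"
    unfolding b_def
    using bij_betw_trans[OF bij_betw_trans[OF bij_betw_inv_into[OF inj_on_imp_bij_betw[OF iX]] permutes_imp_bij[OF p]]
        inj_on_imp_bij_betw[OF iY]] by (simp add: comp_assoc)
  moreover have "\<forall>i\<in>{1..n}. b (X i) = Y (p i)" using iX by (simp add: b_def)
  moreover have "\<forall>i\<in>{1..n}. R i (p i)" using s(2) by (simp add: p_def)
  ultimately show ?thesis unfolding R_def using p by blast
qed

end
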